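(* For $N\in\{2,3,4,5,6,7,8,9,10,12,13,16,18,25\}$ let $h_N$ be the function, holomorphic near $t=0$, defined in the context. Write $F(x)={}_2F_1(\tfrac1{12},\tfrac5{12};1;x)$, $a(t)=\frac{12^3t}{(t+16)^3}$, $b(t)=\frac{12^3t}{(t+27)(t+3)^3}$, $c(t)=\frac{12^3t}{(t^2+10t+5)^3}$, $p(t)=(t+6)(t^3+18t^2+84t+24)$, and let $f\circ g$ denote $f(g(t))$. Then near $t=0$ (all fractional powers equal to $1$ at $t=0$, and equalities between arguments of $F$ meaning that the rational functions coincide): $h_2=[16^{-1}(t+16)]^{-1/4}F(a(t))$ $h_3=[3^{-6}(t+27)(t+3)^3]^{-1/12}F(b(t))$ $h_4=[16^{-1}(t+16)\circ t(t+16)]^{-1/4}F\bigl(a\circ t(t+16)\bigr)$ $h_5=[5^{-1}(t^2+10t+5)]^{-1/4}F(c(t))$ $h_6=[144^{-1}p(t)]^{-1/4}F\bigl(a\circ\frac{t(t+8)^3}{t+9}=b\circ\frac{t(t+9)^2}{t+8}\bigr)$ $h_7=[49^{-1}(t^2+13t+49)(t^2+5t+1)^3]^{-1/12}F\Bigl(\frac{12^3t}{(t^2+13t+49)(t^2+5t+1)^3}\Bigr)$ $h_8=[16^{-1}(t+16)\circ t(t+16)\circ t(t+8)]^{-1/4}F\bigl(a\circ t(t+16)\circ t(t+8)\bigr)$ $h_9=[3^{-6}(t+27)(t+3)^3\circ t(t^2+9t+27)]^{-1/12}F\bigl(b\circ t(t^2+9t+27)\bigr)$ $h_{10}=[80^{-1}(t^6+20t^5+160t^4+640t^3+1280t^2+1040t+80)]^{-1/4}F\bigl(a\circ\frac{t(t+4)^5}{t+5}=c\circ\frac{t(t+5)^2}{t+4}\bigr)$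 $h_{12}=[144^{-1}p\circ t(t+6)]^{-1/4}F\bigl(a\circ\frac{t(t+8)^3}{t+9}\circ t(t+6)=b\circ\frac{t(t+9)^2}{t+8}\circ t(t+6)=a\circ t(t+16)\circ\frac{t(t+4)^3}{t+3}\bigr)$ $h_{13}=[13^{-1}(t^2+5t+13)(t^4+7t^3+20t^2+19t+1)^3]^{-1/12}F\Bigl(\frac{12^3t}{(t^2+5t+13)(t^4+7t^3+20t^2+19t+1)^3}\Bigr)$ $h_{16}=[16^{-1}(t+16)\circ t(t+16)\circ t(t+8)\circ t(t+4)]^{-1/4}F\bigl(a\circ t(t+16)\circ t(t+8)\circ t(t+4)\bigr)$ $h_{18}=[144^{-1}p\circ t(t^2+6t+12)]^{-1/4}F\bigl(a\circ\frac{t(t+8)^3}{t+9}\circ t(t^2+6t+12)=b\circ\frac{t(t+9)^2}{t+8}\circ t(t^2+6t+12)=b\circ t(t^2+9t+27)\circ\frac{t(t+3)^2}{t+2}\bigr)$ $h_{25}=[5^{-1}(t^2+10t+5)\circ t(t^4+5t^3+15t^2+25t+25)]^{-1/4}F\bigl(c\circ t(t^4+5t^3+15t^2+25t+25)\bigr)$.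
   Context: $j=q^{-1}+744+\cdots$ ($q=e^{2\pi i\tau}$) is the elliptic modular invariant; $[m]=\eta(m\tau)$ with $\eta$ the Dedekind eta function. The canonical Hauptmodul $t_N$, a generator of the function field of the genus-zero curve $X_0(N)$, is: $t_2=2^{12}[2]^{24}/[1]^{24}$, $t_3=3^6[3]^{12}/[1]^{12}$, $t_4=2^8[4]^8/[1]^8$, $t_5=5^3[5]^6/[1]^6$, $t_6=2^33^2[2][6]^5/([1]^5[3])$, $t_7=7^2[7]^4/[1]^4$, $t_8=2^5[2]^2[8]^4/([1]^4[4]^2)$, $t_9=3^3[9]^3/[1]^3$, $t_{10}=2^2\cdot5\,[2][10]^3/([1]^3[5])$, $t_{12}=2^2\cdot3\,[2]^2[3][12]^3/([1]^3[4][6]^2)$, $t_{13}=13[13]^2/[1]^2$, $t_{16}=2^3[2][16]^2/([1]^2[8])$, $t_{18}=2\cdot3\,[2][3][18]^2/([1]^2[6][9])$, $t_{25}=5[25]/[1]$. Write $j=P_N(t_N)/Q_N(t_N)$ with coprime polynomials $P_N,Q_N$ (so $Q_N(0)=0$). Near $t=0$, $h_N(t)=[P_N(t)/P_N(0)]^{-1/12}\,{}_2F_1\bigl(\tfrac1{12},\tfrac5{12};1;12^3Q_N(t)/P_N(t)\bigr)$ (power equal to $1$ at $t=0$). *)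

theory Defs
  imports "HOL-Analysis.Analysis"
begin

definition dedekind_eta :: "complex \<Rightarrow> complex" where
  "dedekind_eta \<tau> =
     exp (2 * of_real pi * \<i> * \<tau> / 24) * (\<Prod>n. 1 - exp (2 * of_real pi * \<i> * \<tau>) ^ Suc n)"

definition eisenstein_E4 :: "complex \<Rightarrow> complex" where
  "eisenstein_E4 \<tau> =
     1 + 240 * (\<Sum>n. of_nat (\<Sum>d | d dvd Suc n. d ^ 3) * exp (2 * of_real pi * \<i> * \<tau>) ^ Suc n)"

(* The elliptic modular invariant as E4^3 / Delta, where Delta = eta^24 is the normalised
   discriminant; thus j = q^{-1} + 744 + ... *)
definition elliptic_j :: "complex \<Rightarrow> complex" where
  "elliptic_j \<tau> = eisenstein_E4 \<tau> ^ 3 / dedekind_eta \<tau> ^ 24"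

definition levels :: "nat set" where
  "levels = {2, 3, 4, 5, 6, 7, 8, 9, 10, 12, 13, 16, 18, 25}"

(* The value 0 outside levels is junk. *)
definition hauptmodul :: "nat \<Rightarrow> complex \<Rightarrow> complex" where
  "hauptmodul N \<tau> =
     (let e = (\<lambda>m::nat. dedekind_eta (of_nat m * \<tau>)) in
      if N = 2 then 2^12 * e 2 ^ 24 / e 1 ^ 24
      else if N = 3 then 3^6 * e 3 ^ 12 / e 1 ^ 12
      else if N = 4 then 2^8 * e 4 ^ 8 / e 1 ^ 8
      else if N = 5 then 5^3 * e 5 ^ 6 / e 1 ^ 6
      else if N = 6 then 2^3 * 3^2 * (e 2 * e 6 ^ 5) / (e 1 ^ 5 * e 3)
      else if N = 7 then 7^2 * e 7 ^ 4 / e 1 ^ 4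
      else if N = 8 then 2^5 * (e 2 ^ 2 * e 8 ^ 4) / (e 1 ^ 4 * e 4 ^ 2)
      else if N = 9 then 3^3 * e 9 ^ 3 / e 1 ^ 3
      else if N = 10 then 2^2 * 5 * (e 2 * e 10 ^ 3) / (e 1 ^ 3 * e 5)
      else if N = 12 then 2^2 * 3 * (e 2 ^ 2 * e 3 * e 12 ^ 3) / (e 1 ^ 3 * e 4 * e 6 ^ 2)
      else if N = 13 then 13 * e 13 ^ 2 / e 1 ^ 2
      else if N = 16 then 2^3 * (e 2 * e 16 ^ 2) / (e 1 ^ 2 * e 8)
      else if N = 18 then 2 * 3 * (e 2 * e 3 * e 18 ^ 2) / (e 1 ^ 2 * e 6 * e 9)
      else if N = 25 then 5 * e 25 / e 1
      else 0)"

definition hyp_F :: "complex \<Rightarrow> complex" where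
  "hyp_F x = eval_fps (fps_hypergeo [1/12, 5/12] [1] 1) x"

(* Only used near t = 0, where poly P t / poly P 0 is close to 1; the principal branch of the
   power is then the holomorphic branch with value 1 at t = 0. *)
definition h_fun :: "complex poly \<Rightarrow> complex poly \<Rightarrow> complex \<Rightarrow> complex" where
  "h_fun P Q t = (poly P t / poly P 0) powr (-1/12) * hyp_F (12^3 * poly Q t / poly P t)"

(* Equality of rational functions given by expressions that may have poles: agreement at all
   but finitely many points. *)
definition same_ratfun :: "(complex \<Rightarrow> complex) \<Rightarrow> (complex \<Rightarrow> complex) \<Rightarrow> bool" where
  "same_ratfun f g \<longleftrightarrow> finite {t. f t \<noteq> g t}"

definition a_fun :: "complex \<Rightarrow> complex" where
  "a_fun t = 12^3 * t / (t + 16)^3"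

definition b_fun :: "complex \<Rightarrow> complex" where
  "b_fun t = 12^3 * t / ((t + 27) * (t + 3)^3)"

definition c_fun :: "complex \<Rightarrow> complex" where
  "c_fun t = 12^3 * t / (t^2 + 10*t + 5)^3"

definition p_fun :: "complex \<Rightarrow> complex" where
  "p_fun t = (t + 6) * (t^3 + 18*t^2 + 84*t + 24)"

end

theory Submission
  imports Defs "HOL-Complex_Analysis.Complex_Analysis"
begin

text \<open>
  Everything is reduced to the expansions at the cusp \<open>\<i>\<infinity>\<close>.  The inversion formula of the eta function,
  up to a constant factor of modulus 1, comes from interchanging a conditionally convergent sum over a lattice.
  It shows that \<open>t\<^sub>N \<circ> \<gamma> = \<zeta> t\<^sub>N\<close> with \<open>|\<zeta>| = 1\<close> for \<open>\<gamma>\<close> in the congruence subgroup of level \<open>N\<close>, and it bounds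
  the order of the pole of \<open>t\<^sub>N\<close> at every cusp.  The modularity of \<open>j\<close> is a consequence of the hypothesis: as a
  function of \<open>t\<^sub>2\<close> and as a function of \<open>t\<^sub>3\<close>, the function \<open>j(-1/\<tau>)\<close> has the periods 2 and 3.  Since \<open>j\<close> is a
  rational function of \<open>t\<^sub>N\<close> with a simple pole at 0, also \<open>\<zeta> = 1\<close>.  A modular function for the congruence
  subgroup that vanishes at \<open>\<i>\<infinity>\<close> to a higher order than it has poles is 0: multiply it by all
  its transforms under the modular group and apply the maximum modulus principle.  Hence finitely many
  coefficients prove \<open>t\<^sub>p j = P\<^sub>p(t\<^sub>p)\<close> for the primes \<open>p\<close> and the equations that express \<open>t\<^sub>M\<close> by \<open>t\<^sub>N\<close> for \<open>M | N\<close>.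
  As \<open>t\<^sub>N\<close> takes infinitely many values, coprime \<open>P\<^sub>N, Q\<^sub>N\<close> are unique up to a common constant factor.
\<close>

section \<open>The Euler product\<close>

text \<open>The multiplier of eta under a general substitution is a Dedekind sum. Passing to
  absolute values makes it disappear: an eta quotient divided by its transform has modulus 1 on the
  congruence subgroup, is holomorphic, and is therefore constant. The vanishing criterion counts
  cosets, not only cusps. At a prime level \<open>N\<close> the poles of
  \<open>t_N j - P_N(t_N)\<close> add up to at most \<open>N + 1\<close>, so \<open>N + 2\<close>
  coefficients decide; level 13 dictates the longest expansions. Equations for \<open>j\<close> at
  composite levels come by substitution from the prime ones. Levels 6 and 10 are the exception to
  plain substitution: \<open>t_3\<close> is not a polynomial in \<open>t_6\<close>, because it has a
  pole at a cusp where \<open>t_6\<close> is finite. The denominators \<open>t_6 + 8\<close> and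
  \<open>t_10 + 4\<close> have to be cleared, and the poles left at the cusps of denominator 2 are
  the reason for a second explicit family of cosets. The exponent \<open>-1/12\<close> turns into
  \<open>-1/4\<close> precisely at the levels where the numerator \<open>P_N\<close> is found as a
  cube; this is a statement about branches and holds near 0.\<close>

definition euler_prod :: "complex \<Rightarrow> complex" where
  "euler_prod q = (\<Prod>n. 1 - q ^ Suc n)"

lemma abs_convergent_euler_prod:
  fixes q :: complex
  assumes "norm q < 1"
  shows "abs_convergent_prod (\<lambda>n. 1 - q ^ Suc n)"
proof -
  have "summable (\<lambda>n. norm q ^ Suc n)"
    using assms summable_geometric[of "norm q"] by (subst summable_Suc_iff) auto
  thus ?thesis
    by (intro summable_imp_abs_convergent_prod) (simp add: norm_power norm_mult)
qed

lemma power_Suc_neq_1: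
  fixes q :: complex
  assumes "norm q < 1"
  shows "q ^ Suc n \<noteq> 1"
proof
  assume "q ^ Suc n = 1"
  hence "norm q ^ Suc n = 1" by (metis norm_one norm_power)
  thus False using assms power_Suc_less_one[of "norm q" n] by (cases "norm q = 0") auto
qed

lemma uniform_limit_euler_prod:
  assumes "r < 1"
  shows "uniform_limit (cball 0 r) (\<lambda>N q. \<Prod>n<N. 1 - q ^ Suc n) euler_prod sequentially"
proof -
  have "uniformly_convergent_on (cball 0 r) (\<lambda>N q. \<Prod>n<N. 1 - q ^ Suc n :: complex)"
  proof (rule uniformly_convergent_on_prod')
    show "uniformly_convergent_on (cball 0 r) (\<lambda>N q. \<Sum>n<N. norm (1 - q ^ Suc n - 1 :: complex))"
    proof (cases "r < 0")
      case False
      show ?thesis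
      proof (rule Weierstrass_m_test'[where M = "\<lambda>n. r ^ Suc n"])
        show "summable (\<lambda>n. r ^ Suc n)"
          using False assms summable_geometric[of r] by (subst summable_Suc_iff) auto
      qed (auto simp: norm_power norm_mult simp del: power_Suc intro!: power_mono)
    qed auto
  qed (auto intro!: continuous_intros)
  thus ?thesis
    by (rule uniform_limit_cong[THEN iffD1, rotated 2, OF uniformly_convergent_uniform_limit_iff[THEN iffD1]])
       (use assms in \<open>auto simp: euler_prod_def intro!: always_eventually prodinf_eq_lim'[symmetric]
          abs_convergent_prod_imp_convergent_prod abs_convergent_euler_prod
          dest: power_Suc_neq_1[OF le_less_trans] simp del: power_Suc\<close>)
qed

lemma euler_prod_nonzero:
  assumes "norm q < 1"
  shows "euler_prod q \<noteq> 0"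
proof -
  have "1 - q ^ Suc n \<noteq> 0" for n using power_Suc_neq_1[OF assms, of n] by auto
  thus ?thesis
    unfolding euler_prod_def
    by (intro prodinf_nonzero abs_convergent_prod_imp_convergent_prod abs_convergent_euler_prod assms)
qed

lemma holomorphic_euler_prod: "euler_prod holomorphic_on ball 0 1"
proof (rule holomorphic_uniform_sequence[where f = "\<lambda>N q. \<Prod>n<N. 1 - q ^ Suc n"])
  fix x :: complex assume x: "x \<in> ball 0 1"
  define d where "d = (1 - norm x) / 2"
  have "cball x d \<subseteq> cball 0 (norm x + d)"
  proof
    fix y assume "y \<in> cball x d"
    thus "y \<in> cball 0 (norm x + d)"
      using norm_triangle_ineq2[of y x] by (simp add: dist_norm norm_minus_commute)
  qed
  moreover have "norm x + d < 1" "d > 0" using x by (auto simp: d_def field_simps)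
  moreover from this have "cball 0 (norm x + d) \<subseteq> ball (0::complex) 1" by auto
  ultimately show "\<exists>d>0. cball x d \<subseteq> ball 0 1 \<and>
      uniform_limit (cball x d) (\<lambda>N q. \<Prod>n<N. 1 - q ^ Suc n) euler_prod sequentially"
    using uniform_limit_on_subset[OF uniform_limit_euler_prod] by (meson subset_trans)
qed (auto intro!: holomorphic_intros)

text \<open>Locally uniform convergence of the finite products allows termwise logarithmic
  differentiation. Multiplied by \<open>-q\<close>, the series becomes a Lambert series; this is how
  the Eisenstein series E_2 enters.\<close>

lemma logderiv_euler_prod:
  assumes "norm q < 1"
  shows "(\<lambda>n. - (of_nat (Suc n) * q ^ n) / (1 - q ^ Suc n)) sums (deriv euler_prod q / euler_prod q)"
proof -
  obtain r where r: "norm q < r" "r < 1" using assms dense by blast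
  have "(\<lambda>n. deriv (\<lambda>q. 1 - q ^ Suc n) q / (1 - q ^ Suc n)) sums (deriv euler_prod q / euler_prod q)"
  proof (rule logderiv_prodinf_complex_uniform_limit[where A = "ball 0 r"])
    show "uniform_limit (ball 0 r) (\<lambda>N q. \<Prod>n<N. 1 - q ^ Suc n) euler_prod sequentially"
      by (rule uniform_limit_on_subset[OF uniform_limit_euler_prod[OF r(2)]]) auto
  qed (use r euler_prod_nonzero[OF assms] in \<open>auto intro!: holomorphic_intros\<close>)
  moreover have "deriv (\<lambda>q::complex. 1 - q ^ Suc n) q = - (of_nat (Suc n) * q ^ n)" for n
    by (rule DERIV_imp_deriv) (auto intro!: derivative_eq_intros simp del: power_Suc)
  ultimately show ?thesis by simp
qed

text \<open>Fubini for an unconditionally summable family whose row and column sums are known as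
  ordinary series.\<close>

lemma sums_swap:
  fixes f :: "nat \<times> nat \<Rightarrow> complex"
  assumes "f summable_on UNIV"
    and f1: "\<And>k. (\<lambda>m. f (k, m)) sums g k" and f2: "\<And>m. (\<lambda>k. f (k, m)) sums h m"
  shows "\<exists>S. g sums S \<and> h sums S"
proof -
  have sf: "(\<lambda>(x,y). f (x,y)) summable_on UNIV \<times> UNIV" using assms(1) by simp
  have sf': "(\<lambda>(m,k). f (k, m)) summable_on UNIV \<times> UNIV"
    using sf by (subst summable_on_swap) (auto simp: case_prod_unfold)
  have h1: "((\<lambda>m. f (k, m)) has_sum g k) UNIV" for k
    using summable_on_SigmaD1[OF sf, of k] f1[of k]
    by (metis UNIV_I has_sum_infsum has_sum_imp_sums sums_unique2)
  have h2: "((\<lambda>k. f (k, m)) has_sum h m) UNIV" for m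
    using summable_on_SigmaD1[OF sf', of m] f2[of m]
    by (metis UNIV_I has_sum_infsum has_sum_imp_sums sums_unique2)
  define S where "S = infsum f UNIV"
  have H: "(f has_sum S) (UNIV \<times> UNIV)" using assms(1) by (auto simp: S_def)
  have "(g has_sum S) UNIV"
    by (rule has_sum_SigmaD[OF H]) (auto intro: h1)
  hence s1: "g sums S" by (rule has_sum_imp_sums)
  have H': "((\<lambda>(m,k). f (k, m)) has_sum S) (UNIV \<times> UNIV)"
    using H by (subst has_sum_swap) (auto simp: case_prod_unfold)
  have "(h has_sum S) UNIV"
    by (rule has_sum_SigmaD[OF H']) (auto intro: h2)
  hence "h sums S" by (rule has_sum_imp_sums)
  with s1 show ?thesis by blast
qed

text \<open>Both sides are the double sum of \<open>k q^(k m)\<close> over positive \<open>k\<close>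
  and \<open>m\<close>: a geometric series over \<open>m\<close> gives one side, a differentiated
  geometric series over \<open>k\<close> the other.\<close>

lemma sums_Lambert_square:
  fixes q :: complex
  assumes q: "norm q < 1"
  shows "(\<lambda>m. q ^ Suc m / (1 - q ^ Suc m)\<^sup>2) sums
           (\<Sum>n. of_nat (Suc n) * q ^ Suc n / (1 - q ^ Suc n))"
proof -
  define f where "f = (\<lambda>(k,m). of_nat (Suc k) * q ^ (Suc k * Suc m))"
  have nlt: "norm (q ^ Suc m) < 1" for m
    using q power_Suc_less_one[of "norm q" m] by (cases "norm q = 0") (auto simp: norm_power norm_mult)
  have "f summable_on UNIV \<times> UNIV"
  proof (rule abs_summable_summable, rule Infinite_Sum.abs_summable_on_Sigma_iff[THEN iffD2, OF conjI])
    have in1: "((\<lambda>m. norm (f (k, m))) has_sum (real (Suc k) * norm q ^ Suc k / (1 - norm q ^ Suc k))) UNIV" for k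
    proof -
      have "(\<lambda>m. real (Suc k) * norm q ^ Suc k * (norm q ^ Suc k) ^ m) sums
              (real (Suc k) * norm q ^ Suc k * (1 / (1 - norm q ^ Suc k)))"
        by (intro sums_mult geometric_sums) (use nlt[of k] in \<open>auto simp: norm_power norm_mult\<close>)
      also have "(\<lambda>m. real (Suc k) * norm q ^ Suc k * (norm q ^ Suc k) ^ m) = (\<lambda>m. norm (f (k,m)))"
        by (intro ext) (simp add: f_def norm_mult norm_power power_mult[symmetric] power_add[symmetric] algebra_simps del: of_nat_Suc)
      finally have "(\<lambda>m. norm (f (k, m))) sums (real (Suc k) * norm q ^ Suc k / (1 - norm q ^ Suc k))" by simp
      thus ?thesis by (intro sums_nonneg_imp_has_sum) auto
    qed
    show "\<forall>x\<in>UNIV. (\<lambda>y. norm (f (x, y))) summable_on UNIV"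
      using in1 by (auto simp: summable_on_def)
    have eq: "(\<Sum>\<^sub>\<infinity>y. norm (f (x, y))) = (real (Suc x) * norm q ^ Suc x / (1 - norm q ^ Suc x))" for x
      using in1 by (rule infsumI)
    have sm: "summable (\<lambda>k. real (Suc k) * norm q ^ k)"
      using geometric_deriv_sums[of "norm q"] q by (auto simp: sums_iff)
    show "(\<lambda>x. norm (\<Sum>\<^sub>\<infinity>y. norm (f (x, y)))) summable_on UNIV"
      unfolding eq
    proof (rule Infinite_Sum.summable_on_comparison_test)
      show "(\<lambda>k. real (Suc k) * norm q ^ k * (1 / (1 - norm q))) summable_on UNIV"
        using sm by (intro summable_on_cmult_left summable_nonneg_imp_summable_on) auto
      fix k
      have "norm q ^ Suc k \<le> norm q" using q power_decreasing[of 1 "Suc k" "norm q"] by simp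
      thus "norm (real (Suc k) * norm q ^ Suc k / (1 - norm q ^ Suc k)) \<le> real (Suc k) * norm q ^ k * (1 / (1 - norm q))"
        using q nlt[of k]
        by (auto simp: norm_mult norm_power simp del: power_Suc intro!: frac_le mult_left_mono power_decreasing)
    qed auto
  qed
  hence sf: "f summable_on UNIV" by simp
  have h1: "(\<lambda>m. f (k, m)) sums (of_nat (Suc k) * q ^ Suc k / (1 - q ^ Suc k))" for k
  proof -
    have "(\<lambda>m. of_nat (Suc k) * q ^ Suc k * (q ^ Suc k) ^ m) sums
              (of_nat (Suc k) * q ^ Suc k * (1 / (1 - q ^ Suc k)))"
      by (intro sums_mult geometric_sums nlt)
    also have "(\<lambda>m. of_nat (Suc k) * q ^ Suc k * (q ^ Suc k) ^ m) = (\<lambda>m. f (k,m))"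
      by (intro ext) (simp add: f_def power_mult[symmetric] power_add[symmetric] algebra_simps del: of_nat_Suc)
    finally show ?thesis by simp
  qed
  have h2: "(\<lambda>k. f (k, m)) sums (q ^ Suc m / (1 - q ^ Suc m)\<^sup>2)" for m
  proof -
    have "(\<lambda>k. q ^ Suc m * (of_nat (Suc k) * (q ^ Suc m) ^ k)) sums (q ^ Suc m * (1 / (1 - q ^ Suc m)\<^sup>2))"
      by (intro sums_mult geometric_deriv_sums nlt)
    also have "(\<lambda>k. q ^ Suc m * (of_nat (Suc k) * (q ^ Suc m) ^ k)) = (\<lambda>k. f (k,m))"
      by (intro ext) (simp add: f_def power_mult[symmetric] power_add[symmetric] algebra_simps del: of_nat_Suc)
    finally show ?thesis by simp
  qed
  from sums_swap[OF sf h1 h2] show "(\<lambda>m. q ^ Suc m / (1 - q ^ Suc m)\<^sup>2) sums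
           (\<Sum>n. of_nat (Suc n) * q ^ Suc n / (1 - q ^ Suc n))"
    by (auto simp: sums_iff)
qed

section \<open>The inversion formula for the eta function\<close>

lemma sin_pi_nonzero:
  assumes "Im z \<noteq> 0"
  shows "sin (of_real pi * z) \<noteq> (0::complex)"
proof
  assume "sin (of_real pi * z) = 0"
  then obtain n :: int where "of_real pi * z = of_real (of_int n * pi)"
    by (auto simp: Complex_Transcendental.sin_eq_0)
  hence "Im (of_real pi * z) = 0" by (metis Im_complex_of_real)
  thus False using assms by simp
qed

lemma square_diff_nonzero:
  assumes "Im z \<noteq> 0"
  shows "z\<^sup>2 - (of_real x)\<^sup>2 \<noteq> (0::complex)"
proof
  assume "z\<^sup>2 - (of_real x)\<^sup>2 = 0"
  hence "z = of_real x \<or> z = - of_real x" by (simp add: power2_eq_iff)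
  thus False using assms by auto
qed

text \<open>Logarithmic differentiation of Euler's product for the sine, as for the Euler product
  above. The factors for \<open>k\<close> and \<open>-k\<close> are combined into
  \<open>1 - x^2/k^2\<close>.\<close>

lemma cot_pfd:
  assumes z: "Im z \<noteq> 0"
  shows "(\<lambda>k. 2 * z / (z\<^sup>2 - (of_nat (Suc k))\<^sup>2)) sums (of_real pi * cot (of_real pi * z) - 1 / z)"
proof -
  define f :: "nat \<Rightarrow> complex \<Rightarrow> complex"
    where "f = (\<lambda>k x. if k = 0 then of_real pi * x else 1 - x\<^sup>2 / (of_nat k)\<^sup>2)"
  define R where "R = norm z + 1"
  have R: "R > 0" by (auto simp: R_def add_nonneg_pos)
  have z0: "z \<noteq> 0" using z by auto
  have holo: "f k holomorphic_on A" for k A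
    unfolding f_def by (cases "k = 0") (auto intro!: holomorphic_intros)
  have uc: "uniformly_convergent_on (cball 0 R) (\<lambda>N x. \<Prod>n<N. f n x)"
  proof (rule uniformly_convergent_on_prod')
    show "uniformly_convergent_on (cball 0 R) (\<lambda>N x. \<Sum>n<N. norm (f n x - 1))"
    proof (rule Weierstrass_m_test')
      define M where "M = (\<lambda>n. if n = 0 then pi * R + 1 else R\<^sup>2 * (1 / real n ^ 2))"
      have "summable (\<lambda>n. M (Suc n))"
        unfolding M_def using inverse_squares_sums[THEN sums_summable]
        by (auto dest: summable_mult[of _ "R\<^sup>2"] simp: add_ac)
      thus "summable M" by (subst (asm) summable_Suc_iff)
      fix n and x :: complex assume x: "x \<in> cball 0 R"
      have "norm (complex_of_real pi * x - 1) \<le> pi * R + 1"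
        by (rule order_trans[OF norm_triangle_ineq4]) (use x in \<open>auto simp: norm_mult\<close>)
      moreover have "(norm x)\<^sup>2 / (real n)\<^sup>2 \<le> R\<^sup>2 / (real n)\<^sup>2"
        using x by (intro divide_right_mono power_mono) auto
      ultimately show "norm (norm (f n x - 1)) \<le> M n"
        by (auto simp: f_def M_def norm_divide norm_power)
    qed
  qed (auto intro!: holomorphic_on_imp_continuous_on holo)
  have lim: "(\<lambda>N. \<Prod>n<N. f n x) \<longlonglongrightarrow> sin (of_real pi * x)" for x
  proof -
    have "(\<Prod>n<Suc N. f n x) = of_real pi * x * (\<Prod>k=1..N. 1 - x^2 / of_nat k^2)" for N
    proof -
      have "(\<Prod>n<Suc N. f n x) = f 0 x * (\<Prod>n<N. f (Suc n) x)"
        by (rule prod.lessThan_Suc_shift)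
      also have "(\<Prod>n<N. f (Suc n) x) = (\<Prod>k=1..N. f k x)"
        by (rule prod.reindex_bij_witness[of _ "\<lambda>k. k - 1" Suc]) auto
      also have "\<dots> = (\<Prod>k=1..N. 1 - x^2 / of_nat k^2)"
        by (intro prod.cong) (auto simp: f_def)
      finally show ?thesis by (simp add: f_def)
    qed
    hence "(\<lambda>N. \<Prod>n<Suc N. f n x) \<longlonglongrightarrow> sin (of_real pi * x)"
      using sin_product_formula_complex[of x] by (simp del: prod.lessThan_Suc)
    thus ?thesis by (subst (asm) filterlim_sequentially_Suc)
  qed
  have "uniform_limit (cball 0 R) (\<lambda>N x. \<Prod>n<N. f n x) (\<lambda>x. sin (of_real pi * x)) sequentially"
    by (rule uniform_limit_cong[THEN iffD1, rotated 2, OF uniformly_convergent_uniform_limit_iff[THEN iffD1, OF uc]])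
       (auto intro!: always_eventually limI lim)
  hence ul: "uniform_limit (ball 0 R) (\<lambda>N x. \<Prod>n<N. f n x) (\<lambda>x. sin (of_real pi * x)) sequentially"
    by (rule uniform_limit_on_subset) auto
  have s: "(\<lambda>k. deriv (f k) z / f k z) sums
      (deriv (\<lambda>x. sin (of_real pi * x)) z / sin (of_real pi * z))"
    by (rule logderiv_prodinf_complex_uniform_limit[OF ul])
       (use sin_pi_nonzero[OF z] in \<open>auto intro!: holo simp: R_def\<close>)
  have "deriv (\<lambda>x. sin (of_real pi * x)) z = of_real pi * cos (of_real pi * z)"
    by (rule DERIV_imp_deriv) (auto intro!: derivative_eq_intros)
  with s have "(\<lambda>k. deriv (f k) z / f k z) sums (of_real pi * cot (of_real pi * z))"
    by (simp add: cot_def)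
  hence s': "(\<lambda>k. deriv (f (Suc k)) z / f (Suc k) z) sums
      (of_real pi * cot (of_real pi * z) - deriv (f 0) z / f 0 z)"
    by (subst sums_Suc_iff) auto
  have d0: "deriv (f 0) z = of_real pi"
    unfolding f_def by (rule DERIV_imp_deriv) (auto intro!: derivative_eq_intros)
  have dS: "deriv (f (Suc k)) z / f (Suc k) z = 2 * z / (z\<^sup>2 - (of_nat (Suc k))\<^sup>2)" for k
  proof -
    define c where "c = complex_of_nat (Suc k)"
    have c: "c \<noteq> 0" "z\<^sup>2 - c\<^sup>2 \<noteq> 0"
      unfolding c_def using square_diff_nonzero[OF z, of "real (Suc k)"] by (simp_all del: of_nat_Suc)
    have f: "f (Suc k) = (\<lambda>x. 1 - x\<^sup>2 / c\<^sup>2)" by (simp add: f_def c_def)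
    have d: "deriv (f (Suc k)) z = - (2 * z / c\<^sup>2)"
      unfolding f using c(1)
      by (intro DERIV_imp_deriv) (auto intro!: derivative_eq_intros simp: power2_eq_square power4_eq_xxxx)
    have "1 - z\<^sup>2 / c\<^sup>2 \<noteq> 0" using c by (auto simp: field_simps)
    have "- (2 * z / c\<^sup>2) / (1 - z\<^sup>2 / c\<^sup>2) = - (2 * z) / (c\<^sup>2 * (1 - z\<^sup>2 / c\<^sup>2))" by simp
    also have "c\<^sup>2 * (1 - z\<^sup>2 / c\<^sup>2) = - (z\<^sup>2 - c\<^sup>2)" using c by (simp add: right_diff_distrib)
    also have "- (2 * z) / - (z\<^sup>2 - c\<^sup>2) = 2 * z / (z\<^sup>2 - c\<^sup>2)" by (rule minus_divide_divide)
    finally have "- (2 * z / c\<^sup>2) / (1 - z\<^sup>2 / c\<^sup>2) = 2 * z / (z\<^sup>2 - c\<^sup>2)" .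
    thus ?thesis unfolding d by (simp add: f) (simp add: c_def)
  qed
  have "deriv (f 0) z / f 0 z = 1 / z" unfolding d0 using z0 by (simp add: f_def)
  thus ?thesis using s' unfolding dS by simp
qed

text \<open>Minus the derivative of the cotangent series, taken termwise; the summand is
  \<open>1/(z - k)^2 + 1/(z + k)^2\<close>.\<close>

lemma inverse_sin_squared_pfd:
  assumes z: "Im z \<noteq> 0"
  shows "(\<lambda>k. 2 * (z\<^sup>2 + (of_nat (Suc k))\<^sup>2) / (z\<^sup>2 - (of_nat (Suc k))\<^sup>2)\<^sup>2)
           sums ((of_real pi)\<^sup>2 / (sin (of_real pi * z))\<^sup>2 - 1 / z\<^sup>2)"
proof -
  define d where "d = \<bar>Im z\<bar> / 2"
  have d: "d > 0" using z by (simp add: d_def)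
  define R where "R = norm z + d"
  have R: "R > 0" unfolding R_def using d by (auto simp: add_nonneg_pos)
  have Im: "Im x \<noteq> 0" and nR: "norm x \<le> R" if "x \<in> cball z d" for x
  proof -
    have "\<bar>Im z - Im x\<bar> \<le> d" using that abs_Im_le_cmod[of "z - x"] by (simp add: dist_norm)
    thus "Im x \<noteq> 0" using d by (auto simp: d_def abs_if split: if_splits)
    show "norm x \<le> R" using that norm_triangle_ineq2[of x z] by (simp add: R_def dist_norm norm_minus_commute)
  qed
  have nz: "x\<^sup>2 - (of_nat (Suc k))\<^sup>2 \<noteq> 0" if "x \<in> cball z d" for x k
    using square_diff_nonzero[OF Im[OF that], of "real (Suc k)"] by simp
  define F where "F = (\<lambda>N x. \<Sum>k<N. 2 * x / (x\<^sup>2 - (of_nat (Suc k))\<^sup>2) :: complex)"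
  define G where "G = (\<lambda>x. of_real pi * cot (of_real pi * x) - 1 / x :: complex)"
  have uc: "uniform_limit (cball z d) F (\<lambda>x. \<Sum>k. 2 * x / (x\<^sup>2 - (of_nat (Suc k))\<^sup>2)) sequentially"
    unfolding F_def
  proof (rule Weierstrass_m_test_ev)
    have "summable (\<lambda>n. 1 / (real (Suc n))\<^sup>2)"
      using inverse_squares_sums by (simp add: sums_iff add_ac)
    thus "summable (\<lambda>n. 4 * R * (1 / (real (Suc n))\<^sup>2))" by (rule summable_mult)
    have "\<forall>\<^sub>F n in sequentially. real n \<ge> 2 * R"
      by (meson eventually_sequentiallyI nat_ceiling_le_eq)
    thus "\<forall>\<^sub>F n in sequentially. \<forall>x\<in>cball z d.
            norm (2 * x / (x\<^sup>2 - (of_nat (Suc n))\<^sup>2)) \<le> 4 * R * (1 / (real (Suc n))\<^sup>2)"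
    proof eventually_elim
      case (elim n)
      show ?case
      proof
        fix x assume x: "x \<in> cball z d"
        have "(norm x)\<^sup>2 \<le> R\<^sup>2" using nR[OF x] by (intro power_mono) auto
        moreover have "(2 * R)\<^sup>2 \<le> (real (Suc n))\<^sup>2"
          using elim R by (intro power_mono) auto
        ultimately have "(real (Suc n))\<^sup>2 / 2 \<le> (real (Suc n))\<^sup>2 - (norm x)\<^sup>2"
          using zero_le_power2[of R] power_mult_distrib[of 2 R 2] by (simp only: power2_eq_square)
        also have "\<dots> \<le> norm (x\<^sup>2 - (of_nat (Suc n))\<^sup>2)"
          using norm_triangle_ineq3[of "x\<^sup>2" "(of_nat (Suc n))\<^sup>2"] by (simp add: norm_power del: of_nat_Suc)
        finally have "norm (2 * x / (x\<^sup>2 - (of_nat (Suc n))\<^sup>2)) \<le> 2 * R / ((real (Suc n))\<^sup>2 / 2)"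
          unfolding norm_divide norm_mult using nR[OF x] R by (intro frac_le) auto
        thus "norm (2 * x / (x\<^sup>2 - (of_nat (Suc n))\<^sup>2)) \<le> 4 * R * (1 / (real (Suc n))\<^sup>2)"
          by simp
      qed
    qed
  qed
  have "uniform_limit (cball z d) F G sequentially"
    by (rule uniform_limit_cong[THEN iffD1, rotated 2, OF uc])
       (use Im cot_pfd in \<open>auto intro!: always_eventually simp: G_def sums_iff\<close>)
  hence "uniform_limit (ball z d) F G sequentially"
    by (rule uniform_limit_on_subset) auto
  moreover have "F N holomorphic_on ball z d" for N
    unfolding F_def by (intro holomorphic_intros) (use nz ball_subset_cball in blast)
  ultimately have "(\<lambda>N. deriv (F N) z) \<longlonglongrightarrow> deriv G z"
    using d by (intro deriv_complex_uniform_limit) (auto intro!: always_eventually)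
  moreover have "deriv (F N) z = (\<Sum>k<N. - (2 * (z\<^sup>2 + (of_nat (Suc k))\<^sup>2) / (z\<^sup>2 - (of_nat (Suc k))\<^sup>2)\<^sup>2))" for N
  proof -
    have nzz: "z\<^sup>2 - (of_nat (Suc k))\<^sup>2 \<noteq> 0" for k using nz[of z k] d by simp
    have "(F N has_field_derivative (\<Sum>k<N. (2 * (z\<^sup>2 - (of_nat (Suc k))\<^sup>2) - 2 * z * (2 * z)) / (z\<^sup>2 - (of_nat (Suc k))\<^sup>2)\<^sup>2)) (at z)"
      unfolding F_def using nzz
      by (auto intro!: derivative_eq_intros simp: power2_eq_square simp del: of_nat_Suc)
    also have "(\<Sum>k<N. (2 * (z\<^sup>2 - (of_nat (Suc k))\<^sup>2) - 2 * z * (2 * z)) / (z\<^sup>2 - (of_nat (Suc k))\<^sup>2)\<^sup>2)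
       = (\<Sum>k<N. - (2 * (z\<^sup>2 + (of_nat (Suc k))\<^sup>2) / (z\<^sup>2 - (of_nat (Suc k))\<^sup>2)\<^sup>2))"
      unfolding minus_divide_left by (intro sum.cong refl arg_cong2[where f = "(/)"]) (simp add: algebra_simps power2_eq_square)
    finally show ?thesis by (rule DERIV_imp_deriv)
  qed
  moreover have "deriv G z = - ((of_real pi)\<^sup>2 / (sin (of_real pi * z))\<^sup>2 - 1 / z\<^sup>2)"
  proof (rule DERIV_imp_deriv)
    have z0: "z \<noteq> 0" using z by auto
    have "((\<lambda>x. cot (of_real pi * x)) has_field_derivative
        - inverse ((sin (of_real pi * z))\<^sup>2) * of_real pi) (at z)"
      by (rule DERIV_chain2[where f = cot and g = "\<lambda>x. of_real pi * x", OF DERIV_cot[OF sin_pi_nonzero[OF z]]])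
         (auto intro!: derivative_eq_intros)
    hence "(G has_field_derivative
        of_real pi * (- inverse ((sin (of_real pi * z))\<^sup>2) * of_real pi) + inverse z * inverse z) (at z)"
      unfolding G_def using z0 by (auto intro!: derivative_eq_intros simp: divide_inverse)
    thus "(G has_field_derivative - ((of_real pi)\<^sup>2 / (sin (of_real pi * z))\<^sup>2 - 1 / z\<^sup>2)) (at z)"
      by (simp add: power2_eq_square divide_inverse mult_ac)
  qed
  ultimately have "(\<lambda>k. - (2 * (z\<^sup>2 + (of_nat (Suc k))\<^sup>2) / (z\<^sup>2 - (of_nat (Suc k))\<^sup>2)\<^sup>2))
      sums (- ((of_real pi)\<^sup>2 / (sin (of_real pi * z))\<^sup>2 - 1 / z\<^sup>2))"
    by (simp add: sums_def)
  from sums_minus[OF this] show ?thesis by (simp only: minus_minus)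
qed

lemma sin_pi_conv_exp:
  "sin (of_real pi * z) = (exp (2 * of_real pi * \<i> * z) - 1) / (2 * \<i> * exp (of_real pi * \<i> * z))"
  and cos_pi_conv_exp:
  "cos (of_real pi * z) = (exp (2 * of_real pi * \<i> * z) + 1) / (2 * exp (of_real pi * \<i> * z))"
proof -
  have "exp (2 * of_real pi * \<i> * z) = exp (of_real pi * \<i> * z) * exp (of_real pi * \<i> * z)"
    by (simp add: exp_add[symmetric] algebra_simps)
  thus "sin (of_real pi * z) = (exp (2 * of_real pi * \<i> * z) - 1) / (2 * \<i> * exp (of_real pi * \<i> * z))"
    "cos (of_real pi * z) = (exp (2 * of_real pi * \<i> * z) + 1) / (2 * exp (of_real pi * \<i> * z))"
    unfolding sin_exp_eq cos_exp_eq
    by (simp_all add: exp_minus field_simps)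
qed

lemma inverse_sin_squared_conv_exp:
  assumes "Im z > 0"
  shows "(of_real pi)\<^sup>2 / (sin (of_real pi * z))\<^sup>2 =
     - 4 * (of_real pi)\<^sup>2 * (exp (2 * of_real pi * \<i> * z) / (1 - exp (2 * of_real pi * \<i> * z))\<^sup>2)"
proof -
  have "exp (2 * of_real pi * \<i> * z) = exp (of_real pi * \<i> * z) * exp (of_real pi * \<i> * z)"
    by (simp add: exp_add[symmetric] algebra_simps)
  moreover have "exp (2 * of_real pi * \<i> * z) \<noteq> 1"
    using sin_pi_nonzero[of z] assms by (auto simp: sin_pi_conv_exp)
  ultimately show ?thesis unfolding sin_pi_conv_exp
    by (simp add: power_divide power_mult_distrib divide_simps) (simp add: power2_eq_square algebra_simps)
qed

text \<open>With \<open>w\<close> the nome of \<open>y\<close>,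
  \<open>cot (pi y) = \<i> (1 + 2/(w - 1))\<close>, and \<open>w\<close> is unbounded as
  \<open>Im y\<close> tends to minus infinity. This limit is the origin of the non-modular term in
  the transformation of E_2.\<close>

lemma cot_pi_tendsto:
  assumes "filterlim (\<lambda>n. Im (y n)) at_bot F"
  shows "((\<lambda>n. cot (of_real pi * y n)) \<longlongrightarrow> \<i>) F"
proof -
  define w where "w n = exp (2 * of_real pi * \<i> * y n)" for n
  have "filterlim (\<lambda>n. norm (w n)) at_top F"
  proof -
    have "filterlim (\<lambda>n. - (2 * pi * Im (y n))) at_top F"
      using filterlim_tendsto_pos_mult_at_bot[OF tendsto_const _ assms, of "2 * pi"]
      by (simp add: filterlim_uminus_at_bot)
    hence "filterlim (\<lambda>n. exp (- (2 * pi * Im (y n)))) at_top F"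
      by (rule filterlim_compose[OF exp_at_top])
    thus ?thesis by (simp add: w_def norm_exp_eq_Re)
  qed
  hence winf: "filterlim w at_infinity F" by (rule filterlim_norm_at_top_imp_at_infinity)
  have "filterlim (\<lambda>n. w n + (-1)) at_infinity F"
    by (rule tendsto_add_filterlim_at_infinity'[OF winf tendsto_const])
  hence "((\<lambda>n. \<i> * (1 + 2 / (w n + (-1)))) \<longlongrightarrow> \<i> * (1 + 0)) F"
    by (intro tendsto_intros tendsto_divide_0[OF tendsto_const])
  moreover have "\<forall>\<^sub>F n in F. \<i> * (1 + 2 / (w n + (-1))) = cot (of_real pi * y n)"
  proof -
    have "\<forall>\<^sub>F n in F. Im (y n) < 0" using assms by (auto simp: filterlim_at_bot_dense)
    thus ?thesis
    proof eventually_elim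
      case (elim n)
      have "w n \<noteq> 1" using sin_pi_nonzero[of "y n"] elim by (auto simp: sin_pi_conv_exp w_def)
      thus ?case unfolding cot_def sin_pi_conv_exp cos_pi_conv_exp w_def[symmetric]
        by (simp add: divide_simps)
    qed
  qed
  ultimately have "((\<lambda>n. cot (of_real pi * y n)) \<longlongrightarrow> \<i> * (1 + 0)) F"
    by (rule Lim_transform_eventually)
  thus ?thesis by simp
qed

section \<open>The regularised lattice sum\<close>

definition lattice_term :: "complex \<Rightarrow> nat \<Rightarrow> nat \<Rightarrow> complex" where
  "lattice_term \<tau> m n = 2 * ((of_nat m * \<tau>)\<^sup>2 + (of_nat n)\<^sup>2) / ((of_nat m * \<tau>)\<^sup>2 - (of_nat n)\<^sup>2)\<^sup>2"

text \<open>\<open>lattice_term\<close> is \<open>1/(m\<tau> + n)^2 + 1/(m\<tau> - n)^2\<close>, and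
  \<open>pair_term\<close> is \<open>1/(x - m\<tau>) + 1/(x + m\<tau>)\<close>. The value of
  \<open>pair_term\<close> at \<open>n - 1/2\<close> minus that at \<open>n + 1/2\<close> is the
  integral of \<open>1/(x - m\<tau>)^2 + 1/(x + m\<tau>)^2\<close> between these points. So it
  approximates the lattice term by the midpoint rule, and it telescopes in \<open>n\<close>.\<close>

definition pair_term :: "complex \<Rightarrow> nat \<Rightarrow> real \<Rightarrow> complex" where
  "pair_term \<tau> m x = 2 * of_real x / ((of_real x)\<^sup>2 - (of_nat m * \<tau>)\<^sup>2)"

text \<open>As 1 and \<tau> are linearly independent over the reals, this compares two norms on the
  real plane.\<close>

lemma norm_lattice_ge:
  assumes "Im \<tau> > 0"
  obtains c where "c > 0" "\<And>x y :: real. c * (\<bar>x\<bar> + \<bar>y\<bar>) \<le> norm (of_real x + of_real y * \<tau>)"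
proof -
  define C where "C = 1 + (1 + norm \<tau>) / Im \<tau>"
  have C: "C > 0" using assms by (auto simp: C_def add_pos_nonneg)
  have "inverse C * (\<bar>x\<bar> + \<bar>y\<bar>) \<le> norm (of_real x + of_real y * \<tau>)" for x y :: real
  proof -
    let ?n = "norm (of_real x + of_real y * \<tau>)"
    have "\<bar>x\<bar> \<le> ?n + \<bar>y\<bar> * norm \<tau>"
      using norm_triangle_ineq4[of "of_real x + of_real y * \<tau>" "of_real y * \<tau>"] by (simp add: norm_mult)
    moreover have "\<bar>y\<bar> * Im \<tau> \<le> ?n"
      using abs_Im_le_cmod[of "of_real x + of_real y * \<tau>"] assms by (simp add: abs_mult)
    hence "\<bar>y\<bar> \<le> ?n / Im \<tau>" using assms by (simp add: field_simps)
    hence "\<bar>y\<bar> * (1 + norm \<tau>) \<le> ?n / Im \<tau> * (1 + norm \<tau>)" by (intro mult_right_mono) auto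
    ultimately have "\<bar>x\<bar> + \<bar>y\<bar> \<le> ?n * C"
      unfolding C_def by (simp add: algebra_simps add_divide_distrib)
    thus ?thesis using C by (simp add: field_simps)
  qed
  thus ?thesis using that[of "inverse C"] C by auto
qed

text \<open>Here \<open>w\<close> stands for \<open>(m\<tau>)^2\<close>. If \<open>n\<close> and
  \<open>m\<tau>\<close> have degree 1, the numerator has degree 4 and the denominator degree 8, so
  the error of the midpoint rule decays like the fourth power of the distance from the
  origin.\<close>

lemma lattice_difference_identity:
  fixes n w :: complex
  assumes "n\<^sup>2 - w \<noteq> 0" "(n - 1/2)\<^sup>2 - w \<noteq> 0" "(n + 1/2)\<^sup>2 - w \<noteq> 0"
  shows "2 * (w + n\<^sup>2) / (w - n\<^sup>2)\<^sup>2 - (2 * (n - 1/2) / ((n - 1/2)\<^sup>2 - w) - 2 * (n + 1/2) / ((n + 1/2)\<^sup>2 - w))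
     = ((w + n\<^sup>2) * ((n\<^sup>2 - w) + 1/8 - 2 * n\<^sup>2) + (n\<^sup>2 - w)\<^sup>2 / 2) /
       ((n\<^sup>2 - w)\<^sup>2 * (((n - 1/2)\<^sup>2 - w) * ((n + 1/2)\<^sup>2 - w)))"
proof -
  define E where "E = n\<^sup>2 - w"
  have w: "w = n\<^sup>2 - E" by (simp add: E_def)
  define D1 where "D1 = (n - 1/2)\<^sup>2 - w"
  define D2 where "D2 = (n + 1/2)\<^sup>2 - w"
  have D1: "D1 = E - n + 1/4" and D2: "D2 = E + n + 1/4"
    by (simp_all add: D1_def D2_def E_def power2_eq_square field_simps)
  have nz: "E \<noteq> 0" "D1 \<noteq> 0" "D2 \<noteq> 0" using assms by (auto simp: E_def D1_def D2_def)
  have "2 * (w + n\<^sup>2) / E\<^sup>2 - (2 * (n - 1/2) / D1 - 2 * (n + 1/2) / D2)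
     = (2 * (w + n\<^sup>2) * (D1 * D2) - (2 * (n - 1/2) * D2 - 2 * (n + 1/2) * D1) * E\<^sup>2) / (E\<^sup>2 * (D1 * D2))"
    using nz by (simp add: divide_simps)
  also have "2 * (w + n\<^sup>2) * (D1 * D2) - (2 * (n - 1/2) * D2 - 2 * (n + 1/2) * D1) * E\<^sup>2 =
      (w + n\<^sup>2) * (E + 1/8 - 2 * n\<^sup>2) + E\<^sup>2 / 2"
    unfolding w D1 D2 by (simp add: power2_eq_square field_simps)
  finally show ?thesis
    unfolding D1_def[symmetric] D2_def[symmetric] E_def[symmetric]
    by (simp add: E_def power2_commute)
qed

lemma summable_inverse_squares_product:
  "(\<lambda>(m, n). (1 / (real (Suc m))\<^sup>2) * (1 / (real (Suc n))\<^sup>2)) summable_on UNIV"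
proof -
  have s: "(\<lambda>m. 1 / (real (Suc m))\<^sup>2) summable_on UNIV"
    using inverse_squares_sums by (intro summable_nonneg_imp_summable_on) (auto simp: sums_iff add_ac)
  have "(\<lambda>(m, n). (1 / (real (Suc m))\<^sup>2) * (1 / (real (Suc n))\<^sup>2)) summable_on (UNIV \<times> UNIV)"
  proof (rule summable_on_SigmaI[where g = "\<lambda>m. (1 / (real (Suc m))\<^sup>2) * (\<Sum>\<^sub>\<infinity>n. 1 / (real (Suc n))\<^sup>2)"])
    show "((\<lambda>n. (\<lambda>(m, n). (1 / (real (Suc m))\<^sup>2) * (1 / (real (Suc n))\<^sup>2)) (m, n)) has_sum
       (1 / (real (Suc m))\<^sup>2) * (\<Sum>\<^sub>\<infinity>n. 1 / (real (Suc n))\<^sup>2)) UNIV" for m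
      unfolding prod.case by (intro has_sum_cmult_right has_sum_infsum s)
    show "(\<lambda>m. (1 / (real (Suc m))\<^sup>2) * (\<Sum>\<^sub>\<infinity>n. 1 / (real (Suc n))\<^sup>2)) summable_on UNIV"
      by (intro summable_on_cmult_left s)
  qed auto
  thus ?thesis by simp
qed

text \<open>The error is \<open>O((m + n)^(-4))\<close> and hence \<open>O(m^(-2) n^(-2))\<close>.
  This legitimates an interchange of summations that would be false for the lattice terms
  alone.\<close>

lemma summable_lattice_difference:
  assumes \<tau>: "Im \<tau> > 0"
  shows "(\<lambda>(m, n). lattice_term \<tau> (Suc m) (Suc n) -
            (pair_term \<tau> (Suc m) (real (Suc n) - 1/2) - pair_term \<tau> (Suc m) (real (Suc n) + 1/2)))
         summable_on UNIV"
proof -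
  obtain c where c: "c > 0" "\<And>x y :: real. c * (\<bar>x\<bar> + \<bar>y\<bar>) \<le> norm (of_real x + of_real y * \<tau>)"
    using norm_lattice_ge[OF \<tau>] by blast
  define K where "K = 1 + (norm \<tau>)\<^sup>2"
  have K: "K \<ge> 1" by (simp add: K_def)
  define C where "C = (K * (K + 3) + K\<^sup>2 / 2) / ((c\<^sup>2)\<^sup>2 * ((c\<^sup>2 / 4) * (c\<^sup>2 / 4)))"
  have C: "C > 0" unfolding C_def using c K by (intro divide_pos_pos add_pos_pos mult_pos_pos) auto
  have sq: "norm ((of_real x)\<^sup>2 - (of_real y * \<tau>)\<^sup>2) \<ge> c\<^sup>2 * (x + y)\<^sup>2" if "x \<ge> 0" "y \<ge> 0" for x y :: real
  proof -
    have "(c * (x + y)) * (c * (x + y)) \<le> norm (of_real x + of_real y * \<tau>) * norm (of_real x - of_real y * \<tau>)"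
      using c(2)[of x y] c(2)[of x "-y"] that c(1) by (intro mult_mono) auto
    also have "\<dots> = norm ((of_real x)\<^sup>2 - (of_real y * \<tau>)\<^sup>2)"
      by (simp add: norm_mult[symmetric] power2_eq_square algebra_simps)
    finally show ?thesis by (simp add: power2_eq_square algebra_simps)
  qed
  have bound: "norm (lattice_term \<tau> (Suc m) (Suc n) -
            (pair_term \<tau> (Suc m) (real (Suc n) - 1/2) - pair_term \<tau> (Suc m) (real (Suc n) + 1/2)))
      \<le> C * ((1 / (real (Suc m))\<^sup>2) * (1 / (real (Suc n))\<^sup>2))" for m n
  proof -
    define y where "y = real (Suc m)"
    define x where "x = real (Suc n)"
    have xy: "x \<ge> 1" "y \<ge> 1" by (auto simp: x_def y_def)
    define s where "s = x + y"
    have s: "s \<ge> 2" using xy by (simp add: s_def)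
    define w where "w = (of_real y * \<tau>)\<^sup>2"
    define z where "z = complex_of_real x"
    define E where "E = z\<^sup>2 - w"
    define D1 where "D1 = (z - 1/2)\<^sup>2 - w"
    define D2 where "D2 = (z + 1/2)\<^sup>2 - w"
    have E: "norm E \<ge> c\<^sup>2 * s\<^sup>2" using sq[of x y] xy by (simp add: E_def z_def w_def s_def)
    \<comment> \<open>Moving \<open>x\<close> by 1/2 reduces \<open>x + y\<close> at most to its
      half, because \<open>x + y \<ge> 2\<close>.\<close>
    have half: "c\<^sup>2 / 4 * s\<^sup>2 \<le> c\<^sup>2 * (x' + y)\<^sup>2" if "x' \<ge> x - 1/2" for x'
    proof -
      have "(s / 2)\<^sup>2 \<le> (x' + y)\<^sup>2" using that xy by (intro power_mono) (auto simp: s_def)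
      from mult_left_mono[OF this, of "c\<^sup>2"] show ?thesis by (simp add: power_divide)
    qed
    have D1: "norm D1 \<ge> c\<^sup>2 / 4 * s\<^sup>2"
      using order_trans[OF half[of "x - 1/2"] sq[of "x - 1/2" y]] xy by (simp add: D1_def z_def w_def)
    have D2: "norm D2 \<ge> c\<^sup>2 / 4 * s\<^sup>2"
      using order_trans[OF half[of "x + 1/2"] sq[of "x + 1/2" y]] xy by (simp add: D2_def z_def w_def)
    have pos: "c\<^sup>2 * s\<^sup>2 > 0" using c s by simp
    have nz: "E \<noteq> 0" "D1 \<noteq> 0" "D2 \<noteq> 0"
      using E D1 D2 pos by (auto simp: not_le[symmetric])
    have "lattice_term \<tau> (Suc m) (Suc n) -
            (pair_term \<tau> (Suc m) (real (Suc n) - 1/2) - pair_term \<tau> (Suc m) (real (Suc n) + 1/2))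
        = 2 * (w + z\<^sup>2) / (w - z\<^sup>2)\<^sup>2 - (2 * (z - 1/2) / ((z - 1/2)\<^sup>2 - w) - 2 * (z + 1/2) / ((z + 1/2)\<^sup>2 - w))"
      by (simp add: lattice_term_def pair_term_def w_def z_def x_def y_def)
    also have "\<dots> = ((w + z\<^sup>2) * (E + 1/8 - 2 * z\<^sup>2) + E\<^sup>2 / 2) / (E\<^sup>2 * (D1 * D2))"
      unfolding E_def D1_def D2_def
      by (rule lattice_difference_identity) (use nz in \<open>auto simp: E_def D1_def D2_def\<close>)
    finally have eq: "lattice_term \<tau> (Suc m) (Suc n) -
            (pair_term \<tau> (Suc m) (real (Suc n) - 1/2) - pair_term \<tau> (Suc m) (real (Suc n) + 1/2))
        = ((w + z\<^sup>2) * (E + 1/8 - 2 * z\<^sup>2) + E\<^sup>2 / 2) / (E\<^sup>2 * (D1 * D2))" .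
    have s2: "x\<^sup>2 \<le> s\<^sup>2" "y\<^sup>2 \<le> s\<^sup>2" using xy by (auto simp: s_def intro!: power_mono)
    have nw: "norm w + norm (z\<^sup>2) \<le> K * s\<^sup>2"
      using s2 mult_right_mono[OF s2(2), of "(norm \<tau>)\<^sup>2"]
      by (simp add: w_def z_def norm_mult norm_power power_mult_distrib K_def algebra_simps)
    have n1: "norm (w + z\<^sup>2) \<le> K * s\<^sup>2" and nE: "norm E \<le> K * s\<^sup>2"
      using nw norm_triangle_ineq[of w "z\<^sup>2"] norm_triangle_ineq4[of "z\<^sup>2" w] by (auto simp: E_def)
    have "norm (E + 1/8 - 2 * z\<^sup>2) \<le> norm E + 1/8 + 2 * x\<^sup>2"
      by (rule order_trans[OF norm_triangle_ineq4] add_mono order_trans[OF norm_triangle_ineq])+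
         (auto simp: norm_mult norm_power z_def norm_divide)
    also have "\<dots> \<le> K * s\<^sup>2 + s\<^sup>2 + 2 * s\<^sup>2"
      using nE s2 s power_mono[of 2 s 2] by (intro add_mono mult_left_mono) auto
    finally have n2: "norm (E + 1/8 - 2 * z\<^sup>2) \<le> (K + 3) * s\<^sup>2" by (simp add: algebra_simps)
    have num: "norm ((w + z\<^sup>2) * (E + 1/8 - 2 * z\<^sup>2) + E\<^sup>2 / 2) \<le> (K * s\<^sup>2) * ((K + 3) * s\<^sup>2) + (K * s\<^sup>2)\<^sup>2 / 2"
      by (rule order_trans[OF norm_triangle_ineq]) (use n1 n2 nE K in \<open>auto simp: norm_mult norm_divide norm_power
           intro!: add_mono mult_mono divide_right_mono power_mono mult_nonneg_nonneg\<close>)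
    have den: "(c\<^sup>2 * s\<^sup>2)\<^sup>2 * ((c\<^sup>2 / 4 * s\<^sup>2) * (c\<^sup>2 / 4 * s\<^sup>2)) \<le> norm (E\<^sup>2 * (D1 * D2))"
      unfolding norm_mult norm_power using E D1 D2 pos
      by (intro mult_mono power_mono) (auto intro!: mult_nonneg_nonneg)
    have "norm (((w + z\<^sup>2) * (E + 1/8 - 2 * z\<^sup>2) + E\<^sup>2 / 2) / (E\<^sup>2 * (D1 * D2)))
        \<le> ((K * s\<^sup>2) * ((K + 3) * s\<^sup>2) + (K * s\<^sup>2)\<^sup>2 / 2) / ((c\<^sup>2 * s\<^sup>2)\<^sup>2 * ((c\<^sup>2 / 4 * s\<^sup>2) * (c\<^sup>2 / 4 * s\<^sup>2)))"
      unfolding norm_divide using num den pos K c s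
      by (intro frac_le) (auto intro!: mult_pos_pos add_nonneg_nonneg mult_nonneg_nonneg)
    also have "\<dots> = C * (1 / (s\<^sup>2)\<^sup>2)"
      using c s unfolding C_def by (simp add: divide_simps) (simp add: eval_nat_numeral algebra_simps)
    also have "\<dots> \<le> C * (1 / (y\<^sup>2 * x\<^sup>2))"
      using C xy s2 by (intro mult_left_mono frac_le) (auto simp: power2_eq_square intro!: mult_mono)
    finally show ?thesis unfolding eq by (simp add: x_def y_def)
  qed
  show ?thesis
  proof (rule abs_summable_summable, rule Infinite_Sum.abs_summable_on_comparison_test')
    show "(\<lambda>(m, n). C * ((1 / (real (Suc m))\<^sup>2) * (1 / (real (Suc n))\<^sup>2))) summable_on UNIV"
      using summable_on_cmult_right[OF summable_inverse_squares_product, of C] by (simp add: case_prod_unfold)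
  qed (use bound in auto)
qed

section \<open>The transformation of E_2\<close>

abbreviation nome :: "complex \<Rightarrow> complex" where
  "nome \<tau> \<equiv> exp (2 * of_real pi * \<i> * \<tau>)"

lemma norm_nome: "norm (nome \<tau>) = exp (- (2 * pi * Im \<tau>))"
  by (simp add: norm_exp_eq_Re)

lemma norm_nome_less_1: "Im \<tau> > 0 \<Longrightarrow> norm (nome \<tau>) < 1"
  by (simp add: norm_nome)

lemma nome_power: "nome \<tau> ^ n = nome (of_nat n * \<tau>)"
  by (simp add: exp_of_nat_mult[symmetric] mult_ac)

text \<open>This is \<open>(1 - E_2)/24\<close>, so that \<open>1/24 - lambert_sum\<close> is
  \<open>E_2/24\<close>.\<close>

definition lambert_sum :: "complex \<Rightarrow> complex" where
  "lambert_sum \<tau> = (\<Sum>n. of_nat (Suc n) * nome \<tau> ^ Suc n / (1 - nome \<tau> ^ Suc n))"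

lemma Im_minus_inverse: "Im (- 1 / \<tau>) = Im \<tau> / (norm \<tau>)\<^sup>2"
  by (simp add: Im_divide cmod_power2)

lemma Im_minus_inverse_pos: "Im \<tau> > 0 \<Longrightarrow> Im (- 1 / \<tau>) > 0"
  unfolding Im_minus_inverse by (cases "\<tau> = 0") auto

text \<open>Partial fractions of 1/sin^2 at \<open>m\<tau>\<close>; the subtracted
  \<open>1/(m\<tau>)^2\<close> is the term with \<open>n = 0\<close>.\<close>

lemma sums_row:
  assumes "Im \<tau> > 0"
  shows "(\<lambda>n. lattice_term \<tau> (Suc m) (Suc n)) sums
     (- 4 * (of_real pi)\<^sup>2 * (nome \<tau> ^ Suc m / (1 - nome \<tau> ^ Suc m)\<^sup>2)
      - (1 / \<tau>\<^sup>2) * (1 / (of_nat (Suc m))\<^sup>2))"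
proof -
  define z where "z = of_nat (Suc m) * \<tau>"
  have z: "Im z > 0" using assms by (simp add: z_def)
  have q: "nome \<tau> ^ Suc m = nome z" unfolding nome_power z_def ..
  have "(of_real pi)\<^sup>2 / (sin (of_real pi * z))\<^sup>2 - 1 / z\<^sup>2 =
      - 4 * (of_real pi)\<^sup>2 * (nome \<tau> ^ Suc m / (1 - nome \<tau> ^ Suc m)\<^sup>2)
      - (1 / \<tau>\<^sup>2) * (1 / (of_nat (Suc m))\<^sup>2)"
    unfolding inverse_sin_squared_conv_exp[OF z] q by (simp add: z_def power_mult_distrib)
  moreover have "(\<lambda>k. 2 * (z\<^sup>2 + (of_nat (Suc k))\<^sup>2) / (z\<^sup>2 - (of_nat (Suc k))\<^sup>2)\<^sup>2)
           sums ((of_real pi)\<^sup>2 / (sin (of_real pi * z))\<^sup>2 - 1 / z\<^sup>2)"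
    by (rule inverse_sin_squared_pfd) (use z in simp)
  ultimately show ?thesis unfolding lattice_term_def z_def[symmetric] by (simp only:)
qed

lemma lattice_term_inversion:
  assumes "Im \<tau> > 0"
  shows "lattice_term (- 1 / \<tau>) n m = \<tau>\<^sup>2 * lattice_term \<tau> m n"
proof -
  have t: "\<tau> \<noteq> 0" using assms by auto
  define a b where "a = (of_nat m :: complex)\<^sup>2" and "b = (of_nat n :: complex)\<^sup>2"
  have 1: "lattice_term (- 1 / \<tau>) n m = 2 * (b / \<tau>\<^sup>2 + a) / (b / \<tau>\<^sup>2 - a)\<^sup>2"
    by (simp add: lattice_term_def a_def b_def power_divide)
  have 2: "lattice_term \<tau> m n = 2 * (a * \<tau>\<^sup>2 + b) / (a * \<tau>\<^sup>2 - b)\<^sup>2"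
    by (simp add: lattice_term_def a_def b_def power_mult_distrib)
  have *: "2 * (X / u) / (- Y / u)\<^sup>2 = u * (2 * X / Y\<^sup>2)" if "u \<noteq> 0" for X Y u :: complex
    using that by (cases "Y = 0") (auto simp: power2_eq_square field_simps)
  have **: "b / \<tau>\<^sup>2 + a = (a * \<tau>\<^sup>2 + b) / \<tau>\<^sup>2" "b / \<tau>\<^sup>2 - a = - (a * \<tau>\<^sup>2 - b) / \<tau>\<^sup>2"
    using t by (simp_all add: field_simps)
  show ?thesis unfolding 1 2 ** by (rule *) (use t in simp)
qed

lemma pair_term_column:
  assumes \<tau>: "Im \<tau> > 0" and x: "x > 0"
  shows "(\<lambda>m. pair_term \<tau> (Suc m) x) sums
     (1 / \<tau> * (of_real pi * cot (of_real pi * (of_real x / \<tau>)) - 1 / (of_real x / \<tau>)))"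
proof -
  have t: "\<tau> \<noteq> 0" using \<tau> by auto
  define y where "y = of_real x / \<tau>"
  have y: "Im y \<noteq> 0" using \<tau> x t by (simp add: y_def Im_divide)
  have "pair_term \<tau> (Suc m) x = 1 / \<tau> * (2 * y / (y\<^sup>2 - (of_nat (Suc m))\<^sup>2))" for m
  proof -
    have *: "(x / \<tau>)\<^sup>2 - M\<^sup>2 = (x\<^sup>2 - (M * \<tau>)\<^sup>2) / \<tau>\<^sup>2" for x M
      using t by (simp add: power_divide power_mult_distrib diff_divide_distrib)
    have "y\<^sup>2 - (of_nat (Suc m))\<^sup>2 = ((of_real x)\<^sup>2 - (of_nat (Suc m) * \<tau>)\<^sup>2) / \<tau>\<^sup>2"
      unfolding y_def by (rule *)
    thus ?thesis unfolding pair_term_def using t by (simp add: y_def) (simp add: power2_eq_square)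
  qed
  thus ?thesis using sums_mult[OF cot_pfd[OF y], of "1 / \<tau>"] by (simp add: y_def)
qed

text \<open>In terms of E_2 this reads
  \<open>E_2(-1/\<tau>)/\<tau>^2 = E_2(\<tau>) - 6\<i>/(pi \<tau>)\<close>. Summing the lattice
  terms by rows gives E_2 at \<tau>, by columns E_2 at \<open>-1/\<tau>\<close>. The regularised
  terms have equal iterated sums, so the discrepancy is that of the telescoping terms alone.\<close>

lemma lambert_sum_inversion:
  assumes \<tau>: "Im \<tau> > 0"
  shows "(1 / \<tau>\<^sup>2) * (1 / 24 - lambert_sum (- 1 / \<tau>)) = 1 / 24 - lambert_sum \<tau> - \<i> / (4 * of_real pi * \<tau>)"
proof -
  have t: "\<tau> \<noteq> 0" using \<tau> by auto
  define S where "S \<sigma> m = - 4 * (of_real pi)\<^sup>2 * (nome \<sigma> ^ Suc m / (1 - nome \<sigma> ^ Suc m)\<^sup>2)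
      - (1 / \<sigma>\<^sup>2) * (1 / (of_nat (Suc m))\<^sup>2)" for \<sigma> m
  \<comment> \<open>The half-integers separating the positive integers: \<open>h n\<close> lies just
    before \<open>Suc n\<close> and \<open>h (Suc n)\<close> just after it.\<close>
  define h where "h n = real (Suc n) - 1 / 2" for n
  have hS: "real (Suc n) + 1/2 = h (Suc n)" "h n > 0" for n by (auto simp: h_def)
  define c where "c x = 1 / \<tau> * (of_real pi * cot (of_real pi * (of_real x / \<tau>)) - 1 / (of_real x / \<tau>))" for x
  have Ssum: "S \<sigma> sums (- 4 * (of_real pi)\<^sup>2 * lambert_sum \<sigma> - (1 / \<sigma>\<^sup>2) * ((of_real pi)\<^sup>2 / 6))"
    if "Im \<sigma> > 0" for \<sigma>
  proof -
    have "(\<lambda>n. complex_of_real (1 / (real (Suc n))\<^sup>2)) sums of_real (pi\<^sup>2 / 6)"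
      using inverse_squares_sums unfolding sums_of_real_iff by (simp add: add_ac)
    hence "(\<lambda>n. 1 / (of_nat (Suc n))\<^sup>2) sums ((of_real pi)\<^sup>2 / 6 :: complex)" by simp
    thus ?thesis
      unfolding S_def lambert_sum_def
      by (intro sums_diff sums_mult sums_Lambert_square norm_nome_less_1 that)
  qed
  have row: "(\<lambda>n. lattice_term \<tau> (Suc m) (Suc n)) sums S \<tau> m" for m
    unfolding S_def by (rule sums_row[OF \<tau>])
  have "(\<lambda>m. lattice_term (- 1 / \<tau>) (Suc n) (Suc m)) sums S (- 1 / \<tau>) n" for n
    unfolding S_def by (rule sums_row[OF Im_minus_inverse_pos[OF \<tau>]])
  hence "(\<lambda>m. 1 / \<tau>\<^sup>2 * lattice_term (- 1 / \<tau>) (Suc n) (Suc m)) sums (1 / \<tau>\<^sup>2 * S (- 1 / \<tau>) n)" for n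
    by (rule sums_mult)
  hence col: "(\<lambda>m. lattice_term \<tau> (Suc m) (Suc n)) sums (1 / \<tau>\<^sup>2 * S (- 1 / \<tau>) n)" for n
    unfolding lattice_term_inversion[OF \<tau>] using t by simp
  have prow: "(\<lambda>n. pair_term \<tau> (Suc m) (h n) - pair_term \<tau> (Suc m) (h (Suc n))) sums pair_term \<tau> (Suc m) (1/2)" for m
  proof -
    have "(\<lambda>n. pair_term \<tau> (Suc m) (h n)) \<longlonglongrightarrow> 0"
    proof -
      define w where "w = (of_nat (Suc m) * \<tau>)\<^sup>2"
      have hi: "filterlim (\<lambda>n. complex_of_real (h n)) at_infinity sequentially"
      proof -
        have "filterlim h at_top sequentially" unfolding h_def by real_asymp
        thus ?thesis by (rule filterlim_compose[OF filterlim_of_real_at_infinity])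
      qed
      have "(\<lambda>n. (2 / of_real (h n)) / (1 - w * ((1 / of_real (h n)) * (1 / of_real (h n))))) \<longlonglongrightarrow> 0 / (1 - w * (0 * 0))"
        by (intro tendsto_intros tendsto_divide_0[OF tendsto_const hi]) auto
      moreover have "(2 / of_real (h n)) / (1 - w * ((1 / of_real (h n)) * (1 / of_real (h n)))) = pair_term \<tau> (Suc m) (h n)" for n
      proof -
        have "complex_of_real (h n) \<noteq> 0" using hS(2)[of n] by simp
        moreover from this have "1 - w * ((1 / of_real (h n)) * (1 / of_real (h n))) = ((of_real (h n))\<^sup>2 - w) / (of_real (h n))\<^sup>2"
          by (simp add: field_simps power2_eq_square)
        ultimately show ?thesis by (simp add: pair_term_def w_def power2_eq_square)
      qed
      ultimately show ?thesis by simp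
    qed
    hence "(\<lambda>n. pair_term \<tau> (Suc m) (h n) - pair_term \<tau> (Suc m) (h (Suc n))) sums (pair_term \<tau> (Suc m) (h 0) - 0)"
      by (rule telescope_sums')
    thus ?thesis by (simp add: h_def)
  qed
  have pcol: "(\<lambda>m. pair_term \<tau> (Suc m) (h n) - pair_term \<tau> (Suc m) (h (Suc n))) sums (c (h n) - c (h (Suc n)))" for n
    unfolding c_def by (intro sums_diff pair_term_column \<tau> hS)
  have sm: "(\<lambda>(m, n). lattice_term \<tau> (Suc m) (Suc n) -
            (pair_term \<tau> (Suc m) (h n) - pair_term \<tau> (Suc m) (h (Suc n)))) summable_on UNIV"
    using summable_lattice_difference[OF \<tau>] unfolding hS(1) by (simp add: h_def)
  obtain X where X: "(\<lambda>m. S \<tau> m - pair_term \<tau> (Suc m) (1/2)) sums X"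
      "(\<lambda>n. 1 / \<tau>\<^sup>2 * S (- 1 / \<tau>) n - (c (h n) - c (h (Suc n)))) sums X"
  proof -
    have 1: "(\<lambda>n. lattice_term \<tau> (Suc m) (Suc n) - (pair_term \<tau> (Suc m) (h n) - pair_term \<tau> (Suc m) (h (Suc n))))
        sums (S \<tau> m - pair_term \<tau> (Suc m) (1/2))" for m
      by (intro sums_diff row prow)
    have 2: "(\<lambda>m. lattice_term \<tau> (Suc m) (Suc n) - (pair_term \<tau> (Suc m) (h n) - pair_term \<tau> (Suc m) (h (Suc n))))
        sums (1 / \<tau>\<^sup>2 * S (- 1 / \<tau>) n - (c (h n) - c (h (Suc n))))" for n
      by (intro sums_diff[OF col] pcol)
    show ?thesis
      using sums_swap[OF sm, unfolded prod.case, OF 1 2] that by blast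
  qed
  \<comment> \<open>Taken by rows, the telescoping terms add up to \<open>c (1/2)\<close>; taken by
    columns, to \<open>c (1/2)\<close> minus the limit \<open>pi \<i>/\<tau>\<close> of
    \<open>c\<close> at infinity. This limit is the whole difference between the two orders.\<close>
  have p1: "(\<lambda>m. pair_term \<tau> (Suc m) (1/2)) sums c (1/2)"
    unfolding c_def by (rule pair_term_column[OF \<tau>]) simp
  have "(\<lambda>n. c (h n)) \<longlonglongrightarrow> 1 / \<tau> * (of_real pi * \<i> - 0)"
    unfolding c_def
  proof (intro tendsto_intros cot_pi_tendsto tendsto_divide_0[OF tendsto_const])
    have hinf: "filterlim h at_top sequentially" unfolding h_def by real_asymp
    have Im: "Im (complex_of_real (h n) / \<tau>) = - (Im \<tau> / (norm \<tau>)\<^sup>2) * h n" for n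
      by (simp add: Im_divide cmod_power2)
    show "filterlim (\<lambda>n. Im (complex_of_real (h n) / \<tau>)) at_bot sequentially"
      unfolding Im using \<tau> t hinf
      by (intro filterlim_tendsto_neg_mult_at_bot[OF tendsto_const]) auto
    have "filterlim (\<lambda>n. norm (complex_of_real (h n) / \<tau>)) at_top sequentially"
    proof -
      have "filterlim (\<lambda>n. (1 / norm \<tau>) * h n) at_top sequentially"
        using t hinf by (intro filterlim_tendsto_pos_mult_at_top[OF tendsto_const]) auto
      thus ?thesis by (rule filterlim_at_top_mono) (auto simp: norm_divide intro!: always_eventually divide_right_mono)
    qed
    thus "filterlim (\<lambda>n. complex_of_real (h n) / \<tau>) at_infinity sequentially"
      by (rule filterlim_norm_at_top_imp_at_infinity)
  qed
  hence "(\<lambda>n. c (h n) - c (h (Suc n))) sums (c (h 0) - 1 / \<tau> * (of_real pi * \<i> - 0))"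
    by (rule telescope_sums')
  hence p2: "(\<lambda>n. c (h n) - c (h (Suc n))) sums (c (1/2) - of_real pi * \<i> / \<tau>)"
    by (simp add: h_def)
  have "S \<tau> sums (X + c (1/2))" using sums_add[OF X(1) p1] by simp
  hence A: "- 4 * (of_real pi)\<^sup>2 * lambert_sum \<tau> - (1 / \<tau>\<^sup>2) * ((of_real pi)\<^sup>2 / 6) = X + c (1/2)"
    using Ssum[OF \<tau>] sums_unique2 by blast
  have "(\<lambda>n. 1 / \<tau>\<^sup>2 * S (- 1 / \<tau>) n) sums (X + (c (1/2) - of_real pi * \<i> / \<tau>))"
    using sums_add[OF X(2) p2] by simp
  hence "1 / \<tau>\<^sup>2 * (- 4 * (of_real pi)\<^sup>2 * lambert_sum (- 1 / \<tau>) - (1 / (- 1 / \<tau>)\<^sup>2) * ((of_real pi)\<^sup>2 / 6))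
       = X + (c (1/2) - of_real pi * \<i> / \<tau>)"
    using sums_mult[OF Ssum[OF Im_minus_inverse_pos[OF \<tau>]], of "1 / \<tau>\<^sup>2"] sums_unique2 by blast
  also have "\<dots> = - 4 * (of_real pi)\<^sup>2 * lambert_sum \<tau> - (1 / \<tau>\<^sup>2) * ((of_real pi)\<^sup>2 / 6) - of_real pi * \<i> / \<tau>"
    using A by simp
  finally have B: "1 / \<tau>\<^sup>2 * (- 4 * (of_real pi)\<^sup>2 * lambert_sum (- 1 / \<tau>) - (1 / (- 1 / \<tau>)\<^sup>2) * ((of_real pi)\<^sup>2 / 6))
     = - 4 * (of_real pi)\<^sup>2 * lambert_sum \<tau> - (1 / \<tau>\<^sup>2) * ((of_real pi)\<^sup>2 / 6) - of_real pi * \<i> / \<tau>" .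
  \<comment> \<open>Division by \<open>4 pi^2\<close>. The two terms with
    \<open>zeta(2) = pi^2/6\<close> change sides; they supply the constants 1/24 that complete the
    Lambert sums to multiples of E_2.\<close>
  have alg: "(1 / t\<^sup>2) * (1 / 24 - L') = 1 / 24 - L - i / (4 * p * t)"
    if "1 / t\<^sup>2 * (- 4 * p\<^sup>2 * L' - (1 / (- 1 / t)\<^sup>2) * (p\<^sup>2 / 6)) = - 4 * p\<^sup>2 * L - (1 / t\<^sup>2) * (p\<^sup>2 / 6) - p * i / t"
      "t \<noteq> 0" "p \<noteq> 0" for p i t L L' :: complex
  proof -
    define u where "u = 1 / t"
    have u: "1 / t\<^sup>2 = u\<^sup>2" "(1 / (- 1 / t)\<^sup>2) = t\<^sup>2" "p * i / t = p * i * u" "u * t = 1"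
      using that(2) by (auto simp: u_def power_divide)
    have ut: "u\<^sup>2 * t\<^sup>2 = 1" using u(4) by (simp add: power_mult_distrib[symmetric])
    have "u\<^sup>2 * (- 4 * p\<^sup>2 * L' - t\<^sup>2 * (p\<^sup>2 / 6)) = - 4 * p\<^sup>2 * L - u\<^sup>2 * (p\<^sup>2 / 6) - p * i * u"
      using that(1) unfolding u .
    moreover have "u\<^sup>2 * (- 4 * p\<^sup>2 * L' - t\<^sup>2 * (p\<^sup>2 / 6)) = - 4 * p\<^sup>2 * L' * u\<^sup>2 - (u\<^sup>2 * t\<^sup>2) * (p\<^sup>2 / 6)"
      by (simp add: algebra_simps)
    ultimately have *: "4 * p\<^sup>2 * L' * u\<^sup>2 = 4 * p\<^sup>2 * L + u\<^sup>2 * (p\<^sup>2 / 6) + p * i * u - p\<^sup>2 / 6"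
      unfolding ut by (simp add: algebra_simps)
    have "4 * p\<^sup>2 * (i / (4 * p * t)) = p * i * u"
      using that(2,3) by (simp add: u_def power2_eq_square)
    hence "4 * p\<^sup>2 * (1 / 24 - L - i / (4 * p * t)) = p\<^sup>2 / 6 - 4 * p\<^sup>2 * L - p * i * u"
      by (simp add: right_diff_distrib)
    moreover have "4 * p\<^sup>2 * (u\<^sup>2 * (1 / 24 - L')) = u\<^sup>2 * (p\<^sup>2 / 6) - 4 * p\<^sup>2 * L' * u\<^sup>2"
      by (simp add: algebra_simps)
    ultimately have "4 * p\<^sup>2 * ((1 / t\<^sup>2) * (1 / 24 - L')) = 4 * p\<^sup>2 * (1 / 24 - L - i / (4 * p * t))"
      unfolding u * by simp
    thus ?thesis by (rule mult_left_cancel[THEN iffD1, rotated]) (use that(3) in simp)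
  qed
  show ?thesis by (rule alg[OF B t]) simp
qed

section \<open>The eta function\<close>

lemma dedekind_eta_conv_euler_prod:
  "dedekind_eta \<tau> = exp (2 * of_real pi * \<i> * \<tau> / 24) * euler_prod (nome \<tau>)"
  unfolding dedekind_eta_def euler_prod_def ..

lemma dedekind_eta_nonzero: "Im \<tau> > 0 \<Longrightarrow> dedekind_eta \<tau> \<noteq> 0"
  using euler_prod_nonzero[OF norm_nome_less_1] by (simp add: dedekind_eta_conv_euler_prod)

text \<open>The logarithmic derivative of eta is \<open>2 pi \<i> E_2/24\<close>, so the
  transformation of E_2 integrates to one of eta.\<close>

lemma has_field_derivative_dedekind_eta:
  assumes "Im \<tau> > 0"
  shows "(dedekind_eta has_field_derivative
           2 * of_real pi * \<i> * (1 / 24 - lambert_sum \<tau>) * dedekind_eta \<tau>) (at \<tau>)"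
proof -
  define q where "q = nome \<tau>"
  have q: "norm q < 1" unfolding q_def by (rule norm_nome_less_1[OF assms])
  have "(\<lambda>n. - q * (- (of_nat (Suc n) * q ^ n) / (1 - q ^ Suc n))) sums (- q * (deriv euler_prod q / euler_prod q))"
    by (intro sums_mult logderiv_euler_prod q)
  also have "(\<lambda>n. - q * (- (of_nat (Suc n) * q ^ n) / (1 - q ^ Suc n))) =
      (\<lambda>n. of_nat (Suc n) * q ^ Suc n / (1 - q ^ Suc n))"
    by (intro ext) (simp add: mult_ac del: of_nat_Suc)
  finally have "- q * (deriv euler_prod q / euler_prod q) = lambert_sum \<tau>"
    by (simp add: lambert_sum_def q_def sums_iff)
  hence L: "deriv euler_prod q * q = - lambert_sum \<tau> * euler_prod q"
  proof -
    have "- (deriv euler_prod q * q) = lambert_sum \<tau> * euler_prod q"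
      using \<open>_ = lambert_sum \<tau>\<close> euler_prod_nonzero[OF q] by (simp add: field_simps)
    hence "deriv euler_prod q * q = - (lambert_sum \<tau> * euler_prod q)" by (metis minus_minus)
    thus ?thesis by simp
  qed
  have d: "(euler_prod has_field_derivative deriv euler_prod q) (at q)"
    by (rule holomorphic_derivI[OF holomorphic_euler_prod]) (use q in auto)
  have "(nome has_field_derivative q * (2 * of_real pi * \<i>)) (at \<tau>)"
    unfolding q_def by (auto intro!: derivative_eq_intros)
  from DERIV_chain2[where f = euler_prod and g = nome and x = \<tau>, folded q_def, OF d this]
  have "((\<lambda>\<tau>. euler_prod (nome \<tau>)) has_field_derivative deriv euler_prod q * (q * (2 * of_real pi * \<i>))) (at \<tau>)" .
  also have "deriv euler_prod q * (q * (2 * of_real pi * \<i>)) = - lambert_sum \<tau> * euler_prod q * (2 * of_real pi * \<i>)"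
    by (simp only: mult.assoc[symmetric] L)
  finally have e: "((\<lambda>\<tau>. euler_prod (nome \<tau>)) has_field_derivative
      - lambert_sum \<tau> * euler_prod q * (2 * of_real pi * \<i>)) (at \<tau>)" .
  have "((\<lambda>\<tau>. exp (2 * of_real pi * \<i> * \<tau> / 24) * euler_prod (nome \<tau>)) has_field_derivative
      exp (2 * of_real pi * \<i> * \<tau> / 24) * (2 * of_real pi * \<i> / 24) * euler_prod q +
      (- lambert_sum \<tau> * euler_prod q * (2 * of_real pi * \<i>)) * exp (2 * of_real pi * \<i> * \<tau> / 24)) (at \<tau>)"
    unfolding q_def by (rule DERIV_mult[OF _ e[unfolded q_def]]) (auto intro!: derivative_eq_intros simp: mult_ac)
  also have "exp (2 * of_real pi * \<i> * \<tau> / 24) * (2 * of_real pi * \<i> / 24) * euler_prod q +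
      (- lambert_sum \<tau> * euler_prod q * (2 * of_real pi * \<i>)) * exp (2 * of_real pi * \<i> * \<tau> / 24)
      = 2 * of_real pi * \<i> * (1 / 24 - lambert_sum \<tau>) * (exp (2 * of_real pi * \<i> * \<tau> / 24) * euler_prod q)"
  proof -
    have "E * (K / 24) * P + (- L * P * K) * E = K * (1 / 24 - L) * (E * P)" for E K P L :: complex
      by (simp add: algebra_simps)
    thus ?thesis .
  qed
  finally show ?thesis
    unfolding dedekind_eta_conv_euler_prod[abs_def] q_def .
qed

lemma open_upper_half_plane: "open {\<tau>. Im \<tau> > 0}"
  and convex_upper_half_plane: "convex {\<tau>. Im \<tau> > 0}"
  by (simp_all add: open_halfspace_Im_gt convex_halfspace_Im_gt)

lemma holomorphic_dedekind_eta [holomorphic_intros]: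
  assumes "f holomorphic_on A" "\<And>z. z \<in> A \<Longrightarrow> Im (f z) > 0"
  shows "(\<lambda>z. dedekind_eta (f z)) holomorphic_on A"
proof -
  have "dedekind_eta holomorphic_on {\<tau>. Im \<tau> > 0}"
    using has_field_derivative_dedekind_eta by (auto simp: holomorphic_on_open open_upper_half_plane)
  from holomorphic_on_compose_gen[OF assms(1) this] assms(2) show ?thesis by (auto simp: o_def)
qed

text \<open>Only the square of the inversion formula up to a constant of modulus 1 is needed,
  which avoids a choice of branch.\<close>

lemma dedekind_eta_inversion:
  obtains w where "norm w = 1"
    "\<And>\<tau>. Im \<tau> > 0 \<Longrightarrow> dedekind_eta (- 1 / \<tau>) ^ 2 = w * \<tau> * dedekind_eta \<tau> ^ 2"
proof -
  define h where "h = (\<lambda>\<tau>. dedekind_eta (- 1 / \<tau>) ^ 2 / (\<tau> * dedekind_eta \<tau> ^ 2))"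
  have "\<exists>w. \<forall>\<tau>\<in>{\<tau>. Im \<tau> > 0}. h \<tau> = w"
  proof (rule has_field_derivative_zero_constant[OF convex_upper_half_plane])
    fix \<tau> assume "\<tau> \<in> {\<tau>. Im \<tau> > 0}"
    hence \<tau>: "Im \<tau> > 0" and t: "\<tau> \<noteq> 0" by auto
    define K :: complex where "K = 2 * of_real pi * \<i>"
    define L where "L = K * (1 / 24 - lambert_sum \<tau>)"
    define L' where "L' = K * (1 / 24 - lambert_sum (- 1 / \<tau>))"
    define e where "e = dedekind_eta \<tau>"
    define e' where "e' = dedekind_eta (- 1 / \<tau>)"
    have nz: "e \<noteq> 0" "e' \<noteq> 0"
      using \<tau> Im_minus_inverse_pos[OF \<tau>] by (auto simp: e_def e'_def dedekind_eta_nonzero)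
    \<comment> \<open>Twice this identity says that the non-modular term of E_2 is the logarithmic
      derivative of the factor \<tau> in \<open>h\<close>; hence that of \<open>h\<close>
      vanishes.\<close>
    have rel: "L' / \<tau>\<^sup>2 = L + 1 / (2 * \<tau>)"
    proof -
      have "L' / \<tau>\<^sup>2 = K * ((1 / \<tau>\<^sup>2) * (1 / 24 - lambert_sum (- 1 / \<tau>)))" by (simp add: L'_def)
      also have "\<dots> = L - K * (\<i> / (4 * of_real pi * \<tau>))"
        unfolding lambert_sum_inversion[OF \<tau>] by (simp add: L_def algebra_simps)
      also have "K * (\<i> / (4 * of_real pi * \<tau>)) = - (1 / (2 * \<tau>))"
        using t by (simp add: K_def field_simps)
      finally show ?thesis by simp
    qed
    have inv: "((\<lambda>\<tau>. - 1 / \<tau>) has_field_derivative 1 / \<tau>\<^sup>2) (at \<tau>)"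
      using t by (auto intro!: derivative_eq_intros simp: power2_eq_square)
    have d': "((\<lambda>\<tau>. dedekind_eta (- 1 / \<tau>)) has_field_derivative L' * e' * (1 / \<tau>\<^sup>2)) (at \<tau>)"
      using DERIV_chain2[where g = "\<lambda>\<tau>. - 1 / \<tau>", OF has_field_derivative_dedekind_eta[OF Im_minus_inverse_pos[OF \<tau>]] inv]
      by (simp add: L'_def e'_def K_def)
    have d: "(dedekind_eta has_field_derivative L * e) (at \<tau>)"
      using has_field_derivative_dedekind_eta[OF \<tau>] by (simp add: L_def e_def K_def)
    have d2': "((\<lambda>\<tau>. dedekind_eta (- 1 / \<tau>) ^ 2) has_field_derivative 2 * e' * (L' * e' * (1 / \<tau>\<^sup>2))) (at \<tau>)"
      using DERIV_power[OF d', of 2] by (simp add: e'_def mult_ac)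
    have d2: "((\<lambda>\<tau>. \<tau> * dedekind_eta \<tau> ^ 2) has_field_derivative e ^ 2 + \<tau> * (2 * e * (L * e))) (at \<tau>)"
      using DERIV_mult[OF DERIV_ident DERIV_power[OF d, of 2]] by (simp add: e_def mult_ac add_ac)
    have "(h has_field_derivative
        ((2 * e' * (L' * e' * (1 / \<tau>\<^sup>2))) * (\<tau> * e ^ 2) - e' ^ 2 * (e ^ 2 + \<tau> * (2 * e * (L * e)))) / (\<tau> * e ^ 2 * (\<tau> * e ^ 2))) (at \<tau>)"
      unfolding h_def
      by (rule DERIV_divide[OF d2' d2, folded e_def e'_def]) (use nz t in simp)
    also have "(2 * e' * (L' * e' * (1 / \<tau>\<^sup>2))) * (\<tau> * e ^ 2) - e' ^ 2 * (e ^ 2 + \<tau> * (2 * e * (L * e)))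
       = e' ^ 2 * e ^ 2 * (2 * \<tau> * (L' / \<tau>\<^sup>2) - 1 - 2 * \<tau> * L)"
      by (simp add: power2_eq_square algebra_simps)
    also have "2 * \<tau> * (L' / \<tau>\<^sup>2) - 1 - 2 * \<tau> * L = 0"
      unfolding rel using t by (simp add: algebra_simps)
    finally show "(h has_field_derivative 0) (at \<tau> within {\<tau>. Im \<tau> > 0})"
      by (simp add: has_field_derivative_at_within)
  qed
  then obtain w where w: "\<And>\<tau>. Im \<tau> > 0 \<Longrightarrow> h \<tau> = w" by blast
  \<comment> \<open>The inversion fixes \<i>, so the eta values cancel and the constant is
    \<open>1/\<i>\<close>.\<close>
  have "h \<i> = - \<i>" using dedekind_eta_nonzero[of \<i>] by (simp add: h_def)
  hence "norm w = 1" using w[of \<i>] by (metis norm_minus_cancel norm_ii imaginary_unit.sel(2) zero_less_one)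
  moreover have "dedekind_eta (- 1 / \<tau>) ^ 2 = w * \<tau> * dedekind_eta \<tau> ^ 2" if "Im \<tau> > 0" for \<tau>
    using w[OF that] dedekind_eta_nonzero[OF that] that by (auto simp: h_def field_simps)
  ultimately show ?thesis using that by blast
qed

lemma dedekind_eta_plus_1:
  "dedekind_eta (\<tau> + 1) = exp (2 * of_real pi * \<i> / 24) * dedekind_eta \<tau>"
  and nome_plus_1: "nome (\<tau> + 1) = nome \<tau>"
proof -
  show n: "nome (\<tau> + 1) = nome \<tau>"
    by (simp add: ring_distribs exp_add)
  show "dedekind_eta (\<tau> + 1) = exp (2 * of_real pi * \<i> / 24) * dedekind_eta \<tau>"
    unfolding dedekind_eta_conv_euler_prod n by (simp add: exp_add[symmetric] add_divide_distrib ring_distribs add.commute)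
qed

section \<open>The modular group\<close>

definition mob :: "int \<Rightarrow> int \<Rightarrow> int \<Rightarrow> int \<Rightarrow> complex \<Rightarrow> complex" where
  "mob a b c d \<tau> = (of_int a * \<tau> + of_int b) / (of_int c * \<tau> + of_int d)"

lemma mob_denominator_nonzero:
  assumes "Im \<tau> > 0" "a * d - b * c = 1"
  shows "of_int c * \<tau> + of_int d \<noteq> (0::complex)"
proof
  assume eq: "of_int c * \<tau> + of_int d = (0::complex)"
  hence "Im (of_int c * \<tau> + of_int d) = 0" by simp
  hence "c = 0" using assms(1) by simp
  with eq assms(2) show False by simp
qed

lemma Im_mob:
  assumes "Im \<tau> > 0" "a * d - b * c = 1"
  shows "Im (mob a b c d \<tau>) = Im \<tau> / (norm (of_int c * \<tau> + of_int d))\<^sup>2"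
proof -
  have "Im (mob a b c d \<tau>) = (of_int a * Im \<tau> * (of_int c * Re \<tau> + of_int d) - (of_int a * Re \<tau> + of_int b) * (of_int c * Im \<tau>))
      / (norm (of_int c * \<tau> + of_int d))\<^sup>2"
    by (simp add: mob_def Im_divide cmod_power2)
  also have "of_int a * Im \<tau> * (of_int c * Re \<tau> + of_int d) - (of_int a * Re \<tau> + of_int b) * (of_int c * Im \<tau>)
      = of_int (a * d - b * c) * Im \<tau>"
    by (simp add: algebra_simps)
  finally show ?thesis using assms(2) by simp
qed

lemma Im_mob_pos:
  assumes "Im \<tau> > 0" "a * d - b * c = 1"
  shows "Im (mob a b c d \<tau>) > 0"
  unfolding Im_mob[OF assms] using assms(1) mob_denominator_nonzero[OF assms] by simp

lemma mob_mob:
  assumes "of_int c' * \<tau> + of_int d' \<noteq> 0"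
  shows "mob a b c d (mob a' b' c' d' \<tau>) =
    mob (a * a' + b * c') (a * b' + b * d') (c * a' + d * c') (c * b' + d * d') \<tau>"
proof -
  define w where "w = of_int c' * \<tau> + of_int d'"
  have w: "w \<noteq> 0" using assms by (simp add: w_def)
  have *: "of_int x * ((of_int a' * \<tau> + of_int b') / w) + of_int y =
      (of_int (x * a' + y * c') * \<tau> + of_int (x * b' + y * d')) / w" for x y
    using w by (simp add: field_simps) (simp add: w_def algebra_simps)
  show ?thesis unfolding mob_def w_def[symmetric] * using w by simp
qed

lemma mob_inverse:
  assumes "Im \<tau> > 0" "a * d - b * c = 1"
  shows "mob d (- b) (- c) a (mob a b c d \<tau>) = \<tau>"
    and "mob a b c d (mob d (- b) (- c) a \<tau>) = \<tau>"
proof -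
  have *: "d * a - b * c = 1" "a * d - c * b = 1" "a * d - b * c = 1" using assms(2) by (simp_all add: mult.commute)
  show "mob d (- b) (- c) a (mob a b c d \<tau>) = \<tau>"
    by (subst mob_mob[OF mob_denominator_nonzero[OF assms]]) (simp add: mob_def * mult.commute)
  have "of_int (- c) * \<tau> + of_int a \<noteq> 0"
    by (rule mob_denominator_nonzero[OF assms(1), of d a "- b"]) (use * in simp)
  thus "mob a b c d (mob d (- b) (- c) a \<tau>) = \<tau>"
    by (subst mob_mob) (auto simp: mob_def * mult.commute)
qed

lemma shift_invariant_int:
  assumes T: "\<And>\<tau>. Im \<tau> > 0 \<Longrightarrow> f (\<tau> + 1) = f \<tau>" and "Im \<tau> > 0"
  shows "f (\<tau> + of_int n) = f \<tau>"
proof -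
  have nat: "f (\<tau> + of_nat k) = f \<tau>" if "Im \<tau> > 0" for k \<tau>
  proof (induction k)
    case (Suc k)
    have "f (\<tau> + of_nat k + 1) = f (\<tau> + of_nat k)" using that by (intro T) simp
    thus ?case using Suc by (simp add: add_ac)
  qed simp
  show ?thesis
  proof (cases "n \<ge> 0")
    case True
    thus ?thesis using nat[OF assms(2), of "nat n"] by simp
  next
    case False
    have "f ((\<tau> + of_int n) + of_nat (nat (- n))) = f (\<tau> + of_int n)"
      using assms(2) by (intro nat) simp
    thus ?thesis using False by simp
  qed
qed

text \<open>Translation and inversion generate the modular group: the Euclidean algorithm on the
  first column, as an induction on the absolute value of the lower left entry.\<close>

lemma modular_invariant:
  assumes T: "\<And>\<tau>. Im \<tau> > 0 \<Longrightarrow> f (\<tau> + 1) = f \<tau>"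
    and S: "\<And>\<tau>. Im \<tau> > 0 \<Longrightarrow> f (- 1 / \<tau>) = f \<tau>"
    and "Im \<tau> > 0" "a * d - b * c = 1"
  shows "f (mob a b c d \<tau>) = f \<tau>"
  using assms(4)
proof (induction "nat \<bar>c\<bar>" arbitrary: a b c d rule: less_induct)
  case less
  show ?case
  proof (cases "c = 0")
    case True
    hence "(a = 1 \<and> d = 1) \<or> (a = -1 \<and> d = -1)" using less.prems by (simp add: zmult_eq_1_iff)
    hence "mob a b c d \<tau> = \<tau> + of_int b \<or> mob a b c d \<tau> = \<tau> + of_int (- b)"
      using True by (auto simp: mob_def)
    thus ?thesis using shift_invariant_int[of f, OF T assms(3)] by metis
  next
    case False
    \<comment> \<open>The sign of \<open>c\<close> is taken out so that \<open>r\<close> is the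
      remainder of \<open>a\<close> modulo \<open>|c|\<close>. Translating by \<open>-q\<close> and
      then inverting makes \<open>r\<close> the new lower left entry.\<close>
    define q r where "q = a div \<bar>c\<bar> * sgn c" and "r = a - q * c"
    have r: "r = a mod \<bar>c\<bar>"
      unfolding r_def q_def using div_mult_mod_eq[of a "\<bar>c\<bar>"] by (simp add: mult.assoc mult_sgn_abs sgn_mult_abs abs_sgn mult.commute)
    have rc: "nat \<bar>r\<bar> < nat \<bar>c\<bar>" unfolding r using False by simp
    define b' where "b' = b - q * d"
    have det: "r * d - b' * c = 1" using less.prems by (simp add: r_def b'_def algebra_simps)
    have det': "(- c) * b' - (- d) * r = 1" using det by (simp add: algebra_simps)
    have nz: "of_int c * \<tau> + of_int d \<noteq> (0::complex)" by (rule mob_denominator_nonzero[OF assms(3) det])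
    have "mob a b c d \<tau> = mob r b' c d \<tau> + of_int q"
      using nz by (simp add: mob_def r_def b'_def field_simps)
    hence "f (mob a b c d \<tau>) = f (mob r b' c d \<tau>)"
      using shift_invariant_int[of f, OF T Im_mob_pos[OF assms(3) det]] by simp
    also have "\<dots> = f (- 1 / mob r b' c d \<tau>)" by (rule S[OF Im_mob_pos[OF assms(3) det], symmetric])
    also have "- 1 / mob r b' c d \<tau> = mob (- c) (- d) r b' \<tau>" by (simp add: mob_def minus_divide_left)
    also have "f \<dots> = f \<tau>" by (rule less.hyps[OF rc det'])
    finally show ?thesis .
  qed
qed

text \<open>This half-strip is larger than the usual fundamental domain, but stays away from the
  real axis, which is enough for a compactness argument. If \<open>|Re \<sigma>| \<le> 1/2\<close>
  and \<open>Im \<sigma> < 1/2\<close>, then \<open>|\<sigma>|^2 \<le> 1/2\<close> and the inversion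
  at least doubles \<open>Im\<close>; the number \<open>k\<close> bounds the doublings still
  required.\<close>

lemma modular_reduction:
  assumes T: "\<And>\<tau>. Im \<tau> > 0 \<Longrightarrow> f (\<tau> + 1) = f \<tau>"
    and S: "\<And>\<tau>. Im \<tau> > 0 \<Longrightarrow> f (- 1 / \<tau>) = f \<tau>"
    and "Im \<tau> > 0"
  shows "\<exists>\<sigma>. Im \<sigma> \<ge> 1 / 2 \<and> \<bar>Re \<sigma>\<bar> \<le> 1 / 2 \<and> f \<sigma> = f \<tau>"
proof -
  obtain k where "1 / Im \<tau> < 2 ^ k" using real_arch_pow[of 2 "1 / Im \<tau>"] by auto
  hence "Im \<tau> * 2 ^ k \<ge> 1 / 2" using assms(3) by (simp add: field_simps)
  thus ?thesis using assms(3)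
  proof (induction k arbitrary: \<tau>)
    case (0 \<tau>)
    define \<sigma> where "\<sigma> = \<tau> + of_int (- round (Re \<tau>))"
    have "\<bar>Re \<sigma>\<bar> \<le> 1 / 2" using of_int_round_abs_le[of "Re \<tau>"] by (simp add: \<sigma>_def abs_if split: if_splits)
    moreover have "f \<sigma> = f \<tau>" unfolding \<sigma>_def by (rule shift_invariant_int[of f, OF T 0(2)])
    moreover have "Im \<sigma> \<ge> 1 / 2" using 0 by (simp add: \<sigma>_def)
    ultimately show ?case by blast
  next
    case (Suc k \<tau>)
    define \<sigma> where "\<sigma> = \<tau> + of_int (- round (Re \<tau>))"
    have Re: "\<bar>Re \<sigma>\<bar> \<le> 1 / 2" using of_int_round_abs_le[of "Re \<tau>"] by (simp add: \<sigma>_def abs_if split: if_splits)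
    have f: "f \<sigma> = f \<tau>" unfolding \<sigma>_def by (rule shift_invariant_int[of f, OF T Suc.prems(2)])
    have Im: "Im \<sigma> = Im \<tau>" by (simp add: \<sigma>_def)
    show ?case
    proof (cases "Im \<tau> \<ge> 1 / 2")
      case True
      thus ?thesis using Re f Im by (intro exI[of _ \<sigma>]) simp
    next
      case False
      have "\<bar>Re \<sigma>\<bar>\<^sup>2 \<le> (1/2)\<^sup>2" using Re by (intro power_mono) auto
      moreover have "(Im \<sigma>)\<^sup>2 \<le> (1/2)\<^sup>2" using False Im Suc.prems by (intro power_mono) auto
      ultimately have "(norm \<sigma>)\<^sup>2 \<le> 1 / 2" unfolding cmod_power2 by (simp add: power2_eq_square)
      moreover have "norm \<sigma> > 0" using Im Suc.prems(2) by auto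
      ultimately have "Im \<sigma> / (norm \<sigma>)\<^sup>2 \<ge> Im \<sigma> / (1 / 2)"
        using Suc.prems Im by (intro divide_left_mono) auto
      hence ge: "Im (- 1 / \<sigma>) \<ge> 2 * Im \<tau>" unfolding Im_minus_inverse by (simp add: Im)
      have "Im (- 1 / \<sigma>) * 2 ^ k \<ge> 1 / 2"
        using Suc.prems(1) mult_right_mono[OF ge, of "2 ^ k"] by simp
      moreover have "Im (- 1 / \<sigma>) > 0" using ge Suc.prems by simp
      ultimately obtain \<rho> where "Im \<rho> \<ge> 1 / 2" "\<bar>Re \<rho>\<bar> \<le> 1 / 2" "f \<rho> = f (- 1 / \<sigma>)"
        using Suc.IH by blast
      thus ?thesis using S[of \<sigma>] f Im Suc.prems by auto
    qed
  qed
qed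

section \<open>A vanishing criterion\<close>

text \<open>Holomorphic functions on a connected open set have no zero divisors: where one factor is
  nonzero, an open set, the product of the others vanishes, and the identity theorem extends
  this.\<close>

lemma product_zero_imp_factor_zero:
  assumes "finite G" "\<And>g. g \<in> G \<Longrightarrow> g holomorphic_on A" "open A" "connected A" "A \<noteq> {}"
    and "\<And>z. z \<in> A \<Longrightarrow> (\<Prod>g\<in>G. g z) = (0::complex)"
  shows "\<exists>g\<in>G. \<forall>z\<in>A. g z = 0"
  using assms(1,2,6)
proof (induction G rule: finite_induct)
  case empty
  thus ?case using assms(5) by auto
next
  case (insert g G)
  show ?case
  proof (cases "\<forall>z\<in>A. g z = 0")
    case False
    then obtain z0 where z0: "z0 \<in> A" "g z0 \<noteq> 0" by blast
    have "continuous_on A g" using insert.prems(1) by (auto intro: holomorphic_on_imp_continuous_on)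
    hence op: "open (A \<inter> g -` (- {0}))"
      by (intro continuous_open_preimage assms(3)) auto
    have "(\<Prod>g\<in>G. g z) = 0" if "z \<in> A" for z
    proof (rule analytic_continuation_open[where s = "A \<inter> g -` (- {0})" and s' = A and f = "\<lambda>z. \<Prod>g\<in>G. g z" and g = "\<lambda>_. 0"])
      show "(\<Prod>h\<in>G. h w) = 0" if "w \<in> A \<inter> g -` (- {0})" for w
        using insert.prems(2)[of w] insert.hyps that by auto
    qed (use z0 op assms that insert.prems(1) in \<open>auto intro!: holomorphic_intros\<close>)
    thus ?thesis using insert.IH insert.prems by auto
  qed auto
qed

text \<open>The product of all the functions \<open>f \<circ> \<gamma>\<close> is a modular function without poles, also at
  the cusp, and vanishes there.  Only a list \<open>h\<close> containing all of these functions is given, so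
  that exponents of growth of repeated functions may be counted too often.\<close>

lemma modular_vanishing:
  fixes f :: "complex \<Rightarrow> complex" and h :: "'i \<Rightarrow> complex \<Rightarrow> complex" and w :: "'i \<Rightarrow> real"
  assumes hol: "f holomorphic_on {\<tau>. Im \<tau> > 0}"
    and I: "finite I" "i0 \<in> I"
    and h: "\<And>a b c d. a * d - b * c = 1 \<Longrightarrow> \<exists>i\<in>I. \<forall>\<tau>. Im \<tau> > 0 \<longrightarrow> f (mob a b c d \<tau>) = h i \<tau>"
    and h0: "\<And>\<tau>. Im \<tau> > 0 \<Longrightarrow> h i0 \<tau> = f \<tau>"
    and bound: "\<And>i. i \<in> I \<Longrightarrow> \<exists>C. \<forall>\<tau>. Im \<tau> \<ge> 1 \<longrightarrow> norm (h i \<tau>) \<le> C * exp (2 * pi * w i * Im \<tau>)"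
    and w: "\<And>i. i \<in> I \<Longrightarrow> i \<noteq> i0 \<Longrightarrow> w i \<ge> 0" "(\<Sum>i\<in>I. w i) < 0"
    and "Im \<tau> > 0"
  shows "f \<tau> = 0"
proof -
  define H where "H = {\<tau>. Im \<tau> > 0}"
  have oH: "open H" and cH: "connected H" and neH: "H \<noteq> {}"
    using open_upper_half_plane convex_upper_half_plane assms(9) by (auto simp: H_def convex_connected)
  \<comment> \<open>Setting the functions to 0 outside the half plane makes transforms that agree on
    it equal, so that \<open>G\<close> is finite and each transform is counted once.\<close>
  define R where "R g = (\<lambda>\<tau>. if Im \<tau> > 0 then g \<tau> else 0)" for g :: "complex \<Rightarrow> complex"
  define G where "G = {R (\<lambda>\<tau>. f (mob a b c d \<tau>)) | a b c d. a * d - b * c = 1}"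
  have "G \<subseteq> (\<lambda>i. R (h i)) ` I"
  proof
    fix g assume "g \<in> G"
    then obtain a b c d where g: "g = R (\<lambda>\<tau>. f (mob a b c d \<tau>))" "a * d - b * c = 1" unfolding G_def by blast
    with h obtain i where "i \<in> I" "\<forall>\<tau>. Im \<tau> > 0 \<longrightarrow> f (mob a b c d \<tau>) = h i \<tau>" by blast
    thus "g \<in> (\<lambda>i. R (h i)) ` I" by (auto simp: g R_def fun_eq_iff intro!: image_eqI[of _ _ i])
  qed
  hence finG: "finite G" and Gsub: "\<And>g. g \<in> G \<Longrightarrow> \<exists>i\<in>I. g = R (h i)"
    using I finite_surj by blast+
  have Rf: "R f \<in> G" unfolding G_def
    by (rule CollectI, rule exI[of _ 1], rule exI[of _ 0], rule exI[of _ 0], rule exI[of _ 1])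
       (simp add: mob_def)
  have holG: "g holomorphic_on H" if gG: "g \<in> G" for g
  proof -
    obtain a b c d where g: "g = R (\<lambda>\<tau>. f (mob a b c d \<tau>))" "a * d - b * c = 1" using gG unfolding G_def by blast
    have "mob a b c d holomorphic_on H"
      unfolding mob_def[abs_def] using mob_denominator_nonzero[OF _ g(2)]
      by (intro holomorphic_intros) (auto simp: H_def)
    hence "(f \<circ> mob a b c d) holomorphic_on H"
      by (rule holomorphic_on_compose_gen[OF _ hol]) (use Im_mob_pos[OF _ g(2)] in \<open>auto simp: H_def\<close>)
    thus ?thesis
      by (rule holomorphic_transform) (auto simp: g R_def H_def)
  qed
  define F where "F \<tau> = (\<Prod>g\<in>G. g \<tau>)" for \<tau>
  have holF: "F holomorphic_on H" unfolding F_def by (intro holomorphic_intros holG)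
  have Finv: "F (mob a b c d \<tau>) = F \<tau>" if det: "a * d - b * c = 1" and \<tau>: "Im \<tau> > 0" for a b c d \<tau>
  proof -
    \<comment> \<open>Composition with a fixed matrix is an injective self-map of the finite set
      \<open>G\<close>, hence a permutation of the factors of \<open>F\<close>.\<close>
    define \<Phi> where "\<Phi> g = R (\<lambda>\<tau>. g (mob a b c d \<tau>))" for g :: "complex \<Rightarrow> complex"
    have endo: "\<Phi> ` G \<subseteq> G"
    proof safe
      fix g assume "g \<in> G"
      then obtain a' b' c' d' where g: "g = R (\<lambda>\<tau>. f (mob a' b' c' d' \<tau>))" "a' * d' - b' * c' = 1" unfolding G_def by blast
      have "\<Phi> g = R (\<lambda>\<tau>. f (mob (a' * a + b' * c) (a' * b + b' * d) (c' * a + d' * c) (c' * b + d' * d) \<tau>))"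
        unfolding \<Phi>_def g R_def using Im_mob_pos[OF _ det] mob_mob mob_denominator_nonzero[OF _ det]
        by (auto simp: fun_eq_iff)
      moreover have "(a' * a + b' * c) * (c' * b + d' * d) - (a' * b + b' * d) * (c' * a + d' * c) =
          (a' * d' - b' * c') * (a * d - b * c)" by (simp add: algebra_simps)
      hence "(a' * a + b' * c) * (c' * b + d' * d) - (a' * b + b' * d) * (c' * a + d' * c) = 1"
        using det g(2) by simp
      ultimately show "\<Phi> g \<in> G" unfolding G_def by blast
    qed
    have inj: "inj_on \<Phi> G"
    proof (rule inj_onI)
      fix g g' assume gg: "g \<in> G" "g' \<in> G" "\<Phi> g = \<Phi> g'"
      have det': "d * a - (- b) * (- c) = 1" using det by (simp add: mult.commute)
      have "g \<sigma> = g' \<sigma>" if "Im \<sigma> > 0" for \<sigma>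
        using fun_cong[OF gg(3), of "mob d (- b) (- c) a \<sigma>"] Im_mob_pos[OF that det'] mob_inverse(2)[OF that det]
        by (simp add: \<Phi>_def R_def)
      moreover have "g \<sigma> = 0 \<and> g' \<sigma> = 0" if "\<not> Im \<sigma> > 0" for \<sigma>
        using gg(1,2) that by (auto simp: G_def R_def)
      ultimately show "g = g'" by (metis ext)
    qed
    have img: "\<Phi> ` G = G" by (rule endo_inj_surj[OF finG endo inj])
    have "F (mob a b c d \<tau>) = (\<Prod>g\<in>G. \<Phi> g \<tau>)"
      unfolding F_def \<Phi>_def R_def using \<tau> by simp
    also have "\<dots> = F \<tau>" unfolding F_def by (rule prod.reindex_cong[OF inj, symmetric]) (use img in auto)
    finally show ?thesis .
  qed
  have FT: "F (\<tau> + 1) = F \<tau>" and FS: "F (- 1 / \<tau>) = F \<tau>" if "Im \<tau> > 0" for \<tau>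
    using Finv[of 1 1 1 0 \<tau>] Finv[of 0 0 "-1" 1 \<tau>] that by (simp_all add: mob_def)
  obtain C where C: "\<And>i \<tau>. i \<in> I \<Longrightarrow> Im \<tau> \<ge> 1 \<Longrightarrow> norm (h i \<tau>) \<le> C i * exp (2 * pi * w i * Im \<tau>)"
    using bound by metis
  \<comment> \<open>The transform \<open>R f\<close> must receive the index \<open>i0\<close>, the
    only one whose weight may be negative. The weights of the indices left out are nonnegative, so
    leaving them out only lowers the sum.\<close>
  define rep where "rep g = (if g = R f then i0 else SOME i. i \<in> I \<and> g = R (h i))" for g
  have rep: "rep g \<in> I" "g = R (h (rep g))" if "g \<in> G" for g
  proof -
    have "R (h i0) = R f" by (auto simp: R_def h0)
    thus "rep g \<in> I" "g = R (h (rep g))"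
      using someI_ex[of "\<lambda>i. i \<in> I \<and> g = R (h i)"] Gsub[OF that] I(2) by (auto simp: rep_def)
  qed
  have injrep: "inj_on rep G" by (rule inj_onI) (metis rep(2))
  define W where "W = (\<Sum>i\<in>rep ` G. w i)"
  have i0rep: "i0 \<in> rep ` G" using Rf by (auto simp: rep_def intro!: image_eqI[of _ _ "R f"])
  have "W \<le> (\<Sum>i\<in>I. w i)"
    unfolding W_def by (rule sum_mono2[OF I(1)]) (use rep(1) i0rep w(1) in auto)
  hence W: "W < 0" using w(2) by simp
  define K where "K = (\<Prod>g\<in>G. C (rep g))"
  have Fb: "norm (F \<tau>) \<le> K * exp (2 * pi * W * Im \<tau>)" if "Im \<tau> \<ge> 1" for \<tau>
  proof -
    have "norm (F \<tau>) = (\<Prod>g\<in>G. norm (g \<tau>))" by (simp add: F_def prod_norm)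
    also have "\<dots> \<le> (\<Prod>g\<in>G. C (rep g) * exp (2 * pi * w (rep g) * Im \<tau>))"
    proof (intro prod_mono conjI)
      fix g assume g: "g \<in> G"
      have "g \<tau> = h (rep g) \<tau>" using fun_cong[OF rep(2)[OF g], of \<tau>] that by (simp add: R_def)
      thus "norm (g \<tau>) \<le> C (rep g) * exp (2 * pi * w (rep g) * Im \<tau>)" using C[OF rep(1)[OF g] that] by simp
    qed auto
    also have "\<dots> = K * exp (\<Sum>g\<in>G. 2 * pi * w (rep g) * Im \<tau>)"
      by (simp add: K_def prod.distrib exp_sum[OF finG])
    also have "(\<Sum>g\<in>G. 2 * pi * w (rep g) * Im \<tau>) = 2 * pi * W * Im \<tau>"
      unfolding W_def sum.reindex[OF injrep] by (simp add: sum_distrib_left sum_distrib_right)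
    finally show ?thesis .
  qed
  have small: "\<exists>Y\<ge>1. \<forall>\<tau>. Im \<tau> \<ge> Y \<longrightarrow> norm (F \<tau>) < e" if "e > 0" for e
  proof -
    have "((\<lambda>y. K * exp (2 * pi * W * y)) \<longlongrightarrow> 0) at_top"
      using W by (intro tendsto_mult_right_zero filterlim_compose[OF exp_at_bot]
        filterlim_tendsto_neg_mult_at_bot[OF tendsto_const _ filterlim_ident]) (auto simp: mult_pos_neg)
    hence "\<forall>\<^sub>F y in at_top. K * exp (2 * pi * W * y) < e" using that by (rule order_tendstoD)
    then obtain Y where "\<And>y. y \<ge> Y \<Longrightarrow> K * exp (2 * pi * W * y) < e" by (auto simp: eventually_at_top_linorder)
    thus ?thesis using Fb by (intro exI[of _ "max 1 Y"]) (meson le_max_iff_disj max.bounded_iff order_le_less_trans order.trans max.cobounded1)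
  qed
  have F0: "F \<tau> = 0" if \<tau>: "\<tau> \<in> H" for \<tau>
  proof (rule ccontr)
    \<comment> \<open>Above height \<open>Y\<close> the modulus of \<open>F\<close> is smaller than
      at \<tau>. By reduction to the half-strip, its supremum is attained in the compact box
      \<open>B\<close>; then \<open>F\<close> is constant, which contradicts the decay at the
      cusp.\<close>
    assume nz: "F \<tau> \<noteq> 0"
    obtain Y where Y: "Y \<ge> 1" "\<And>\<sigma>. Im \<sigma> \<ge> Y \<Longrightarrow> norm (F \<sigma>) < norm (F \<tau>)"
      using small[of "norm (F \<tau>)"] nz by auto
    define B where "B = cbox (Complex (-1/2) (1/2)) (Complex (1/2) Y)"
    have B: "z \<in> B \<longleftrightarrow> \<bar>Re z\<bar> \<le> 1/2 \<and> 1/2 \<le> Im z \<and> Im z \<le> Y" for z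
      by (auto simp: B_def in_cbox_complex_iff)
    have BH: "B \<subseteq> H" by (auto simp: B H_def)
    have red: "\<exists>z\<in>B. norm (F \<sigma>) \<le> norm (F z)" if \<sigma>: "Im \<sigma> > 0" "norm (F \<sigma>) \<ge> norm (F \<tau>)" for \<sigma>
    proof -
      obtain z where z: "Im z \<ge> 1 / 2" "\<bar>Re z\<bar> \<le> 1 / 2" "F z = F \<sigma>"
        using modular_reduction[of F, OF FT FS \<sigma>(1)] by blast
      hence "Im z \<le> Y" using Y(2)[of z] \<sigma> by fastforce
      thus ?thesis using z by (intro bexI[of _ z]) (auto simp: B)
    qed
    have "B \<noteq> {}" using red[of \<tau>] \<tau> by (auto simp: H_def)
    moreover have "continuous_on B (\<lambda>z. norm (F z))"
      by (intro continuous_intros holomorphic_on_imp_continuous_on holomorphic_on_subset[OF holF BH])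
    ultimately obtain z0 where z0: "z0 \<in> B" "\<And>z. z \<in> B \<Longrightarrow> norm (F z) \<le> norm (F z0)"
      using continuous_attains_sup[of B "\<lambda>z. norm (F z)"] compact_cbox unfolding B_def by blast
    have max: "norm (F \<sigma>) \<le> norm (F z0)" if "\<sigma> \<in> H" for \<sigma>
    proof (cases "norm (F \<sigma>) \<ge> norm (F \<tau>)")
      case True
      thus ?thesis using red[of \<sigma>] that z0(2) by (force simp: H_def)
    next
      case False
      thus ?thesis using red[of \<tau>] \<tau> z0(2) by (force simp: H_def)
    qed
    have "F constant_on H"
      by (rule maximum_modulus_principle[OF holF oH cH oH order_refl, of z0]) (use z0 BH max in auto)
    hence const: "F \<sigma> = F \<tau>" if "\<sigma> \<in> H" for \<sigma> using that \<tau> unfolding constant_on_def by metis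
    have "\<i> * of_real Y \<in> H" using Y(1) by (simp add: H_def)
    from const[OF this] Y(2)[of "\<i> * of_real Y"] show False by simp
  qed
  obtain g where g: "g \<in> G" "\<forall>z\<in>H. g z = 0"
    using product_zero_imp_factor_zero[OF finG holG oH cH neH] F0 unfolding F_def by blast
  then obtain a b c d where g': "g = R (\<lambda>\<tau>. f (mob a b c d \<tau>))" "a * d - b * c = 1" unfolding G_def by blast
  have det': "d * a - (- b) * (- c) = 1" using g'(2) by (simp add: mult.commute)
  have "g (mob d (- b) (- c) a \<tau>) = 0" using g(2) Im_mob_pos[OF assms(9) det'] by (auto simp: H_def)
  thus ?thesis using Im_mob_pos[OF assms(9) det'] mob_inverse(2)[OF assms(9) g'(2)] by (simp add: g' R_def)
qed

section \<open>Eta quotients\<close>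

text \<open>A pole of order at most \<open>w\<close> at \<i>\<infinity>, measured in the nome; a
  negative \<open>w\<close> prescribes a zero. The order is real because expansions at the other
  cusps involve fractional powers of the nome.\<close>

definition growth :: "(complex \<Rightarrow> complex) \<Rightarrow> real \<Rightarrow> bool" where
  "growth g w \<longleftrightarrow> (\<exists>C. \<forall>\<tau>. Im \<tau> \<ge> 1 \<longrightarrow> norm (g \<tau>) \<le> C * exp (2 * pi * w * Im \<tau>))"

lemma growthI: "(\<And>\<tau>. Im \<tau> \<ge> 1 \<Longrightarrow> norm (g \<tau>) \<le> C * exp (2 * pi * w * Im \<tau>)) \<Longrightarrow> growth g w"
  unfolding growth_def by blast

lemma growthE:
  assumes "growth g w"
  obtains C where "C \<ge> 0" "\<And>\<tau>. Im \<tau> \<ge> 1 \<Longrightarrow> norm (g \<tau>) \<le> C * exp (2 * pi * w * Im \<tau>)"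
proof -
  obtain C where C: "\<And>\<tau>. Im \<tau> \<ge> 1 \<Longrightarrow> norm (g \<tau>) \<le> C * exp (2 * pi * w * Im \<tau>)"
    using assms unfolding growth_def by blast
  have "0 \<le> C * exp (2 * pi * w * Im \<i>)" by (rule order_trans[OF norm_ge_zero C]) simp
  hence "C \<ge> 0" using exp_gt_zero zero_le_mult_iff not_less by blast
  from that[OF this C] show ?thesis .
qed

lemma growth_mono:
  assumes "growth g w" "w \<le> w'"
  shows "growth g w'"
proof -
  obtain C where C: "C \<ge> 0" "\<And>\<tau>. Im \<tau> \<ge> 1 \<Longrightarrow> norm (g \<tau>) \<le> C * exp (2 * pi * w * Im \<tau>)"
    using growthE[OF assms(1)] by blast
  show ?thesis
  proof (rule growthI[where C = C])
    fix \<tau> :: complex assume \<tau>: "Im \<tau> \<ge> 1"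
    have "C * exp (2 * pi * w * Im \<tau>) \<le> C * exp (2 * pi * w' * Im \<tau>)"
    proof (intro mult_left_mono C(1) exp_le_cancel_iff[THEN iffD2])
      show "2 * pi * w * Im \<tau> \<le> 2 * pi * w' * Im \<tau>"
        using assms(2) \<tau> by (intro mult_right_mono mult_left_mono) auto
    qed
    thus "norm (g \<tau>) \<le> C * exp (2 * pi * w' * Im \<tau>)" using C(2)[OF \<tau>] by linarith
  qed
qed

lemma growth_cong: "(\<And>\<tau>. Im \<tau> > 0 \<Longrightarrow> f \<tau> = g \<tau>) \<Longrightarrow> growth f w \<longleftrightarrow> growth g w"
  by (simp add: growth_def)

lemma growth_const: "w \<ge> 0 \<Longrightarrow> growth (\<lambda>_. c) w"
  by (rule growth_mono[of _ 0], rule growthI[of _ "norm c"]) auto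

lemma growth_mult:
  assumes "growth f v" "growth g w"
  shows "growth (\<lambda>\<tau>. f \<tau> * g \<tau>) (v + w)"
proof -
  obtain C where C: "C \<ge> 0" "\<And>\<tau>. Im \<tau> \<ge> 1 \<Longrightarrow> norm (f \<tau>) \<le> C * exp (2 * pi * v * Im \<tau>)"
    using growthE[OF assms(1)] by blast
  obtain D where D: "D \<ge> 0" "\<And>\<tau>. Im \<tau> \<ge> 1 \<Longrightarrow> norm (g \<tau>) \<le> D * exp (2 * pi * w * Im \<tau>)"
    using growthE[OF assms(2)] by blast
  show ?thesis
  proof (rule growthI[where C = "C * D"])
    fix \<tau> :: complex assume \<tau>: "Im \<tau> \<ge> 1"
    have "norm (f \<tau> * g \<tau>) \<le> (C * exp (2 * pi * v * Im \<tau>)) * (D * exp (2 * pi * w * Im \<tau>))"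
      unfolding norm_mult using C D \<tau> by (intro mult_mono) auto
    also have "\<dots> = C * D * exp (2 * pi * (v + w) * Im \<tau>)" by (simp add: exp_add ring_distribs)
    finally show "norm (f \<tau> * g \<tau>) \<le> C * D * exp (2 * pi * (v + w) * Im \<tau>)" .
  qed
qed

lemma growth_add:
  assumes "growth f w" "growth g w"
  shows "growth (\<lambda>\<tau>. f \<tau> + g \<tau>) w"
proof -
  obtain C where C: "\<And>\<tau>. Im \<tau> \<ge> 1 \<Longrightarrow> norm (f \<tau>) \<le> C * exp (2 * pi * w * Im \<tau>)"
    using growthE[OF assms(1)] by blast
  obtain D where D: "\<And>\<tau>. Im \<tau> \<ge> 1 \<Longrightarrow> norm (g \<tau>) \<le> D * exp (2 * pi * w * Im \<tau>)"
    using growthE[OF assms(2)] by blast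
  show ?thesis
  proof (rule growthI[where C = "C + D"])
    fix \<tau> :: complex assume \<tau>: "Im \<tau> \<ge> 1"
    have "norm (f \<tau> + g \<tau>) \<le> C * exp (2 * pi * w * Im \<tau>) + D * exp (2 * pi * w * Im \<tau>)"
      by (rule order_trans[OF norm_triangle_ineq add_mono[OF C[OF \<tau>] D[OF \<tau>]]])
    thus "norm (f \<tau> + g \<tau>) \<le> (C + D) * exp (2 * pi * w * Im \<tau>)" by (simp only: distrib_right)
  qed
qed

lemma growth_uminus: "growth f w \<Longrightarrow> growth (\<lambda>\<tau>. - f \<tau>) w"
  by (simp add: growth_def)

lemma growth_diff: "growth f w \<Longrightarrow> growth g w \<Longrightarrow> growth (\<lambda>\<tau>. f \<tau> - g \<tau>) w"
  using growth_add[OF _ growth_uminus] by simp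

text \<open>In absolute values the constant of the inversion formula disappears, and the factor
  \<open>|\<tau>|^2\<close> that is left cancels against the change of \<open>Im\<close>.\<close>

lemma norm_dedekind_eta_modular:
  assumes "Im \<tau> > 0" "a * d - b * c = 1"
  shows "norm (dedekind_eta (mob a b c d \<tau>)) ^ 4 * Im (mob a b c d \<tau>) = norm (dedekind_eta \<tau>) ^ 4 * Im \<tau>"
proof (rule modular_invariant[where f = "\<lambda>\<tau>. norm (dedekind_eta \<tau>) ^ 4 * Im \<tau>", OF _ _ assms])
  fix \<tau> :: complex assume \<tau>: "Im \<tau> > 0"
  show "norm (dedekind_eta (\<tau> + 1)) ^ 4 * Im (\<tau> + 1) = norm (dedekind_eta \<tau>) ^ 4 * Im \<tau>"
    by (simp add: dedekind_eta_plus_1 norm_mult)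
  obtain w where w: "norm w = 1" "dedekind_eta (- 1 / \<tau>) ^ 2 = w * \<tau> * dedekind_eta \<tau> ^ 2"
    using dedekind_eta_inversion \<tau> by metis
  have "norm (dedekind_eta (- 1 / \<tau>)) ^ 4 = (norm (dedekind_eta (- 1 / \<tau>) ^ 2))\<^sup>2"
    by (simp add: norm_power)
  also have "\<dots> = (norm \<tau>)\<^sup>2 * norm (dedekind_eta \<tau>) ^ 4"
    unfolding w(2) by (simp add: norm_mult norm_power w(1) power_mult_distrib)
  finally show "norm (dedekind_eta (- 1 / \<tau>)) ^ 4 * Im (- 1 / \<tau>) = norm (dedekind_eta \<tau>) ^ 4 * Im \<tau>"
    unfolding Im_minus_inverse using \<tau> by (cases "\<tau> = 0") auto
qed

text \<open>The integral matrix of \<open>m\<close> times the map factors as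
  \<open>(D a, y; c', x)\<close>, of determinant 1, times the triangular \<open>(A, B; 0, D)\<close>
  with \<open>A D = m\<close>. The last factor of the formula is the same for all \<open>m\<close>,
  so that it cancels in quotients of weight 0.\<close>

lemma norm_dedekind_eta_mult_mob:
  fixes m :: nat
  assumes m: "m > 0" and det: "a * d - b * c = 1"
  defines "A \<equiv> gcd (int m) c"
  shows "\<exists>B. \<forall>\<tau>. Im \<tau> > 0 \<longrightarrow>
    norm (dedekind_eta (of_nat m * mob a b c d \<tau>)) =
    norm (dedekind_eta ((of_int A * \<tau> + of_int B) / of_int (int m div A))) * sqrt (of_int A / real m)
      * (Im \<tau> / Im (mob a b c d \<tau>)) powr (1 / 4)"
proof -
  have A: "A > 0" "A dvd int m" "A dvd c" using m by (auto simp: A_def)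
  define D where "D = int m div A"
  define c' where "c' = c div A"
  have mAD: "int m = A * D" and cA: "c = A * c'" using A by (auto simp: D_def c'_def)
  have D: "D > 0" using mAD A(1) m by (metis of_nat_0_less_iff zero_less_mult_pos)
  have "coprime D c'" unfolding D_def c'_def A_def using m by (intro div_gcd_coprime) auto
  moreover have "coprime a c'"
  proof (rule coprimeI)
    fix l assume "l dvd a" "l dvd c'"
    hence "l dvd a * d - b * (A * c')" by simp
    thus "is_unit l" using det by (simp add: cA)
  qed
  ultimately have "gcd (D * a) c' = 1" by simp
  then obtain u v where uv: "u * (D * a) + v * c' = 1" using bezout_int[of "D * a" c'] by auto
  \<comment> \<open>Bezout's identity completes the primitive column \<open>(D a, c')\<close> to a
    matrix of determinant 1.\<close>
  define x y where "x = u" and "y = - v"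
  have xy: "(D * a) * x - y * c' = 1" using uv by (simp add: x_def y_def mult.commute)
  \<comment> \<open>The inverse of that matrix sends the column \<open>(m b, d)\<close> to
    \<open>(B, D)\<close>; \<open>B1\<close> and \<open>B2\<close> say the same in the other
    direction.\<close>
  define B where "B = x * (int m * b) - y * d"
  have B1: "c' * B + x * D = d"
  proof -
    have "c' * B + x * D = x * D * (1 + b * c) - y * c' * d"
      by (simp add: B_def mAD cA algebra_simps)
    also have "1 + b * c = a * d" using det by simp
    also have "x * D * (a * d) - y * c' * d = ((D * a) * x - y * c') * d" by (simp add: algebra_simps)
    finally show ?thesis by (simp add: xy)
  qed
  have B2: "D * (a * B + y) = int m * b"
  proof -
    have "D * (a * B + y) = int m * b * (D * a * x) - D * y * (a * d - 1)"
      by (simp add: B_def algebra_simps)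
    also have "a * d - 1 = b * c" using det by simp
    also have "int m * b * (D * a * x) - D * y * (b * c) = int m * b * ((D * a) * x - y * c')"
      by (simp add: mAD cA algebra_simps)
    finally show ?thesis by (simp add: xy)
  qed
  have "norm (dedekind_eta (of_nat m * mob a b c d \<tau>)) =
    norm (dedekind_eta ((of_int A * \<tau> + of_int B) / of_int D)) * sqrt (of_int A / real m)
      * (Im \<tau> / Im (mob a b c d \<tau>)) powr (1 / 4)" if \<tau>: "Im \<tau> > 0" for \<tau>
  proof -
    define z where "z = (of_int A * \<tau> + of_int B) / of_int D"
    have Imz: "Im z = of_int A * Im \<tau> / of_int D" by (simp add: z_def)
    have z: "Im z > 0" unfolding Imz using A D \<tau> by simp
    have D0: "of_int D \<noteq> (0::complex)" using D by simp
    have Dz: "of_int D * z = of_int A * \<tau> + of_int B" using D0 by (simp add: z_def)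
    have "of_int D * (of_int (D * a) * z + of_int y) = of_int (D * A) * (of_int a * \<tau>) + of_int (D * (a * B + y))"
    proof -
      have "of_int D * (of_int (D * a) * z + of_int y) = of_int (D * a) * (of_int D * z) + of_int (D * y)"
        by (simp add: algebra_simps)
      thus ?thesis unfolding Dz by (simp add: algebra_simps)
    qed
    also have "\<dots> = of_nat m * (of_int a * \<tau> + of_int b)"
      unfolding B2 mult.commute[of D A] mAD[symmetric] by (simp add: algebra_simps)
    finally have num: "of_int D * (of_int (D * a) * z + of_int y) = of_nat m * (of_int a * \<tau> + of_int b)" .
    have "of_int D * (of_int c' * z + of_int x) = of_int (A * c') * \<tau> + of_int (c' * B + x * D)"
    proof -
      have "of_int D * (of_int c' * z + of_int x) = of_int c' * (of_int D * z) + of_int (x * D)"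
        by (simp add: algebra_simps)
      thus ?thesis unfolding Dz by (simp add: algebra_simps)
    qed
    also have "\<dots> = of_int c * \<tau> + of_int d" unfolding B1 cA ..
    finally have den: "of_int D * (of_int c' * z + of_int x) = of_int c * \<tau> + of_int d" .
    have "mob (D * a) y c' x z = (of_int D * (of_int (D * a) * z + of_int y)) / (of_int D * (of_int c' * z + of_int x))"
      unfolding mob_def using D0 by simp
    also have "\<dots> = of_nat m * mob a b c d \<tau>" unfolding num den by (simp add: mob_def)
    finally have mz: "mob (D * a) y c' x z = of_nat m * mob a b c d \<tau>" .
    define e1 where "e1 = norm (dedekind_eta (of_nat m * mob a b c d \<tau>))"
    define e2 where "e2 = norm (dedekind_eta z)"
    define I' where "I' = Im (mob a b c d \<tau>)"
    have I': "I' > 0" unfolding I'_def by (rule Im_mob_pos[OF \<tau> det])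
    have mR: "real m = of_int A * of_int D" using mAD by (metis of_int_mult of_int_of_nat_eq)
    have "e1 ^ 4 * (real m * I') = e2 ^ 4 * (of_int A * Im \<tau> / of_int D)"
      using norm_dedekind_eta_modular[OF z xy] unfolding mz Imz by (simp add: e1_def e2_def I'_def)
    hence "e1 ^ 4 = e2 ^ 4 * (1 / of_int D)\<^sup>2 * (Im \<tau> / I')"
      unfolding mR using A D I' by (simp add: field_simps power2_eq_square)
    also have "\<dots> = (e2 * sqrt (of_int A / real m) * (Im \<tau> / I') powr (1 / 4)) ^ 4"
    proof -
      have "of_int A / real m = 1 / of_int D" unfolding mR using A by simp
      moreover have "sqrt (1 / of_int D) ^ 4 = (1 / of_int D)\<^sup>2"
        using D by (simp add: power4_eq_xxxx power2_eq_square)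
      moreover have "((Im \<tau> / I') powr (1 / 4)) ^ 4 = Im \<tau> / I'"
        using \<tau> I' by (simp add: powr_power)
      ultimately show ?thesis by (simp add: power_mult_distrib)
    qed
    finally have "e1 = e2 * sqrt (of_int A / real m) * (Im \<tau> / I') powr (1 / 4)"
      by (rule power_eq_imp_eq_base) (use A in \<open>auto simp: e1_def e2_def\<close>)
    thus ?thesis by (simp add: e1_def e2_def z_def I'_def)
  qed
  thus ?thesis unfolding D_def by blast
qed

text \<open>For \<open>Im z \<ge> y\<close> the nome stays in a compact disc of radius less than 1,
  on which the Euler product is continuous without zeros. Two-sided bounds serve exponents of both
  signs.\<close>

lemma dedekind_eta_bounds:
  assumes "y > 0"
  obtains c C where "c > 0" "C > 0"
    "\<And>z. Im z \<ge> y \<Longrightarrow> c * exp (- (2 * pi * (Im z / 24))) \<le> norm (dedekind_eta z)"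
    "\<And>z. Im z \<ge> y \<Longrightarrow> norm (dedekind_eta z) \<le> C * exp (- (2 * pi * (Im z / 24)))"
proof -
  define r where "r = exp (- (2 * pi * y))"
  have r: "r < 1" "r > 0" using assms by (auto simp: r_def)
  have sub: "cball (0::complex) r \<subseteq> ball 0 1" using r by auto
  have cont: "continuous_on (cball 0 r) (\<lambda>q. norm (euler_prod q))"
    by (intro continuous_intros holomorphic_on_imp_continuous_on holomorphic_on_subset[OF holomorphic_euler_prod sub])
  have ne: "cball (0::complex) r \<noteq> {}" using r by simp
  obtain q1 where q1: "q1 \<in> cball 0 r" "\<And>q. q \<in> cball 0 r \<Longrightarrow> norm (euler_prod q1) \<le> norm (euler_prod q)"
    using continuous_attains_inf[OF compact_cball ne cont] by blast
  obtain q2 where q2: "q2 \<in> cball 0 r" "\<And>q. q \<in> cball 0 r \<Longrightarrow> norm (euler_prod q) \<le> norm (euler_prod q2)"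
    using continuous_attains_sup[OF compact_cball ne cont] by blast
  have pos: "norm (euler_prod q1) > 0" "norm (euler_prod q2) > 0"
    using euler_prod_nonzero q1(1) q2(1) sub by auto
  have n: "norm (dedekind_eta z) = norm (euler_prod (nome z)) * exp (- (2 * pi * (Im z / 24)))" for z
    by (simp add: dedekind_eta_conv_euler_prod norm_mult norm_exp_eq_Re)
  have nz: "nome z \<in> cball 0 r" if "Im z \<ge> y" for z
    using that unfolding mem_cball dist_0_norm norm_nome r_def by simp
  show ?thesis
    by (rule that[OF pos]) (use q1(2)[OF nz] q2(2)[OF nz] in \<open>auto simp: n intro!: mult_right_mono\<close>)
qed

section \<open>Eta quotients at the cusps\<close>

definition etaq :: "(nat \<times> int) list \<Rightarrow> complex \<Rightarrow> complex" where
  "etaq rs \<tau> = (\<Prod>(m, r)\<leftarrow>rs. dedekind_eta (of_nat m * \<tau>) powi r)"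

lemma etaq_nonzero:
  assumes "Im \<tau> > 0" "\<forall>(m, r)\<in>set rs. m > 0"
  shows "etaq rs \<tau> \<noteq> 0"
  using assms(2) unfolding etaq_def
  by (induction rs) (use assms(1) in \<open>auto simp: dedekind_eta_nonzero\<close>)

lemma holomorphic_etaq:
  assumes "\<forall>(m, r)\<in>set rs. m > 0"
  shows "etaq rs holomorphic_on {\<tau>. Im \<tau> > 0}"
  using assms unfolding etaq_def[abs_def]
  by (induction rs) (auto intro!: holomorphic_intros simp: dedekind_eta_nonzero)

lemma prod_list_power_int_mult:
  fixes x :: "nat \<Rightarrow> real"
  assumes "\<rho> \<noteq> 0"
  shows "(\<Prod>(m, r)\<leftarrow>rs. (x m * \<rho>) powi r) = (\<Prod>(m, r)\<leftarrow>rs. x m powi r) * \<rho> powi (\<Sum>(m, r)\<leftarrow>rs. r)"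
  using assms by (induction rs) (auto simp: power_int_mult_distrib power_int_add)

lemma norm_prod_list: "norm (prod_list xs) = prod_list (map norm (xs :: complex list))"
  by (induction xs) (auto simp: norm_mult)

text \<open>Weight 0 cancels the common power of the ratio of the imaginary parts. The translations
  \<open>B\<close> depend on \<open>m\<close> and the matrix, but not on \<tau>.\<close>

lemma norm_etaq_mob:
  assumes m: "\<forall>(m, r)\<in>set rs. m > 0" and weight: "(\<Sum>(m, r)\<leftarrow>rs. r) = 0" and det: "a * d - b * c = 1"
  obtains B :: "nat \<Rightarrow> int" where "\<And>\<tau>. Im \<tau> > 0 \<Longrightarrow> norm (etaq rs (mob a b c d \<tau>)) =
     (\<Prod>(m, r)\<leftarrow>rs. (norm (dedekind_eta ((of_int (gcd (int m) c) * \<tau> + of_int (B m)) / of_int (int m div gcd (int m) c)))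
        * sqrt (of_int (gcd (int m) c) / real m)) powi r)"
proof -
  define Q where "Q m B \<longleftrightarrow> (\<forall>\<tau>. Im \<tau> > 0 \<longrightarrow> norm (dedekind_eta (of_nat m * mob a b c d \<tau>)) =
    norm (dedekind_eta ((of_int (gcd (int m) c) * \<tau> + of_int B) / of_int (int m div gcd (int m) c)))
      * sqrt (of_int (gcd (int m) c) / real m) * (Im \<tau> / Im (mob a b c d \<tau>)) powr (1 / 4))" for m B
  have "\<exists>B. m > 0 \<longrightarrow> Q m B" for m
    using norm_dedekind_eta_mult_mob[OF _ det, of m] unfolding Q_def by blast
  then obtain B where "\<And>m. m > 0 \<longrightarrow> Q m (B m)" by metis
  hence B: "norm (dedekind_eta (of_nat m * mob a b c d \<tau>)) =
    norm (dedekind_eta ((of_int (gcd (int m) c) * \<tau> + of_int (B m)) / of_int (int m div gcd (int m) c)))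
      * sqrt (of_int (gcd (int m) c) / real m) * (Im \<tau> / Im (mob a b c d \<tau>)) powr (1 / 4)"
    if "m > 0" "Im \<tau> > 0" for m \<tau>
    using that unfolding Q_def by blast
  show ?thesis
  proof (rule that[of B])
    fix \<tau> :: complex assume \<tau>: "Im \<tau> > 0"
    define \<rho> where "\<rho> = (Im \<tau> / Im (mob a b c d \<tau>)) powr (1 / 4)"
    have \<rho>: "\<rho> \<noteq> 0" using \<tau> Im_mob_pos[OF \<tau> det] by (simp add: \<rho>_def)
    define X where "X m = norm (dedekind_eta ((of_int (gcd (int m) c) * \<tau> + of_int (B m)) / of_int (int m div gcd (int m) c)))
        * sqrt (of_int (gcd (int m) c) / real m)" for m
    have "norm (etaq rs (mob a b c d \<tau>)) = (\<Prod>(m, r)\<leftarrow>rs. norm (dedekind_eta (of_nat m * mob a b c d \<tau>)) powi r)"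
      unfolding etaq_def norm_prod_list by (simp add: o_def case_prod_unfold norm_power_int)
    also have "\<dots> = (\<Prod>(m, r)\<leftarrow>rs. (X m * \<rho>) powi r)"
      by (intro arg_cong[where f = prod_list] map_cong refl) (use m B[OF _ \<tau>] in \<open>auto simp: X_def \<rho>_def\<close>)
    also have "\<dots> = (\<Prod>(m, r)\<leftarrow>rs. X m powi r)"
      unfolding prod_list_power_int_mult[OF \<rho>] weight by simp
    finally show "norm (etaq rs (mob a b c d \<tau>)) =
       (\<Prod>(m, r)\<leftarrow>rs. (norm (dedekind_eta ((of_int (gcd (int m) c) * \<tau> + of_int (B m)) / of_int (int m div gcd (int m) c)))
        * sqrt (of_int (gcd (int m) c) / real m)) powi r)" unfolding X_def .
  qed
qed

text \<open>The order of vanishing of the eta quotient along \<open>\<gamma>\<close> in powers of the nome.\<close>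

definition etaq_order :: "(nat \<times> int) list \<Rightarrow> int \<Rightarrow> real" where
  "etaq_order rs c = (\<Sum>(m, r)\<leftarrow>rs. of_int r * (of_int (gcd (int m) c))\<^sup>2 / (24 * real m))"

lemma growth_prod_list:
  fixes X :: "'b \<Rightarrow> complex \<Rightarrow> real"
  assumes "\<And>x. x \<in> set xs \<Longrightarrow> \<exists>C. \<forall>\<tau>. Im \<tau> \<ge> 1 \<longrightarrow> X x \<tau> \<ge> 0 \<and> X x \<tau> \<le> C * exp (2 * pi * w x * Im \<tau>)"
  shows "\<exists>C. \<forall>\<tau>. Im \<tau> \<ge> 1 \<longrightarrow> (\<Prod>x\<leftarrow>xs. X x \<tau>) \<ge> 0 \<and> (\<Prod>x\<leftarrow>xs. X x \<tau>) \<le> C * exp (2 * pi * (\<Sum>x\<leftarrow>xs. w x) * Im \<tau>)"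
  using assms
proof (induction xs)
  case (Cons x xs)
  obtain C where C: "\<And>\<tau>. Im \<tau> \<ge> 1 \<Longrightarrow> X x \<tau> \<ge> 0 \<and> X x \<tau> \<le> C * exp (2 * pi * w x * Im \<tau>)"
    using Cons.prems[of x] by auto
  obtain D where D: "\<And>\<tau>. Im \<tau> \<ge> 1 \<Longrightarrow> (\<Prod>x\<leftarrow>xs. X x \<tau>) \<ge> 0 \<and> (\<Prod>x\<leftarrow>xs. X x \<tau>) \<le> D * exp (2 * pi * (\<Sum>x\<leftarrow>xs. w x) * Im \<tau>)"
    using Cons by (metis list.set_intros(2))
  show ?case
  proof (intro exI[of _ "C * D"] allI impI conjI)
    fix \<tau> :: complex assume \<tau>: "Im \<tau> \<ge> 1"
    show "(\<Prod>x\<leftarrow>x # xs. X x \<tau>) \<ge> 0" using C[OF \<tau>] D[OF \<tau>] by simp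
    have "X x \<tau> * (\<Prod>x\<leftarrow>xs. X x \<tau>) \<le> (C * exp (2 * pi * w x * Im \<tau>)) * (D * exp (2 * pi * (\<Sum>x\<leftarrow>xs. w x) * Im \<tau>))"
      using C[OF \<tau>] D[OF \<tau>] by (intro mult_mono) auto
    also have "\<dots> = C * D * exp (2 * pi * (\<Sum>x\<leftarrow>x # xs. w x) * Im \<tau>)" by (simp add: exp_add ring_distribs)
    finally show "(\<Prod>x\<leftarrow>x # xs. X x \<tau>) \<le> C * D * exp (2 * pi * (\<Sum>x\<leftarrow>x # xs. w x) * Im \<tau>)" by simp
  qed
qed (auto intro!: exI[of _ 1])

text \<open>A nonnegative power is bounded by means of the upper bound for \<open>x\<close>, a
  negative one by means of the lower bound.\<close>

lemma power_int_le_exp: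
  assumes "c > 0" "C > 0"
  shows "\<exists>K. \<forall>x s. c * exp s \<le> x \<and> x \<le> C * exp s \<longrightarrow> x powi r \<ge> 0 \<and> x powi r \<le> K * exp (of_int r * s :: real)"
proof (cases "r \<ge> 0")
  case True
  show ?thesis
  proof (intro exI[of _ "C powi r"] allI impI)
    fix x s assume x: "c * exp s \<le> x \<and> x \<le> C * exp s"
    have "x > 0" using x assms by (metis exp_gt_zero less_le_trans mult_pos_pos)
    moreover have "x powi r \<le> (C * exp s) powi r"
      using x \<open>x > 0\<close> True by (intro power_int_mono) auto
    ultimately show "x powi r \<ge> 0 \<and> x powi r \<le> C powi r * exp (of_int r * s)"
      using assms by (simp add: power_int_mult_distrib exp_power_int)
  qed
next
  case False
  show ?thesis
  proof (intro exI[of _ "c powi r"] allI impI)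
    fix x s assume x: "c * exp s \<le> x \<and> x \<le> C * exp s"
    have "x > 0" using x assms by (metis exp_gt_zero less_le_trans mult_pos_pos)
    moreover have "x powi r \<le> (c * exp s) powi r"
      using x \<open>x > 0\<close> False assms by (intro power_int_antimono) auto
    ultimately show "x powi r \<ge> 0 \<and> x powi r \<le> c powi r * exp (of_int r * s)"
      using assms by (simp add: power_int_mult_distrib exp_power_int)
  qed
qed

text \<open>Up to constants, \<open>|eta z|\<close> is \<open>exp (-2 pi Im z/24)\<close>, and the
  triangular matrix multiplies \<open>Im\<close> by \<open>A/D = A^2/m\<close> with
  \<open>A = gcd m c\<close>. This is the usual formula for the order of an eta quotient at a
  cusp.\<close>

lemma growth_etaq:
  assumes m: "\<forall>(m, r)\<in>set rs. m > 0" and weight: "(\<Sum>(m, r)\<leftarrow>rs. r) = 0" and det: "a * d - b * c = 1"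
  shows "growth (\<lambda>\<tau>. etaq rs (mob a b c d \<tau>)) (- etaq_order rs c)"
proof -
  obtain B where B: "\<And>\<tau>. Im \<tau> > 0 \<Longrightarrow> norm (etaq rs (mob a b c d \<tau>)) =
     (\<Prod>(m, r)\<leftarrow>rs. (norm (dedekind_eta ((of_int (gcd (int m) c) * \<tau> + of_int (B m)) / of_int (int m div gcd (int m) c)))
        * sqrt (of_int (gcd (int m) c) / real m)) powi r)"
    using norm_etaq_mob[OF assms] by blast
  define X where "X = (\<lambda>(m, r) \<tau>. (norm (dedekind_eta ((of_int (gcd (int m) c) * \<tau> + of_int (B m)) / of_int (int m div gcd (int m) c)))
        * sqrt (of_int (gcd (int m) c) / real m)) powi r)"
  define w where "w = (\<lambda>(m, r). - (of_int r * (of_int (gcd (int m) c))\<^sup>2 / (24 * real m)))"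
  have "\<exists>C. \<forall>\<tau>. Im \<tau> \<ge> 1 \<longrightarrow> X x \<tau> \<ge> 0 \<and> X x \<tau> \<le> C * exp (2 * pi * w x * Im \<tau>)" if x: "x \<in> set rs" for x
  proof -
    obtain m r where mr: "x = (m, r)" by (cases x)
    have m0: "m > 0" using m x mr by auto
    define A where "A = gcd (int m) c"
    define D where "D = int m div A"
    have A: "A > 0" using m0 by (auto simp: A_def)
    have AD: "int m = A * D" by (simp add: D_def A_def)
    have D: "D > 0" using AD A m0 by (metis of_nat_0_less_iff zero_less_mult_pos)
    have mR: "real m = of_int A * of_int D" using AD by (metis of_int_mult of_int_of_nat_eq)
    define \<kappa> where "\<kappa> = sqrt (of_int A / real m)"
    have \<kappa>: "\<kappa> > 0" using A m0 by (simp add: \<kappa>_def)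
    define y :: real where "y = of_int A / of_int D"
    have y: "y > 0" using A D by (simp add: y_def)
    obtain e1 e2 where e: "e1 > 0" "e2 > 0"
      "\<And>z. Im z \<ge> y \<Longrightarrow> e1 * exp (- (2 * pi * (Im z / 24))) \<le> norm (dedekind_eta z)"
      "\<And>z. Im z \<ge> y \<Longrightarrow> norm (dedekind_eta z) \<le> e2 * exp (- (2 * pi * (Im z / 24)))"
      using dedekind_eta_bounds[OF y] by metis
    obtain K where K: "\<forall>x s. e1 * \<kappa> * exp s \<le> x \<and> x \<le> e2 * \<kappa> * exp s \<longrightarrow> x powi r \<ge> 0 \<and> x powi r \<le> K * exp (of_int r * s)"
      using power_int_le_exp[OF mult_pos_pos[OF e(1) \<kappa>] mult_pos_pos[OF e(2) \<kappa>], of r] by blast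
    show ?thesis
    proof (intro exI[of _ K] allI impI)
      fix \<tau> :: complex assume \<tau>: "Im \<tau> \<ge> 1"
      define z where "z = (of_int A * \<tau> + of_int (B m)) / of_int D"
      have Imz: "Im z = y * Im \<tau>" by (simp add: z_def y_def)
      have yz: "Im z \<ge> y" unfolding Imz using y \<tau> by simp
      have "X x \<tau> = (norm (dedekind_eta z) * \<kappa>) powi r"
        by (simp add: X_def mr z_def A_def D_def \<kappa>_def)
      moreover have "2 * pi * w x * Im \<tau> = of_int r * (- (2 * pi * (Im z / 24)))"
        unfolding Imz y_def w_def mr prod.case A_def[symmetric] mR using A D by (simp add: field_simps power2_eq_square)
      ultimately show "X x \<tau> \<ge> 0 \<and> X x \<tau> \<le> K * exp (2 * pi * w x * Im \<tau>)"
        using K[rule_format, of "- (2 * pi * (Im z / 24))" "norm (dedekind_eta z) * \<kappa>"]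
          mult_right_mono[OF e(3)[OF yz], of \<kappa>] mult_right_mono[OF e(4)[OF yz], of \<kappa>] \<kappa>
        by (simp add: mult_ac)
    qed
  qed
  from growth_prod_list[of rs X w, OF this] obtain C where
    C: "\<And>\<tau>. Im \<tau> \<ge> 1 \<Longrightarrow> (\<Prod>x\<leftarrow>rs. X x \<tau>) \<le> C * exp (2 * pi * (\<Sum>x\<leftarrow>rs. w x) * Im \<tau>)" by blast
  have "(\<Sum>x\<leftarrow>rs. w x) = - etaq_order rs c"
    unfolding etaq_order_def w_def by (induction rs) auto
  with C show ?thesis
    by (intro growthI[where C = C]) (simp add: B X_def case_prod_unfold)
qed

text \<open>If \<open>m\<close> divides \<open>c\<close>, then \<open>A = m\<close> and
  \<open>D = 1\<close>: the triangular matrix is multiplication by \<open>m\<close> and an integral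
  translation, which absolute values do not see.\<close>

lemma norm_etaq_Gamma0:
  assumes m: "\<forall>(m, r)\<in>set rs. m > 0 \<and> int m dvd c" and weight: "(\<Sum>(m, r)\<leftarrow>rs. r) = 0"
    and det: "a * d - b * c = 1" and \<tau>: "Im \<tau> > 0"
  shows "norm (etaq rs (mob a b c d \<tau>)) = norm (etaq rs \<tau>)"
proof -
  have m': "\<forall>(m, r)\<in>set rs. m > 0" using m by auto
  obtain B where B: "\<And>\<tau>. Im \<tau> > 0 \<Longrightarrow> norm (etaq rs (mob a b c d \<tau>)) =
     (\<Prod>(m, r)\<leftarrow>rs. (norm (dedekind_eta ((of_int (gcd (int m) c) * \<tau> + of_int (B m)) / of_int (int m div gcd (int m) c)))
        * sqrt (of_int (gcd (int m) c) / real m)) powi r)"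
    using norm_etaq_mob[OF m' weight det] by blast
  have "norm (etaq rs (mob a b c d \<tau>)) = (\<Prod>(m, r)\<leftarrow>rs. norm (dedekind_eta (of_nat m * \<tau>)) powi r)"
    unfolding B[OF \<tau>]
  proof (intro arg_cong[where f = prod_list] map_cong refl, safe)
    fix n r assume "(n, r) \<in> set rs"
    hence n: "n > 0" "int n dvd c" using m by auto
    have g: "gcd (int n) c = int n" using n by (simp add: gcd_nat.absorb1 gcd_proj1_if_dvd)
    have "norm (dedekind_eta (of_nat n * \<tau> + of_int (B n))) = norm (dedekind_eta (of_nat n * \<tau>))"
      using n \<tau> by (intro shift_invariant_int[where f = "\<lambda>\<tau>. norm (dedekind_eta \<tau>)"])
                   (auto simp: dedekind_eta_plus_1 norm_mult)
    thus "(norm (dedekind_eta ((of_int (gcd (int n) c) * \<tau> + of_int (B n)) / of_int (int n div gcd (int n) c)))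
        * sqrt (of_int (gcd (int n) c) / real n)) powi r = norm (dedekind_eta (of_nat n * \<tau>)) powi r"
      unfolding g using n by simp
  qed
  thus ?thesis unfolding etaq_def norm_prod_list by (simp add: o_def case_prod_unfold norm_power_int)
qed

text \<open>A holomorphic function of modulus 1 on the half plane is constant by the maximum modulus
  principle. So \<zeta> depends on the matrix only.\<close>

lemma etaq_Gamma0:
  assumes m: "\<forall>(m, r)\<in>set rs. m > 0 \<and> int m dvd c" and weight: "(\<Sum>(m, r)\<leftarrow>rs. r) = 0"
    and det: "a * d - b * c = 1"
  shows "\<exists>\<zeta>. \<forall>\<tau>. Im \<tau> > 0 \<longrightarrow> etaq rs (mob a b c d \<tau>) = \<zeta> * etaq rs \<tau>"
proof -
  define H where "H = {\<tau>. Im \<tau> > 0}"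
  have oH: "open H" and cH: "connected H"
    using open_upper_half_plane convex_upper_half_plane by (auto simp: H_def convex_connected)
  have m': "\<forall>(m, r)\<in>set rs. m > 0" using m by auto
  have hol: "etaq rs holomorphic_on H" unfolding H_def by (rule holomorphic_etaq[OF m'])
  have "mob a b c d holomorphic_on H"
    unfolding mob_def[abs_def] using mob_denominator_nonzero[OF _ det]
    by (intro holomorphic_intros) (auto simp: H_def)
  hence "(etaq rs \<circ> mob a b c d) holomorphic_on H"
    by (rule holomorphic_on_compose_gen[OF _ hol]) (use Im_mob_pos[OF _ det] in \<open>auto simp: H_def\<close>)
  hence hol': "(\<lambda>\<tau>. etaq rs (mob a b c d \<tau>) / etaq rs \<tau>) holomorphic_on H"
    using hol etaq_nonzero[OF _ m'] by (intro holomorphic_intros) (auto simp: H_def o_def)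
  have n1: "norm (etaq rs (mob a b c d \<tau>) / etaq rs \<tau>) = 1" if "\<tau> \<in> H" for \<tau>
    using norm_etaq_Gamma0[OF m weight det] etaq_nonzero[OF _ m'] that by (simp add: H_def norm_divide)
  have iH: "\<i> \<in> H" by (simp add: H_def)
  have "(\<lambda>\<tau>. etaq rs (mob a b c d \<tau>) / etaq rs \<tau>) constant_on H"
    by (rule maximum_modulus_principle[OF hol' oH cH oH order_refl iH]) (simp only: n1 iH order_refl)
  then obtain \<zeta> where \<zeta>: "\<And>\<tau>. \<tau> \<in> H \<Longrightarrow> etaq rs (mob a b c d \<tau>) / etaq rs \<tau> = \<zeta>"
    unfolding constant_on_def by blast
  show ?thesis
    using \<zeta> etaq_nonzero[OF _ m'] by (intro exI[of _ \<zeta>]) (auto simp: H_def field_simps)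
qed

definition epq :: "(nat \<times> int) list \<Rightarrow> complex \<Rightarrow> complex" where
  "epq rs q = (\<Prod>(m, r)\<leftarrow>rs. euler_prod (q ^ m) powi r)"

text \<open>The 24th roots of the nome combine to its first power: the quotient is single-valued in
  the nome, with a simple zero at the cusp.\<close>

lemma etaq_conv_epq:
  assumes "(\<Sum>(m, r)\<leftarrow>rs. int m * r) = 24"
  shows "etaq rs \<tau> = nome \<tau> * epq rs (nome \<tau>)"
proof -
  have *: "etaq rs \<tau> = exp (2 * of_real pi * \<i> * \<tau> / 24) powi (\<Sum>(m, r)\<leftarrow>rs. int m * r) * epq rs (nome \<tau>)" for rs
  proof (induction rs)
    case (Cons x rs)
    obtain m r where x: "x = (m, r)" by (cases x)
    have "dedekind_eta (of_nat m * \<tau>) = exp (2 * of_real pi * \<i> * \<tau> / 24) ^ m * euler_prod (nome \<tau> ^ m)"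
      unfolding dedekind_eta_conv_euler_prod nome_power by (simp add: exp_of_nat_mult[symmetric] mult_ac)
    hence "dedekind_eta (of_nat m * \<tau>) powi r =
        exp (2 * of_real pi * \<i> * \<tau> / 24) powi (int m * r) * euler_prod (nome \<tau> ^ m) powi r"
      by (simp add: power_int_mult_distrib power_int_mult)
    thus ?case using Cons by (simp add: x etaq_def epq_def power_int_add mult_ac)
  qed (simp add: etaq_def epq_def)
  have "exp (2 * of_real pi * \<i> * \<tau> / 24) powi 24 = exp (of_nat 24 * (2 * of_real pi * \<i> * \<tau> / 24))"
    unfolding exp_of_nat_mult by simp
  also have "of_nat 24 * (2 * of_real pi * \<i> * \<tau> / 24) = 2 * of_real pi * \<i> * \<tau>" by simp
  finally show ?thesis unfolding *[of rs] assms by simp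
qed

section \<open>The Hauptmoduln as eta quotients\<close>

text \<open>The final branch stands for level 25, as in \<open>kappa\<close>.\<close>

definition eta_exps :: "nat \<Rightarrow> (nat \<times> int) list" where
  "eta_exps N =
     (if N = 2 then [(2, 24), (1, -24)]
      else if N = 3 then [(3, 12), (1, -12)]
      else if N = 4 then [(4, 8), (1, -8)]
      else if N = 5 then [(5, 6), (1, -6)]
      else if N = 6 then [(2, 1), (6, 5), (1, -5), (3, -1)]
      else if N = 7 then [(7, 4), (1, -4)]
      else if N = 8 then [(2, 2), (8, 4), (1, -4), (4, -2)]
      else if N = 9 then [(9, 3), (1, -3)]
      else if N = 10 then [(2, 1), (10, 3), (1, -3), (5, -1)]
      else if N = 12 then [(2, 2), (3, 1), (12, 3), (1, -3), (4, -1), (6, -2)]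
      else if N = 13 then [(13, 2), (1, -2)]
      else if N = 16 then [(2, 1), (16, 2), (1, -2), (8, -1)]
      else if N = 18 then [(2, 1), (3, 1), (18, 2), (1, -2), (6, -1), (9, -1)]
      else [(25, 1), (1, -1)])"

definition kappa :: "nat \<Rightarrow> int" where
  "kappa N =
     (if N = 2 then 4096 else if N = 3 then 729 else if N = 4 then 256 else if N = 5 then 125
      else if N = 6 then 72 else if N = 7 then 49 else if N = 8 then 32 else if N = 9 then 27
      else if N = 10 then 20 else if N = 12 then 12 else if N = 13 then 13 else if N = 16 then 8
      else if N = 18 then 6 else 5)"

lemma hauptmodul_conv_etaq:
  assumes "N \<in> levels"
  shows "hauptmodul N \<tau> = of_int (kappa N) * etaq (eta_exps N) \<tau>"
  using assms unfolding levels_def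
  by (elim insertE)
     (simp_all add: hauptmodul_def Let_def kappa_def eta_exps_def etaq_def power_int_minus divide_inverse)

text \<open>Divisors of the level give invariance up to a constant, exponent sum 0 means weight 0,
  and the weighted sum 24 means a simple zero at \<i>\<infinity>.\<close>

lemma eta_exps_props:
  assumes "N \<in> levels"
  shows "\<forall>(m, r)\<in>set (eta_exps N). m > 0 \<and> m dvd N" "(\<Sum>(m, r)\<leftarrow>eta_exps N. r) = 0"
    "(\<Sum>(m, r)\<leftarrow>eta_exps N. int m * r) = 24" "kappa N \<noteq> 0" "N > 1"
  using assms unfolding levels_def
  by (elim insertE; simp add: eta_exps_def kappa_def)+

lemma eta_exps_pos: "N \<in> levels \<Longrightarrow> \<forall>(m, r)\<in>set (eta_exps N). m > 0"
  using eta_exps_props(1) by fast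

lemma holomorphic_hauptmodul:
  assumes "N \<in> levels"
  shows "hauptmodul N holomorphic_on {\<tau>. Im \<tau> > 0}"
proof -
  have "(\<lambda>\<tau>. of_int (kappa N) * etaq (eta_exps N) \<tau>) holomorphic_on {\<tau>. Im \<tau> > 0}"
    by (intro holomorphic_intros holomorphic_etaq eta_exps_pos assms)
  thus ?thesis by (rule holomorphic_transform) (simp add: hauptmodul_conv_etaq[OF assms])
qed

lemma hauptmodul_nonzero: "N \<in> levels \<Longrightarrow> Im \<tau> > 0 \<Longrightarrow> hauptmodul N \<tau> \<noteq> 0"
  using eta_exps_props(4) etaq_nonzero eta_exps_pos by (simp add: hauptmodul_conv_etaq)

text \<open>The same function on the unit disc, including the point 0 that represents the
  cusp.\<close>

definition hauptmodul_q :: "nat \<Rightarrow> complex \<Rightarrow> complex" where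
  "hauptmodul_q N q = of_int (kappa N) * (q * epq (eta_exps N) q)"

lemma hauptmodul_conv_q: "N \<in> levels \<Longrightarrow> hauptmodul N \<tau> = hauptmodul_q N (nome \<tau>)"
  using etaq_conv_epq[OF eta_exps_props(3)] by (simp add: hauptmodul_conv_etaq hauptmodul_q_def)

lemma norm_power_less_1: "norm (q :: complex) < 1 \<Longrightarrow> m > 0 \<Longrightarrow> norm (q ^ m) < 1"
  by (simp add: norm_power power_less_one_iff)

lemma holomorphic_epq:
  assumes "\<forall>(m, r)\<in>set rs. m > 0"
  shows "epq rs holomorphic_on ball 0 1"
proof -
  have e: "(\<lambda>q. euler_prod (q ^ m)) holomorphic_on ball 0 1" if "m > 0" for m
  proof -
    have "(euler_prod \<circ> (\<lambda>q. q ^ m)) holomorphic_on ball 0 1"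
      by (rule holomorphic_on_compose_gen[OF _ holomorphic_euler_prod])
         (use that norm_power_less_1 in \<open>auto intro!: holomorphic_intros\<close>)
    thus ?thesis by (simp add: o_def)
  qed
  have nz: "euler_prod (q ^ m) \<noteq> 0" if "norm q < 1" "m > 0" for q m
    using that by (intro euler_prod_nonzero norm_power_less_1)
  show ?thesis
    using assms unfolding epq_def[abs_def]
    by (induction rs) (use e nz in \<open>auto intro!: holomorphic_intros\<close>)
qed

lemma holomorphic_hauptmodul_q:
  "N \<in> levels \<Longrightarrow> hauptmodul_q N holomorphic_on ball 0 1"
  unfolding hauptmodul_q_def[abs_def] by (intro holomorphic_intros holomorphic_epq eta_exps_pos)

lemma euler_prod_0: "euler_prod 0 = 1"
  by (simp add: euler_prod_def)

lemma epq_0: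
  assumes "\<forall>(m, r)\<in>set rs. m > 0"
  shows "epq rs 0 = 1"
  using assms unfolding epq_def by (induction rs) (auto simp: euler_prod_0 zero_power)

section \<open>The modular invariant\<close>

definition sigma3 :: "nat \<Rightarrow> nat" where
  "sigma3 n = (\<Sum>d | d dvd n. d ^ 3)"

definition e4_coeff :: "nat \<Rightarrow> int" where
  "e4_coeff n = (if n = 0 then 1 else 240 * int (sigma3 n))"

lemma sigma3_le: "sigma3 (Suc n) \<le> Suc n ^ 4"
proof -
  have "{d. d dvd Suc n} \<subseteq> {1..Suc n}"
  proof
    fix d assume "d \<in> {d. d dvd Suc n}"
    hence d: "d dvd Suc n" by simp
    have "d \<noteq> 0" using d by (intro notI) simp
    moreover have "d \<le> Suc n" using d by (rule dvd_imp_le) simp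
    ultimately show "d \<in> {1..Suc n}" by simp
  qed
  hence "sigma3 (Suc n) \<le> (\<Sum>d\<in>{1..Suc n}. d ^ 3)"
    unfolding sigma3_def by (intro sum_mono2) auto
  also have "\<dots> \<le> (\<Sum>d\<in>{1..Suc n}. Suc n ^ 3)" by (intro sum_mono power_mono) auto
  also have "\<dots> = Suc n ^ 4" by (simp add: eval_nat_numeral)
  finally show ?thesis .
qed

lemma summable_e4:
  fixes q :: complex
  assumes "norm q < 1"
  shows "summable (\<lambda>n. of_int (e4_coeff n) * q ^ n)"
proof -
  have "conv_radius (\<lambda>n. complex_of_nat (Suc n) ^ 4) = ereal 1"
  proof (rule conv_radius_ratio_limit_nonzero)
    have "(\<lambda>n. real (Suc n) ^ 4 / real (Suc (Suc n)) ^ 4) \<longlonglongrightarrow> 1" by real_asymp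
    thus "(\<lambda>n. norm (complex_of_nat (Suc n) ^ 4) / norm (complex_of_nat (Suc (Suc n)) ^ 4)) \<longlonglongrightarrow> 1"
      by (simp only: norm_power norm_of_nat)
  qed (simp_all del: of_nat_Suc)
  hence "summable (\<lambda>n. norm (complex_of_nat (Suc n) ^ 4 * q ^ n))"
    using assms by (intro abs_summable_in_conv_radius) simp
  hence "summable (\<lambda>n. 240 * norm q * norm (complex_of_nat (Suc n) ^ 4 * q ^ n))"
    by (rule summable_mult)
  hence "summable (\<lambda>n. 240 * (real (Suc n) ^ 4 * norm q ^ Suc n))"
    by (simp add: norm_mult norm_power mult_ac del: of_nat_Suc)
  hence "summable (\<lambda>n. of_int (e4_coeff (Suc n)) * q ^ Suc n)"
  proof (rule summable_comparison_test'[where N = 0])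
    fix n
    have "real (sigma3 (Suc n)) \<le> real (Suc n ^ 4)" using sigma3_le by (rule of_nat_mono)
    thus "norm (of_int (e4_coeff (Suc n)) * q ^ Suc n) \<le> 240 * (real (Suc n) ^ 4 * norm q ^ Suc n)"
      by (auto simp: e4_coeff_def norm_mult norm_power simp del: power_Suc of_nat_Suc intro!: mult_right_mono)
  qed
  thus ?thesis by (subst (asm) summable_Suc_iff)
qed

definition e4q :: "complex \<Rightarrow> complex" where
  "e4q q = (\<Sum>n. of_int (e4_coeff n) * q ^ n)"

lemma eisenstein_E4_conv_e4q:
  assumes "Im \<tau> > 0"
  shows "eisenstein_E4 \<tau> = e4q (nome \<tau>)"
proof -
  note sm = summable_e4[OF norm_nome_less_1[OF assms]]
  have "e4q (nome \<tau>) = 1 + (\<Sum>n. of_int (e4_coeff (Suc n)) * nome \<tau> ^ Suc n)"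
    unfolding e4q_def using suminf_split_head[OF sm] by (simp add: e4_coeff_def)
  also have "(\<Sum>n. of_int (e4_coeff (Suc n)) * nome \<tau> ^ Suc n)
      = (\<Sum>n. 240 * (of_nat (sigma3 (Suc n)) * nome \<tau> ^ Suc n))"
    by (simp add: e4_coeff_def mult_ac)
  also have "\<dots> = 240 * (\<Sum>n. of_nat (sigma3 (Suc n)) * nome \<tau> ^ Suc n)"
  proof (rule suminf_mult)
    have "summable (\<lambda>n. (1 / 240) * (of_int (e4_coeff (Suc n)) * nome \<tau> ^ Suc n))"
      using sm by (intro summable_mult) (subst summable_Suc_iff)
    thus "summable (\<lambda>n. of_nat (sigma3 (Suc n)) * nome \<tau> ^ Suc n)"
      by (simp add: e4_coeff_def mult_ac)
  qed
  finally show ?thesis by (simp add: eisenstein_E4_def sigma3_def)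
qed

lemma holomorphic_e4q: "e4q holomorphic_on ball 0 1"
  by (rule power_series_holomorphic[where a = "\<lambda>n. of_int (e4_coeff n)"])
     (use summable_e4 in \<open>auto simp: e4q_def intro!: summable_sums\<close>)

lemma e4q_0: "e4q 0 = 1"
  by (simp add: e4q_def powser_zero e4_coeff_def)

text \<open>This is \<open>q j\<close>, from which the simple pole at the cusp has been
  removed.\<close>

definition jq :: "complex \<Rightarrow> complex" where
  "jq q = e4q q ^ 3 / euler_prod q ^ 24"

lemma holomorphic_jq: "jq holomorphic_on ball 0 1"
  unfolding jq_def[abs_def] using euler_prod_nonzero
  by (intro holomorphic_intros holomorphic_e4q holomorphic_euler_prod) auto

lemma jq_0: "jq 0 = 1"
  by (simp add: jq_def e4q_0 euler_prod_0)

lemma elliptic_j_conv_jq: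
  assumes "Im \<tau> > 0"
  shows "elliptic_j \<tau> = jq (nome \<tau>) / nome \<tau>"
proof -
  have "exp (2 * of_real pi * \<i> * \<tau> / 24) ^ 24 = nome \<tau>"
    unfolding exp_of_nat_mult[symmetric] by (rule arg_cong[where f = exp]) simp
  thus ?thesis
    by (simp add: elliptic_j_def eisenstein_E4_conv_e4q[OF assms] dedekind_eta_conv_euler_prod
        jq_def power_mult_distrib)
qed

lemma holomorphic_on_nome:
  assumes "g holomorphic_on ball 0 1"
  shows "(\<lambda>\<tau>. g (nome \<tau>)) holomorphic_on {\<tau>. Im \<tau> > 0}"
proof -
  have "(g \<circ> nome) holomorphic_on {\<tau>. Im \<tau> > 0}"
    by (rule holomorphic_on_compose_gen[OF _ assms]) (auto intro!: holomorphic_intros norm_nome_less_1)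
  thus ?thesis by (simp add: o_def)
qed

lemma holomorphic_elliptic_j: "elliptic_j holomorphic_on {\<tau>. Im \<tau> > 0}"
proof -
  have "(\<lambda>\<tau>. jq (nome \<tau>) / nome \<tau>) holomorphic_on {\<tau>. Im \<tau> > 0}"
    by (intro holomorphic_intros holomorphic_on_nome holomorphic_jq) auto
  thus ?thesis by (rule holomorphic_transform) (simp add: elliptic_j_conv_jq)
qed

text \<open>The region \<open>Im \<tau> \<ge> 1\<close> lies in the disc
  \<open>|q| \<le> exp (-2 pi)\<close>. Near 0 the assumed bound applies; on the rest of the disc
  compactness bounds \<open>F\<close>, and \<open>|q|^K\<close> is at least
  \<open>r^K\<close>.\<close>

lemma growth_nome:
  assumes "continuous_on (ball 0 1) F" "r > 0" "\<And>q. norm q < r \<Longrightarrow> norm (F q) \<le> C * norm q ^ K"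
  shows "growth (\<lambda>\<tau>. F (nome \<tau>)) (- real K)"
proof -
  define s where "s = exp (- (2 * pi))"
  have s: "s < 1" by (simp add: s_def)
  have cont: "continuous_on (cball 0 s) (\<lambda>q. norm (F q))"
    by (intro continuous_intros continuous_on_subset[OF assms(1)]) (use s in auto)
  have ne: "cball (0::complex) s \<noteq> {}" by (simp add: s_def)
  obtain M where M: "\<And>q. q \<in> cball 0 s \<Longrightarrow> norm (F q) \<le> M"
    using continuous_attains_sup[OF compact_cball ne cont] by blast
  have M0: "M \<ge> 0" using M[of 0] norm_ge_zero[of "F 0"] by (auto simp: s_def simp del: norm_ge_zero)
  have b: "norm (F q) \<le> (max C 0 + M / r ^ K) * norm q ^ K" if "q \<in> cball 0 s" for q
  proof (cases "norm q < r")
    case True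
    have "C * norm q ^ K \<le> (max C 0 + M / r ^ K) * norm q ^ K"
      using M0 assms(2) by (intro mult_right_mono) (auto intro: add_increasing2)
    thus ?thesis using assms(3)[OF True] by linarith
  next
    case False
    have "M = (M / r ^ K) * r ^ K" using assms(2) by simp
    also have "\<dots> \<le> (max C 0 + M / r ^ K) * norm q ^ K"
      using False assms(2) M0 by (intro mult_mono power_mono) auto
    finally show ?thesis using M[OF that] by linarith
  qed
  show ?thesis
  proof (rule growthI[where C = "max C 0 + M / r ^ K"])
    fix \<tau> :: complex assume \<tau>: "Im \<tau> \<ge> 1"
    have "nome \<tau> \<in> cball 0 s" unfolding mem_cball dist_0_norm norm_nome s_def using \<tau> by simp
    from b[OF this] show "norm (F (nome \<tau>)) \<le> (max C 0 + M / r ^ K) * exp (2 * pi * - real K * Im \<tau>)"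
      unfolding norm_nome by (simp add: exp_of_nat_mult[symmetric] mult_ac)
  qed
qed

lemma growth_elliptic_j: "growth elliptic_j 1"
proof -
  have "\<exists>C r. r > 0 \<and> (\<forall>q. norm q < r \<longrightarrow> norm (jq q) \<le> C * norm q ^ 0)"
  proof -
    have "isCont jq 0"
      using holomorphic_on_imp_continuous_on[OF holomorphic_jq] by (rule continuous_on_interior) simp
    then obtain r where "r > 0" "\<forall>q. dist q 0 < r \<longrightarrow> dist (jq q) (jq 0) < 1"
      unfolding continuous_at_eps_delta using zero_less_one by blast
    hence "r > 0" "\<And>q. norm q < r \<Longrightarrow> dist (jq q) 1 < 1" by (auto simp: jq_0)
    moreover have "norm (jq q) \<le> 2" if "dist (jq q) 1 < 1" for q
      using that norm_triangle_ineq2[of "jq q" 1] by (simp add: dist_norm)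
    ultimately show ?thesis by (intro exI[of _ 2] exI[of _ r]) auto
  qed
  then obtain C r where "r > 0" "\<And>q. norm q < r \<Longrightarrow> norm (jq q) \<le> C * norm q ^ 0" by blast
  from growth_nome[OF holomorphic_on_imp_continuous_on[OF holomorphic_jq] this]
  have 1: "growth (\<lambda>\<tau>. jq (nome \<tau>)) 0" by simp
  have "growth (\<lambda>\<tau>. inverse (nome \<tau>)) 1"
    by (rule growthI[where C = 1]) (simp add: norm_inverse norm_nome exp_minus)
  from growth_mult[OF 1 this] have "growth (\<lambda>\<tau>. jq (nome \<tau>) * inverse (nome \<tau>)) 1" by simp
  thus ?thesis by (subst growth_cong[of _ "\<lambda>\<tau>. jq (nome \<tau>) * inverse (nome \<tau>)"]) (auto simp: elliptic_j_conv_jq divide_inverse)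
qed

lemma elliptic_j_plus_1: "Im \<tau> > 0 \<Longrightarrow> elliptic_j (\<tau> + 1) = elliptic_j \<tau>"
  by (simp add: elliptic_j_conv_jq nome_plus_1)

text \<open>Since \<open>n (-1/\<tau>) = -1/(\<tau>/n)\<close>, the inversion formula applies to
  both eta values; their ratio cancels the constant and leaves \<open>1/n\<close> of the linear
  factors.\<close>

lemma dedekind_eta_ratio_inversion:
  assumes "Im \<tau> > 0" "n > 0"
  shows "(dedekind_eta (of_nat n * (- 1 / \<tau>)) / dedekind_eta (- 1 / \<tau>)) ^ 2 =
     (dedekind_eta (\<tau> / of_nat n) / dedekind_eta \<tau>) ^ 2 / of_nat n"
proof -
  obtain w where w: "norm w = 1" "\<And>\<tau>. Im \<tau> > 0 \<Longrightarrow> dedekind_eta (- 1 / \<tau>) ^ 2 = w * \<tau> * dedekind_eta \<tau> ^ 2"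
    using dedekind_eta_inversion by metis
  have w0: "w \<noteq> 0" "\<tau> \<noteq> 0" using w(1) assms by auto
  have "of_nat n * (- 1 / \<tau>) = - 1 / (\<tau> / of_nat n)" using assms(2) by simp
  moreover have "Im (\<tau> / of_nat n) > 0" using assms by simp
  ultimately show ?thesis
    using w(2)[of "\<tau> / of_nat n"] w(2)[OF assms(1)] w0 by (simp add: power_divide)
qed

lemma exp_24th_root:
  "exp (2 * of_real pi * \<i> / 24) ^ 12 = (-1 :: complex)" "exp (2 * of_real pi * \<i> / 24) ^ 24 = (1 :: complex)"
proof -
  have "exp (2 * of_real pi * \<i> / 24) ^ 12 = exp (of_real pi * \<i>)"
    unfolding exp_of_nat_mult[symmetric] by (rule arg_cong[where f = exp]) simp
  thus 1: "exp (2 * of_real pi * \<i> / 24) ^ 12 = (-1 :: complex)" by (simp add: mult.commute)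
  have "exp (2 * of_real pi * \<i> / 24) ^ 24 = (exp (2 * of_real pi * \<i> / 24) ^ 12) ^ 2"
    by (simp only: power_mult[symmetric]) simp
  thus "exp (2 * of_real pi * \<i> / 24) ^ 24 = (1 :: complex)" unfolding 1 by simp
qed

lemma dedekind_eta_plus_nat:
  "dedekind_eta (\<tau> + of_nat n) = exp (2 * of_real pi * \<i> / 24) ^ n * dedekind_eta \<tau>"
proof (induction n)
  case (Suc n)
  have "dedekind_eta (\<tau> + of_nat (Suc n)) = dedekind_eta ((\<tau> + of_nat n) + 1)" by (simp add: add_ac)
  thus ?case unfolding dedekind_eta_plus_1 Suc by simp
qed simp

text \<open>\<open>t\<^sub>N(-1/\<tau>)\<close> is a function of \<open>\<tau>/N\<close> and hence has period \<open>N\<close>.  So \<open>j(-1/\<tau>)\<close>, being a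
  function of \<open>t\<^sub>2(-1/\<tau>)\<close> and of \<open>t\<^sub>3(-1/\<tau>)\<close>, has the periods 2 and 3.\<close>

lemma hauptmodul_inversion_periodic:
  assumes "N = 2 \<or> N = 3" "Im \<tau> > 0"
  shows "hauptmodul N (- 1 / (\<tau> + of_nat N)) = hauptmodul N (- 1 / \<tau>)"
proof -
  define w :: complex where "w = exp (2 * of_real pi * \<i> / 24)"
  \<comment> \<open>Half of the exponents 24 and 12, because the inversion formula concerns
    squares.\<close>
  define k :: nat where "k = (if N = 2 then 12 else 6)"
  have N: "N > 0" "N \<in> levels" using assms(1) by (auto simp: levels_def)
  have t: "hauptmodul N \<sigma> = of_int (kappa N) * ((dedekind_eta (of_nat N * \<sigma>) / dedekind_eta \<sigma>) ^ 2) ^ k" for \<sigma>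
    using assms(1) unfolding hauptmodul_conv_etaq[OF N(2)]
    by (auto simp: etaq_def eta_exps_def k_def power_mult[symmetric] power_mult_distrib power_inverse power_int_minus divide_inverse)
  have t': "hauptmodul N (- 1 / \<sigma>) = of_int (kappa N) * ((dedekind_eta (\<sigma> / of_nat N) / dedekind_eta \<sigma>) ^ 2 / of_nat N) ^ k"
    if "Im \<sigma> > 0" for \<sigma>
    unfolding t dedekind_eta_ratio_inversion[OF that N(1)] ..
  have "dedekind_eta ((\<tau> + of_nat N) / of_nat N) = w * dedekind_eta (\<tau> / of_nat N)"
    using N by (simp add: add_divide_distrib dedekind_eta_plus_1 w_def)
  moreover have "dedekind_eta (\<tau> + of_nat N) = w ^ N * dedekind_eta \<tau>"
    unfolding w_def by (rule dedekind_eta_plus_nat)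
  ultimately have ratio: "dedekind_eta ((\<tau> + of_nat N) / of_nat N) / dedekind_eta (\<tau> + of_nat N) =
      (w / w ^ N) * (dedekind_eta (\<tau> / of_nat N) / dedekind_eta \<tau>)"
    by simp
  \<comment> \<open>For \<open>N = 2\<close> use \<open>w^24 = 1\<close>; for \<open>N = 3\<close>
    use \<open>w^12 = -1\<close>, where the sign cancels as \<open>N\<close> is odd.\<close>
  have "((w / w ^ N) ^ 2) ^ k = w ^ (2 * k) / (w ^ (2 * k)) ^ N"
    by (simp add: power_divide power_mult[symmetric] mult_ac)
  also have "\<dots> = 1"
    using assms(1) exp_24th_root by (auto simp: k_def w_def)
  finally have wk: "((w / w ^ N) ^ 2) ^ k = 1" .
  have dist: "((u * x) ^ 2 / of_nat N) ^ k = (u ^ 2) ^ k * (x ^ 2 / of_nat N) ^ k" for u x :: complex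
    by (simp add: power_mult_distrib power_divide)
  have "((w / w ^ N * x) ^ 2 / of_nat N) ^ k = (x ^ 2 / of_nat N) ^ k" for x :: complex
    using dist[of "w / w ^ N" x] unfolding wk by (simp only: mult_1)
  thus ?thesis
    using t'[of "\<tau> + of_nat N"] t'[OF assms(2)] assms(2) by (simp only: ratio) simp
qed

text \<open>The periods 2 and 3 give \<open>j(-1/\<tau>)\<close> the period 1, which is invariance
  of \<open>j\<close> under a conjugate of the translation. The translation and this conjugate
  generate the modular group.\<close>

lemma elliptic_j_modular:
  assumes R2: "\<And>\<tau>. Im \<tau> > 0 \<Longrightarrow> elliptic_j \<tau> = R2 (hauptmodul 2 \<tau>)"
    and R3: "\<And>\<tau>. Im \<tau> > 0 \<Longrightarrow> elliptic_j \<tau> = R3 (hauptmodul 3 \<tau>)"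
    and "Im \<tau> > 0" "a * d - b * c = 1"
  shows "elliptic_j (mob a b c d \<tau>) = elliptic_j \<tau>"
proof (rule modular_invariant[of elliptic_j, OF elliptic_j_plus_1 _ assms(3,4)])
  fix \<tau> :: complex assume \<tau>: "Im \<tau> > 0"
  have p2: "elliptic_j (- 1 / (\<sigma> + 2)) = elliptic_j (- 1 / \<sigma>)" if "Im \<sigma> > 0" for \<sigma>
    using R2[OF Im_minus_inverse_pos, of \<sigma>] R2[OF Im_minus_inverse_pos, of "\<sigma> + 2"] that
      hauptmodul_inversion_periodic[of 2 \<sigma>] by simp
  have p3: "elliptic_j (- 1 / (\<sigma> + 3)) = elliptic_j (- 1 / \<sigma>)" if "Im \<sigma> > 0" for \<sigma>
    using R3[OF Im_minus_inverse_pos, of \<sigma>] R3[OF Im_minus_inverse_pos, of "\<sigma> + 3"] that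
      hauptmodul_inversion_periodic[of 3 \<sigma>] by simp
  have p1: "elliptic_j (- 1 / (\<sigma> + 1)) = elliptic_j (- 1 / \<sigma>)" if "Im \<sigma> > 0" for \<sigma>
    using p2[of "\<sigma> + 1"] p3[OF that] that by (simp add: add_ac)
  show "elliptic_j (- 1 / \<tau>) = elliptic_j \<tau>"
  proof -
    \<comment> \<open>This expresses the inversion by translations and the conjugate: for
      \<open>\<rho> = -1/(\<tau> - 1)\<close>, the new invariance identifies the values at
      \<open>-1/(\<rho> - 1) = 1 - 1/\<tau>\<close> and at
      \<open>-1/\<rho> = \<tau> - 1\<close>.\<close>
    define \<sigma> where "\<sigma> = \<tau> - 1"
    have \<sigma>: "Im \<sigma> > 0" "\<sigma> \<noteq> 0" "\<tau> \<noteq> 0" "\<tau> = \<sigma> + 1" using \<tau> by (auto simp: \<sigma>_def)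
    define \<rho> where "\<rho> = - 1 / \<sigma>"
    have \<rho>: "Im \<rho> > 0" unfolding \<rho>_def by (rule Im_minus_inverse_pos[OF \<sigma>(1)])
    have 1: "- 1 / \<rho> = \<sigma>" by (simp add: \<rho>_def)
    have "\<rho> - 1 = - \<tau> / \<sigma>" using \<sigma> by (simp add: \<rho>_def field_simps)
    moreover have "- 1 / (- \<tau> / \<sigma>) = \<sigma> / \<tau>" by simp
    moreover have "\<sigma> / \<tau> = - 1 / \<tau> + 1" using \<sigma>(3) by (simp add: \<sigma>_def diff_divide_distrib)
    ultimately have 2: "- 1 / (\<rho> - 1) = - 1 / \<tau> + 1" by simp
    have "elliptic_j (- 1 / \<tau>) = elliptic_j (- 1 / \<tau> + 1)"
      using elliptic_j_plus_1[OF Im_minus_inverse_pos[OF \<tau>]] by simp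
    also have "\<dots> = elliptic_j (- 1 / \<rho>)" using p1[of "\<rho> - 1"] \<rho> unfolding 2 by simp
    also have "\<dots> = elliptic_j (\<sigma> + 1)" unfolding 1 using elliptic_j_plus_1[OF \<sigma>(1)] by simp
    finally show ?thesis using \<sigma>(4) by simp
  qed
qed

section \<open>Invariance under the congruence subgroup\<close>

lemma growth_hauptmodul:
  assumes N: "N \<in> levels" and det: "a * d - b * c = 1"
  shows "growth (\<lambda>\<tau>. hauptmodul N (mob a b c d \<tau>)) (- etaq_order (eta_exps N) c)"
  using growth_mult[OF growth_const[of 0 "of_int (kappa N)"]
      growth_etaq[OF eta_exps_pos[OF N] eta_exps_props(2)[OF N] det]]
  by (simp add: hauptmodul_conv_etaq[OF N])

lemma etaq_order_gcd:
  assumes "\<forall>(m, r)\<in>set rs. m dvd N"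
  shows "etaq_order rs c = etaq_order rs (gcd c (int N))"
proof -
  have "gcd (int m) c = gcd (int m) (gcd c (int N))" if "m dvd N" for m
  proof -
    have "gcd (int m) (int N) = int m" using that by (simp add: gcd_proj1_iff)
    thus ?thesis by (metis gcd.assoc gcd.commute)
  qed
  thus ?thesis using assms unfolding etaq_order_def
    by (intro arg_cong[where f = sum_list] map_cong) auto
qed

lemma nome_tendsto_0: "((\<lambda>y. nome (\<i> * of_real y)) \<longlongrightarrow> 0) at_top"
proof (rule tendsto_norm_zero_cancel)
  have "((\<lambda>y. exp (- (2 * pi * y))) \<longlongrightarrow> 0) at_top" by real_asymp
  thus "((\<lambda>y. norm (nome (\<i> * of_real y))) \<longlongrightarrow> 0) at_top" unfolding norm_nome by simp
qed

lemma isCont_0_of_holomorphic: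
  assumes "g holomorphic_on ball 0 1"
  shows "isCont g (0 :: complex)"
  using holomorphic_on_imp_continuous_on[OF assms] by (rule continuous_on_interior) simp

lemma hauptmodul_tendsto_0:
  assumes N: "N \<in> levels"
  shows "((\<lambda>y. hauptmodul N (\<i> * of_real y)) \<longlongrightarrow> 0) at_top"
proof -
  have "((\<lambda>y. hauptmodul_q N (nome (\<i> * of_real y))) \<longlongrightarrow> hauptmodul_q N 0) at_top"
    by (rule isCont_tendsto_compose[OF isCont_0_of_holomorphic[OF holomorphic_hauptmodul_q[OF N]] nome_tendsto_0])
  thus ?thesis by (simp add: hauptmodul_conv_q[OF N]) (simp add: hauptmodul_q_def)
qed

text \<open>A simple zero meets a simple pole, so the limit is the product of the leading
  coefficients \<open>kappa N\<close> and 1.\<close>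

lemma hauptmodul_mult_j_tendsto:
  assumes N: "N \<in> levels"
  shows "((\<lambda>y. hauptmodul N (\<i> * of_real y) * elliptic_j (\<i> * of_real y)) \<longlongrightarrow> of_int (kappa N)) at_top"
proof -
  define g where "g q = of_int (kappa N) * epq (eta_exps N) q * jq q" for q
  have "g holomorphic_on ball 0 1"
    unfolding g_def by (intro holomorphic_intros holomorphic_epq holomorphic_jq eta_exps_pos[OF N])
  hence "((\<lambda>y. g (nome (\<i> * of_real y))) \<longlongrightarrow> g 0) at_top"
    by (rule isCont_tendsto_compose[OF isCont_0_of_holomorphic nome_tendsto_0])
  hence lim: "((\<lambda>y. g (nome (\<i> * of_real y))) \<longlongrightarrow> of_int (kappa N)) at_top"
    by (simp add: g_def jq_0 epq_0[OF eta_exps_pos[OF N]])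
  have "\<forall>\<^sub>F y in at_top. g (nome (\<i> * of_real y)) = hauptmodul N (\<i> * of_real y) * elliptic_j (\<i> * of_real y)"
    using eventually_gt_at_top[of 0]
    by eventually_elim (simp add: g_def hauptmodul_conv_q[OF N] elliptic_j_conv_jq hauptmodul_q_def)
  from Lim_transform_eventually[OF lim this] show ?thesis .
qed

text \<open>As \<open>j\<close> has a simple pole at the cusp, where \<open>t\<^sub>N\<close> has a simple zero, \<open>R = P/Q\<close> has a simple pole
  at 0.  Hence \<open>R(\<zeta>x) = R(x)\<close> only for \<open>\<zeta> = 1\<close>.\<close>

lemma simple_pole_rigid:
  fixes P Q :: "complex poly" and X :: "real \<Rightarrow> complex"
  assumes cop: "coprime P Q"
    and X: "(X \<longlongrightarrow> 0) at_top" "\<forall>\<^sub>F y in at_top. X y \<noteq> 0"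
    and lim: "((\<lambda>y. X y * (poly P (X y) / poly Q (X y))) \<longlongrightarrow> k) at_top" "k \<noteq> 0"
    and sym: "\<forall>\<^sub>F y in at_top. poly P (\<zeta> * X y) / poly Q (\<zeta> * X y) = poly P (X y) / poly Q (X y)"
    and z: "\<zeta> \<noteq> 0"
  shows "\<zeta> = 1"
proof -
  have Q0: "Q \<noteq> 0"
  proof
    assume "Q = 0"
    hence "((\<lambda>y::real. 0) \<longlongrightarrow> k) at_top" using lim(1) by simp
    thus False using lim(2) by (simp add: tendsto_const_iff)
  qed
  obtain Q1 where Q1: "Q = [:- 0, 1:] ^ order 0 Q * Q1" "\<not> [:- 0, 1:] dvd Q1"
    using order_decomp[OF Q0] by blast
  \<comment> \<open>The order of the zero of \<open>Q\<close> at 0. Order 0 would force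
    \<open>k = 0\<close>; an order above 1 would force \<open>P 0 = 0\<close>, which coprimality
    forbids.\<close>
  define n where "n = order 0 Q"
  have Q1n: "poly Q1 0 \<noteq> 0" using Q1(2) poly_eq_0_iff_dvd[of Q1 0] by auto
  have Qn: "poly Q x = x ^ n * poly Q1 x" for x
    by (subst Q1(1)) (simp add: n_def poly_power)
  have n0: "n \<noteq> 0"
  proof
    assume n: "n = 0"
    have "((\<lambda>y. X y * (poly P (X y) / poly Q (X y))) \<longlongrightarrow> 0 * (poly P 0 / poly Q 0)) at_top"
      by (intro tendsto_intros X(1) isCont_tendsto_compose[OF poly_isCont X(1)]) (simp add: Qn n Q1n)
    hence "k = 0" using tendsto_unique[OF _ lim(1)] by simp
    thus False using lim(2) by simp
  qed
  have P0: "poly P 0 \<noteq> 0"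
  proof
    assume "poly P 0 = 0"
    moreover have "poly Q 0 = 0" using n0 by (simp add: Qn)
    ultimately have "[:0, 1:] dvd P" "[:0, 1:] dvd Q" by (simp_all add: poly_eq_0_iff_dvd)
    with cop have "is_unit [:0, 1 :: complex:]" by (rule coprime_common_divisor)
    thus False by (simp add: is_unit_poly_iff)
  qed
  define g where "g x = poly P x / poly Q1 x" for x
  have gX: "((\<lambda>y. g (c * X y)) \<longlongrightarrow> poly P 0 / poly Q1 0) at_top" for c
  proof -
    have "((\<lambda>y. c * X y) \<longlongrightarrow> c * 0) at_top" by (intro tendsto_intros X(1))
    hence c: "((\<lambda>y. c * X y) \<longlongrightarrow> 0) at_top" by simp
    show ?thesis unfolding g_def
      by (intro tendsto_intros isCont_tendsto_compose[OF poly_isCont c] Q1n)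
  qed
  have fX: "\<forall>\<^sub>F y in at_top. X y ^ (n - 1) * (X y * (poly P (X y) / poly Q (X y))) = g (1 * X y)"
    using X(2)
  proof eventually_elim
    case (elim y)
    have "X y ^ (n - 1) * X y = X y ^ n" by (rule power_minus_mult) (use n0 in simp)
    thus ?case using elim by (simp add: Qn g_def mult.assoc[symmetric])
  qed
  have n1: "n = 1"
  proof (rule ccontr)
    assume "n \<noteq> 1"
    hence "n - 1 > 0" using n0 by simp
    have "((\<lambda>y. X y ^ (n - 1) * (X y * (poly P (X y) / poly Q (X y)))) \<longlongrightarrow> 0 ^ (n - 1) * k) at_top"
      by (intro tendsto_intros X(1) lim(1))
    moreover have "((\<lambda>y. X y ^ (n - 1) * (X y * (poly P (X y) / poly Q (X y)))) \<longlongrightarrow> poly P 0 / poly Q1 0) at_top"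
      using gX[of 1] by (rule Lim_transform_eventually) (use fX in \<open>eventually_elim, simp\<close>)
    ultimately have "0 ^ (n - 1) * k = poly P 0 / poly Q1 0"
      by (rule tendsto_unique[rotated]) simp
    thus False using \<open>n - 1 > 0\<close> P0 Q1n by (simp add: zero_power)
  qed
  \<comment> \<open>As \<open>n = 1\<close>, \<open>g x\<close> is \<open>x P(x)/Q(x)\<close>
    extended continuously to 0. Both \<open>g (X y)\<close> and \<open>g (\<zeta> X y)\<close> tend
    to \<open>g 0\<close>, whereas the symmetry makes the second tend to
    \<open>\<zeta> k\<close>.\<close>
  have "((\<lambda>y. \<zeta> * (X y * (poly P (X y) / poly Q (X y)))) \<longlongrightarrow> \<zeta> * k) at_top"
    by (intro tendsto_intros lim(1))
  moreover have "\<forall>\<^sub>F y in at_top. \<zeta> * (X y * (poly P (X y) / poly Q (X y))) = g (\<zeta> * X y)"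
    using sym X(2)
  proof eventually_elim
    case (elim y)
    have "g (\<zeta> * X y) = \<zeta> * X y * (poly P (\<zeta> * X y) / poly Q (\<zeta> * X y))"
      using elim(2) z by (simp add: g_def Qn n1)
    thus ?case unfolding elim(1) by (simp add: mult_ac)
  qed
  ultimately have "((\<lambda>y. g (\<zeta> * X y)) \<longlongrightarrow> \<zeta> * k) at_top"
    by (rule Lim_transform_eventually)
  hence "\<zeta> * k = poly P 0 / poly Q1 0" using gX[of \<zeta>] by (rule tendsto_unique[rotated]) simp
  moreover have "((\<lambda>y. g (1 * X y)) \<longlongrightarrow> k) at_top"
    using lim(1) by (rule Lim_transform_eventually) (use fX n1 in \<open>simp\<close>)
  hence "k = poly P 0 / poly Q1 0" using gX[of 1] by (rule tendsto_unique[rotated]) simp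
  ultimately show ?thesis using lim(2) by simp
qed

lemma hauptmodul_Gamma0:
  assumes N: "N \<in> levels" and cop: "coprime P Q"
    and j: "\<And>\<tau>. Im \<tau> > 0 \<Longrightarrow> elliptic_j \<tau> = poly P (hauptmodul N \<tau>) / poly Q (hauptmodul N \<tau>)"
    and mod: "\<And>a b c d \<tau>. Im \<tau> > 0 \<Longrightarrow> a * d - b * c = 1 \<Longrightarrow> elliptic_j (mob a b c d \<tau>) = elliptic_j \<tau>"
    and det: "a * d - b * c = 1" and c: "int N dvd c" and \<tau>: "Im \<tau> > 0"
  shows "hauptmodul N (mob a b c d \<tau>) = hauptmodul N \<tau>"
proof -
  have m: "\<forall>(m, r)\<in>set (eta_exps N). m > 0 \<and> int m dvd c"
  proof safe
    fix m r assume "(m, r) \<in> set (eta_exps N)"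
    hence "m > 0" "int m dvd int N" using eta_exps_props(1)[OF N] by auto
    thus "m > 0" "int m dvd c" using dvd_trans[OF _ c] by auto
  qed
  obtain \<zeta> where \<zeta>: "\<And>\<tau>. Im \<tau> > 0 \<Longrightarrow> etaq (eta_exps N) (mob a b c d \<tau>) = \<zeta> * etaq (eta_exps N) \<tau>"
    using etaq_Gamma0[OF m eta_exps_props(2)[OF N] det] by blast
  hence h: "hauptmodul N (mob a b c d \<tau>) = \<zeta> * hauptmodul N \<tau>" if "Im \<tau> > 0" for \<tau>
    using that by (simp add: hauptmodul_conv_etaq[OF N])
  have z: "\<zeta> \<noteq> 0" using h[OF \<tau>] hauptmodul_nonzero[OF N Im_mob_pos[OF \<tau> det]] by auto
  define X where "X y = hauptmodul N (\<i> * of_real y)" for y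
  have "\<zeta> = 1"
  proof (rule simple_pole_rigid[OF cop _ _ _ _ _ z])
    show "(X \<longlongrightarrow> 0) at_top" unfolding X_def by (rule hauptmodul_tendsto_0[OF N])
    show "\<forall>\<^sub>F y in at_top. X y \<noteq> 0"
      using eventually_gt_at_top[of 0] by eventually_elim (simp add: X_def hauptmodul_nonzero[OF N])
    show "((\<lambda>y. X y * (poly P (X y) / poly Q (X y))) \<longlongrightarrow> of_int (kappa N)) at_top"
      using hauptmodul_mult_j_tendsto[OF N]
      by (rule Lim_transform_eventually) (use eventually_gt_at_top[of 0] in \<open>eventually_elim, simp add: X_def j\<close>)
    show "of_int (kappa N) \<noteq> (0::complex)" using eta_exps_props(4)[OF N] by simp
    show "\<forall>\<^sub>F y in at_top. poly P (\<zeta> * X y) / poly Q (\<zeta> * X y) = poly P (X y) / poly Q (X y)"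
      using eventually_gt_at_top[of 0]
    proof eventually_elim
      case (elim y)
      hence y: "Im (\<i> * of_real y) > 0" by simp
      show ?case using mod[OF y det] j[OF y] j[OF Im_mob_pos[OF y det]] h[OF y] by (simp add: X_def)
    qed
  qed
  thus ?thesis using h[OF \<tau>] by simp
qed

text \<open>The first matrix times the inverse of the second has lower left entry
  \<open>c d' - d c'\<close>. Thus the bottom rows alone decide whether two cosets agree.\<close>

lemma Gamma0_coset_eq:
  assumes inv: "\<And>a b c d \<tau>. Im \<tau> > 0 \<Longrightarrow> a * d - b * c = 1 \<Longrightarrow> int N dvd c \<Longrightarrow> f (mob a b c d \<tau>) = f \<tau>"
    and det: "a * d - b * c = 1" "a' * d' - b' * c' = 1" and "int N dvd c * d' - d * c'" and \<tau>: "Im \<tau> > 0"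
  shows "f (mob a b c d \<tau>) = f (mob a' b' c' d' \<tau>)"
proof -
  define A B C D where "A = a * d' - b * c'" and "B = b * a' - a * b'" and "C = c * d' - d * c'" and "D = d * a' - c * b'"
  have "A * D - B * C = (a * d - b * c) * (a' * d' - b' * c')"
    by (simp add: A_def B_def C_def D_def algebra_simps)
  hence det'': "A * D - B * C = 1" using det by simp
  have "A * a' + B * c' = a * (a' * d' - b' * c')" "A * b' + B * d' = b * (a' * d' - b' * c')"
       "C * a' + D * c' = c * (a' * d' - b' * c')" "C * b' + D * d' = d * (a' * d' - b' * c')"
    by (simp_all add: A_def B_def C_def D_def algebra_simps)
  hence "mob A B C D (mob a' b' c' d' \<tau>) = mob a b c d \<tau>"
    unfolding mob_mob[OF mob_denominator_nonzero[OF \<tau> det(2)]] using det(2) by simp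
  moreover have "f (mob A B C D (mob a' b' c' d' \<tau>)) = f (mob a' b' c' d' \<tau>)"
    by (rule inv[OF Im_mob_pos[OF \<tau> det(2)] det'']) (use assms(4) in \<open>simp add: C_def\<close>)
  ultimately show ?thesis by simp
qed

text \<open>The cosets of the congruence subgroup with \<open>gcd c N = 1\<close> are represented by the matrices
  \<open>(0, -1; 1, k)\<close> with \<open>k < N\<close>, and if \<open>N = 2p\<close> with \<open>p\<close> odd, those with \<open>gcd c N = 2\<close> by
  \<open>(1, k; 2, 2k+1)\<close> with \<open>k < p\<close>.  The value \<open>p = 0\<close> means that no special treatment of the
  second family is needed.\<close>

lemma Gamma0_vanishing:
  fixes f :: "complex \<Rightarrow> complex" and w :: "int \<Rightarrow> real"
  assumes hol: "f holomorphic_on {\<tau>. Im \<tau> > 0}" and N: "N > 1"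
    and inv: "\<And>a b c d \<tau>. Im \<tau> > 0 \<Longrightarrow> a * d - b * c = 1 \<Longrightarrow> int N dvd c \<Longrightarrow> f (mob a b c d \<tau>) = f \<tau>"
    and inf: "growth f (- real K)"
    and gr: "\<And>a b c d. a * d - b * c = 1 \<Longrightarrow> \<not> int N dvd c \<Longrightarrow> growth (\<lambda>\<tau>. f (mob a b c d \<tau>)) (w (gcd c (int N)))"
    and w1: "w 1 \<ge> 0" and w2: "p > 0 \<Longrightarrow> w 2 \<ge> 0 \<and> N = 2 * p \<and> odd p \<and> p > 1"
    and w0: "\<And>d. d dvd N \<Longrightarrow> d \<noteq> 1 \<Longrightarrow> d \<noteq> N \<Longrightarrow> p > 0 \<longrightarrow> d \<noteq> 2 \<Longrightarrow> w (int d) \<le> 0"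
    and sum: "real N * w 1 + real p * w 2 < real K"
    and \<tau>: "Im \<tau> > 0"
  shows "f \<tau> = 0"
proof -
  \<comment> \<open>The remaining cosets are labelled by the residues of \<open>(c, d)\<close>
    modulo \<open>N\<close>. These labels repeat cosets, which is harmless as each has weight 0; a
    label that no matrix realises gets the zero function in \<open>pick\<close>.\<close>
  define good where "good \<gamma> x y \<longleftrightarrow> (case \<gamma> of (a, b, c, d) \<Rightarrow> a * d - b * c = 1 \<and> int N dvd c - int x \<and> int N dvd d - int y
     \<and> \<not> int N dvd c \<and> gcd c (int N) \<noteq> 1 \<and> (p > 0 \<longrightarrow> gcd c (int N) \<noteq> 2))" for \<gamma> :: "int \<times> int \<times> int \<times> int" and x y :: nat
  define pick where "pick x y = (if \<exists>\<gamma>. good \<gamma> x y then (\<lambda>\<tau>. case (SOME \<gamma>. good \<gamma> x y) of (a, b, c, d) \<Rightarrow> f (mob a b c d \<tau>))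
     else (\<lambda>_. 0))" for x y
  define I where "I = {()} <+> ({..<N} <+> ({..<p} <+> ({..<N} \<times> {..<N})))"
  define h where "h = case_sum (\<lambda>_::unit. f) (case_sum (\<lambda>k \<tau>. f (mob 0 (-1) 1 (int k) \<tau>))
     (case_sum (\<lambda>k \<tau>. f (mob 1 (int k) 2 (2 * int k + 1) \<tau>)) (\<lambda>(x, y). pick x y)))"
  define v where "v = case_sum (\<lambda>_::unit. - real K) (case_sum (\<lambda>_::nat. w 1) (case_sum (\<lambda>_::nat. w 2) (\<lambda>_::nat \<times> nat. 0)))"
  show ?thesis
  proof (rule modular_vanishing[where I = I and h = h and w = v and ?i0.0 = "Inl ()", OF hol _ _ _ _ _ _ _ \<tau>])
    show "finite I" by (auto simp: I_def)
    show "Inl () \<in> I" by (auto simp: I_def)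
    show "h (Inl ()) \<tau> = f \<tau>" for \<tau> by (simp add: h_def)
    show "v i \<ge> 0" if "i \<in> I" "i \<noteq> Inl ()" for i
      using that w1 w2 by (auto simp: v_def I_def)
    show "(\<Sum>i\<in>I. v i) < 0"
      using sum by (simp add: I_def v_def sum.Plus)
    show "\<exists>C. \<forall>\<tau>. Im \<tau> \<ge> 1 \<longrightarrow> norm (h i \<tau>) \<le> C * exp (2 * pi * v i * Im \<tau>)" if "i \<in> I" for i
    proof -
      have "growth (h i) (v i)"
      proof (cases i)
        case (Inl u)
        thus ?thesis using inf by (simp add: h_def v_def)
      next
        case i1: (Inr i1)
        show ?thesis
        proof (cases i1)
          case (Inl k)
          have "growth (\<lambda>\<tau>. f (mob 0 (-1) 1 (int k) \<tau>)) (w (gcd 1 (int N)))"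
            using N by (intro gr) auto
          thus ?thesis by (simp add: i1 Inl h_def v_def)
        next
          case i2: (Inr i2)
          show ?thesis
          proof (cases i2)
            case (Inl k)
            hence p: "p > 0" using that by (auto simp: I_def i1 i2)
            have "\<not> int N dvd 2" using w2[OF p] zdvd_imp_le[of "int N" 2] by auto
            moreover have "gcd 2 (int N) = 2" using w2[OF p] by simp
            ultimately have "growth (\<lambda>\<tau>. f (mob 1 (int k) 2 (2 * int k + 1) \<tau>)) (w 2)"
              using gr[of 1 "2 * int k + 1" "int k" 2] by simp
            thus ?thesis by (simp add: i1 i2 Inl h_def v_def)
          next
            case (Inr xy)
            obtain x y where xy: "xy = (x, y)" by (cases xy)
            have "growth (pick x y) 0"
            proof (cases "\<exists>\<gamma>. good \<gamma> x y")
              case True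
              obtain a b c d where g: "(SOME \<gamma>. good \<gamma> x y) = (a, b, c, d)" by (metis prod_cases4)
              have "good (a, b, c, d) x y" using someI_ex[OF True] unfolding g .
              hence *: "a * d - b * c = 1" "\<not> int N dvd c" "gcd c (int N) \<noteq> 1" "p > 0 \<longrightarrow> gcd c (int N) \<noteq> 2"
                by (auto simp: good_def)
              define e where "e = nat (gcd c (int N))"
              have e: "int e = gcd c (int N)" by (simp add: e_def)
              have "int e dvd int N" unfolding e by simp
              hence "e dvd N" by simp
              moreover have "e \<noteq> N" using *(2) e by (metis gcd_dvd1)
              ultimately have "w (int e) \<le> 0" using *(3,4) e by (intro w0) auto
              hence "w (gcd c (int N)) \<le> 0" by (simp add: e)
              with gr[OF *(1,2)] have "growth (\<lambda>\<tau>. f (mob a b c d \<tau>)) 0" by (rule growth_mono)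
              thus ?thesis using True by (simp add: pick_def g)
            qed (simp add: pick_def growth_const)
            thus ?thesis by (simp add: i1 i2 Inr xy h_def v_def)
          qed
        qed
      qed
      thus ?thesis unfolding growth_def .
    qed
    show "\<exists>i\<in>I. \<forall>\<tau>. Im \<tau> > 0 \<longrightarrow> f (mob a b c d \<tau>) = h i \<tau>" if det: "a * d - b * c = 1" for a b c d
    proof -
      consider (0) "int N dvd c" | (1) "gcd c (int N) = 1" "\<not> int N dvd c" | (2) "p > 0" "gcd c (int N) = 2" "\<not> int N dvd c"
        | (3) "\<not> int N dvd c" "gcd c (int N) \<noteq> 1" "p > 0 \<longrightarrow> gcd c (int N) \<noteq> 2" by blast
      thus ?thesis
      proof cases
        case 0
        thus ?thesis using inv[OF _ det] by (intro bexI[of _ "Inl ()"]) (auto simp: I_def h_def)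
      next
        case 1
        \<comment> \<open>The bottom row \<open>(1, k)\<close> needs \<open>c k\<close> congruent to
          \<open>d\<close> modulo \<open>N\<close>; \<open>u\<close> inverts
          \<open>c\<close>.\<close>
        obtain u v where uv: "u * c + v * int N = 1" using bezout_int[of c "int N"] 1 by auto
        define t where "t = (u * d) div int N"
        define k where "k = nat ((u * d) mod int N)"
        have k: "k < N" "int k = u * d - int N * t" using N by (auto simp: k_def t_def nat_less_iff minus_mult_div_eq_mod)
        have "c * int k - d * 1 = (u * c - 1) * d - int N * (c * t)" by (simp add: k(2) algebra_simps)
        also have "u * c - 1 = - (v * int N)" using uv by simp
        finally have "c * int k - d * 1 = int N * (- v * d - c * t)" by (simp add: algebra_simps)
        hence "int N dvd c * int k - d * 1" by simp
        hence "f (mob a b c d \<tau>) = f (mob 0 (-1) 1 (int k) \<tau>)" if "Im \<tau> > 0" for \<tau>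
          using that by (intro Gamma0_coset_eq[OF inv det]) auto
        thus ?thesis using k(1) by (intro bexI[of _ "Inr (Inl k)"]) (auto simp: I_def h_def)
      next
        case 2
        note p = w2[OF 2(1)]
        \<comment> \<open>The bottom row \<open>(2, 2k + 1)\<close> needs \<open>c (2k + 1)\<close>
          congruent to \<open>2d\<close> modulo \<open>2p\<close>. With \<open>c = 2 c1\<close> this
          is \<open>c k\<close> congruent to \<open>d - c1\<close> modulo \<open>p\<close>, and
          \<open>c\<close> is invertible modulo the odd number \<open>p\<close>.\<close>
        obtain c1 where c1: "c = 2 * c1" using 2(2) by (metis dvdE gcd_dvd1)
        have "gcd c (int N) = 2 * gcd c1 (int p)" using p by (simp add: c1 gcd_mult_distrib_int[symmetric])
        hence "coprime c1 (int p)" using 2(2) by (simp add: coprime_iff_gcd_eq_1)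
        moreover have "coprime 2 (int p)" using p by simp
        ultimately have "coprime c (int p)" unfolding c1 by simp
        hence "gcd c (int p) = 1" by simp
        then obtain u v where uv: "u * c + v * int p = 1" using bezout_int[of c "int p"] by auto
        define t where "t = (u * (d - c1)) div int p"
        define k where "k = nat ((u * (d - c1)) mod int p)"
        have k: "k < p" "int k = u * (d - c1) - int p * t"
          using 2(1) by (auto simp: k_def t_def nat_less_iff minus_mult_div_eq_mod)
        have "c * int k - (d - c1) = (u * c - 1) * (d - c1) - int p * (c * t)" by (simp add: k(2) algebra_simps)
        also have "u * c - 1 = - (v * int p)" using uv by simp
        finally have "c * int k - (d - c1) = int p * (- v * (d - c1) - c * t)" by (simp add: algebra_simps)
        hence "int p dvd c * int k - (d - c1)" by simp
        hence "2 * int p dvd 2 * (c * int k - (d - c1))" by (rule mult_dvd_mono[OF dvd_refl])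
        also have "2 * (c * int k - (d - c1)) = c * (2 * int k + 1) - d * 2" by (simp add: c1 algebra_simps)
        also have "2 * int p = int N" using p by simp
        finally have "int N dvd c * (2 * int k + 1) - d * 2" .
        hence "f (mob a b c d \<tau>) = f (mob 1 (int k) 2 (2 * int k + 1) \<tau>)" if "Im \<tau> > 0" for \<tau>
          using that by (intro Gamma0_coset_eq[OF inv det]) auto
        thus ?thesis using k(1) by (intro bexI[of _ "Inr (Inr (Inl k))"]) (auto simp: I_def h_def)
      next
        case 3
        define x y where "x = nat (c mod int N)" and "y = nat (d mod int N)"
        have xy: "x < N" "y < N" "int x = c mod int N" "int y = d mod int N"
          using N by (auto simp: x_def y_def nat_less_iff)
        have g0: "good (a, b, c, d) x y"
          using det 3 xy(3,4) by (auto simp: good_def mod_eq_dvd_iff[symmetric])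
        hence ex: "\<exists>\<gamma>. good \<gamma> x y" by blast
        obtain a' b' c' d' where g: "(SOME \<gamma>. good \<gamma> x y) = (a', b', c', d')" by (metis prod_cases4)
        have "good (a', b', c', d') x y" using someI_ex[OF ex] unfolding g .
        hence *: "a' * d' - b' * c' = 1" "int N dvd c' - int x" "int N dvd d' - int y" by (auto simp: good_def)
        have **: "int N dvd c - int x" "int N dvd d - int y" using g0 by (auto simp: good_def)
        have "c * d' - d * c' = (c - int x) * d' + int x * (d' - int y) - ((d - int y) * c' + int y * (c' - int x))"
          by (simp add: algebra_simps)
        hence "int N dvd c * d' - d * c'" using * ** by simp
        hence "f (mob a b c d \<tau>) = f (mob a' b' c' d' \<tau>)" if "Im \<tau> > 0" for \<tau>
          using that by (intro Gamma0_coset_eq[OF inv det *(1)]) auto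
        hence "\<forall>\<tau>. Im \<tau> > 0 \<longrightarrow> f (mob a b c d \<tau>) = pick x y \<tau>" using ex by (simp add: pick_def g)
        thus ?thesis using xy(1,2) by (intro bexI[of _ "Inr (Inr (Inr (x, y)))"]) (auto simp: I_def h_def)
      qed
    qed
  qed
qed

section \<open>Truncated power series with integer coefficients\<close>

text \<open>Coefficients are listed from the constant term upwards; those beyond the end of the list
  count as 0.\<close>

fun lp :: "int list \<Rightarrow> complex \<Rightarrow> complex" where
  "lp [] q = 0"
| "lp (x # xs) q = of_int x + q * lp xs q"

fun ladd :: "int list \<Rightarrow> int list \<Rightarrow> int list" where
  "ladd [] ys = ys"
| "ladd xs [] = xs"
| "ladd (x # xs) (y # ys) = (x + y) # ladd xs ys"

fun lmul :: "int list \<Rightarrow> int list \<Rightarrow> int list" where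
  "lmul [] ys = []"
| "lmul (x # xs) ys = ladd (map ((*) x) ys) (0 # lmul xs ys)"

text \<open>The coefficients after substituting \<open>q^m\<close> for \<open>q\<close>.\<close>

fun lstretch :: "nat \<Rightarrow> int list \<Rightarrow> int list" where
  "lstretch m [] = []"
| "lstretch m (x # xs) = x # replicate (m - 1) 0 @ lstretch m xs"

fun lpow :: "nat \<Rightarrow> nat \<Rightarrow> int list \<Rightarrow> int list" where
  "lpow K n xs = (if n = 0 then [1]
     else let ys = lpow K (n div 2) xs; zs = take K (lmul ys ys)
          in if even n then zs else take K (lmul xs zs))"

declare lpow.simps [simp del]

fun lcomp :: "nat \<Rightarrow> int list \<Rightarrow> int list \<Rightarrow> int list" where
  "lcomp K [] xs = []"
| "lcomp K (b # bs) xs = ladd [b] (take K (lmul xs (lcomp K bs xs)))"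

lemma lp_ladd: "lp (ladd xs ys) q = lp xs q + lp ys q"
  by (induction xs ys rule: ladd.induct) (auto simp: algebra_simps)

lemma lp_map_mult: "lp (map ((*) c) xs) q = of_int c * lp xs q"
  by (induction xs) (auto simp: algebra_simps)

lemma lp_lmul: "lp (lmul xs ys) q = lp xs q * lp ys q"
  by (induction xs) (auto simp: lp_ladd lp_map_mult algebra_simps)

lemma lp_append: "lp (xs @ ys) q = lp xs q + q ^ length xs * lp ys q"
  by (induction xs) (auto simp: algebra_simps)

lemma lp_replicate_0: "lp (replicate n 0) q = 0"
  by (induction n) auto

lemma lp_lstretch: "m > 0 \<Longrightarrow> lp (lstretch m xs) q = lp xs (q ^ m)"
proof (induction xs)
  case (Cons x xs)
  have "q * q ^ (m - 1) = q ^ m" using Cons.prems by (cases m) auto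
  thus ?case using Cons by (simp add: lp_append lp_replicate_0 mult.assoc[symmetric])
qed simp

lemma norm_lp_le: "norm q \<le> 1 \<Longrightarrow> norm (lp xs q) \<le> (\<Sum>x\<leftarrow>xs. real_of_int \<bar>x\<bar>)"
proof (induction xs)
  case (Cons x xs)
  have "norm (lp (x # xs) q) \<le> norm (of_int x :: complex) + norm q * norm (lp xs q)"
    unfolding lp.simps norm_mult[symmetric] by (rule norm_triangle_ineq)
  also have "norm q * norm (lp xs q) \<le> 1 * (\<Sum>x\<leftarrow>xs. real_of_int \<bar>x\<bar>)"
    using Cons by (intro mult_mono) auto
  finally show ?case by simp
qed simp

text \<open>Agreement up to \<open>O(q^K)\<close>, as an estimate and not as an identity of Taylor
  coefficients: it passes easily through products, powers and compositions, and it has the form that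
  \<open>growth_nome\<close> consumes. The list may be longer than \<open>K\<close>.\<close>

definition approx :: "nat \<Rightarrow> (complex \<Rightarrow> complex) \<Rightarrow> int list \<Rightarrow> bool" where
  "approx K F xs \<longleftrightarrow> (\<exists>C r. r > 0 \<and> (\<forall>q. norm q < r \<longrightarrow> norm (F q - lp xs q) \<le> C * norm q ^ K))"

lemma approxI: "r > 0 \<Longrightarrow> (\<And>q. norm q < r \<Longrightarrow> norm (F q - lp xs q) \<le> C * norm q ^ K) \<Longrightarrow> approx K F xs"
  unfolding approx_def by blast

lemma approxE:
  assumes "approx K F xs"
  obtains C r where "C \<ge> 0" "r > 0" "r \<le> 1" "\<And>q. norm q < r \<Longrightarrow> norm (F q - lp xs q) \<le> C * norm q ^ K"
proof -
  obtain C r where C: "r > 0" "\<And>q. norm q < r \<Longrightarrow> norm (F q - lp xs q) \<le> C * norm q ^ K"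
    using assms unfolding approx_def by blast
  show ?thesis
  proof (rule that[of "max C 0" "min r 1"])
    fix q :: complex assume "norm q < min r 1"
    hence "norm (F q - lp xs q) \<le> C * norm q ^ K" using C(2) by simp
    also have "\<dots> \<le> max C 0 * norm q ^ K" by (intro mult_right_mono) auto
    finally show "norm (F q - lp xs q) \<le> max C 0 * norm q ^ K" .
  qed (use C(1) in auto)
qed

lemma approx_lp: "approx K (lp xs) xs"
  by (rule approxI[of 1 _ _ 0]) auto

lemma approx_cong_lp: "approx K F xs \<Longrightarrow> (\<And>q. lp xs q = lp ys q) \<Longrightarrow> approx K F ys"
  unfolding approx_def by simp

lemma approx_take:
  assumes "approx K F xs" "K' \<le> K"
  shows "approx K' F (take K' xs)"
proof -
  obtain C r where C: "C \<ge> 0" "r > 0" "r \<le> 1" "\<And>q. norm q < r \<Longrightarrow> norm (F q - lp xs q) \<le> C * norm q ^ K"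
    using approxE[OF assms(1)] by blast
  define B where "B = (\<Sum>x\<leftarrow>drop K' xs. real_of_int \<bar>x\<bar>)"
  show ?thesis
  proof (rule approxI[OF C(2), where C = "C + B"])
    fix q :: complex assume q: "norm q < r"
    have q1: "norm q \<le> 1" using q C(3) by simp
    have "norm (lp xs q - lp (take K' xs) q) \<le> B * norm q ^ K'"
    proof (cases "K' \<le> length xs")
      case True
      have "lp xs q = lp (take K' xs) q + q ^ K' * lp (drop K' xs) q"
        using lp_append[of "take K' xs" "drop K' xs" q] True by simp
      hence "norm (lp xs q - lp (take K' xs) q) = norm (lp (drop K' xs) q) * norm q ^ K'"
        by (simp add: norm_mult norm_power)
      also have "\<dots> \<le> B * norm q ^ K'" unfolding B_def by (intro mult_right_mono norm_lp_le q1) auto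
      finally show ?thesis .
    qed (simp add: B_def)
    moreover have "norm (F q - lp xs q) \<le> C * norm q ^ K'"
      using C(4)[OF q] mult_left_mono[OF power_decreasing[OF assms(2) norm_ge_zero q1] C(1)] by linarith
    ultimately show "norm (F q - lp (take K' xs) q) \<le> (C + B) * norm q ^ K'"
      using norm_triangle_ineq[of "F q - lp xs q" "lp xs q - lp (take K' xs) q"]
      by (simp add: distrib_right)
  qed
qed

lemma approx_add:
  assumes "approx K F xs" "approx K G ys"
  shows "approx K (\<lambda>q. F q + G q) (ladd xs ys)"
proof -
  obtain C r where C: "C \<ge> 0" "r > 0" "r \<le> 1" "\<And>q. norm q < r \<Longrightarrow> norm (F q - lp xs q) \<le> C * norm q ^ K"
    using approxE[OF assms(1)] by blast
  obtain D s where D: "D \<ge> 0" "s > 0" "s \<le> 1" "\<And>q. norm q < s \<Longrightarrow> norm (G q - lp ys q) \<le> D * norm q ^ K"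
    using approxE[OF assms(2)] by blast
  show ?thesis
  proof (rule approxI[where r = "min r s" and C = "C + D"])
    fix q :: complex assume q: "norm q < min r s"
    have "norm ((F q - lp xs q) + (G q - lp ys q)) \<le> C * norm q ^ K + D * norm q ^ K"
      by (rule norm_triangle_le) (use C(4)[of q] D(4)[of q] q in auto)
    thus "norm (F q + G q - lp (ladd xs ys) q) \<le> (C + D) * norm q ^ K"
      by (simp add: lp_ladd algebra_simps)
  qed (use C D in auto)
qed

lemma approx_mult:
  assumes "approx K F xs" "approx K G ys"
  shows "approx K (\<lambda>q. F q * G q) (lmul xs ys)"
proof -
  obtain C r where C: "C \<ge> 0" "r > 0" "r \<le> 1" "\<And>q. norm q < r \<Longrightarrow> norm (F q - lp xs q) \<le> C * norm q ^ K"
    using approxE[OF assms(1)] by blast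
  obtain D s where D: "D \<ge> 0" "s > 0" "s \<le> 1" "\<And>q. norm q < s \<Longrightarrow> norm (G q - lp ys q) \<le> D * norm q ^ K"
    using approxE[OF assms(2)] by blast
  define A where "A = (\<Sum>x\<leftarrow>xs. real_of_int \<bar>x\<bar>)"
  define B where "B = (\<Sum>x\<leftarrow>ys. real_of_int \<bar>x\<bar>)"
  show ?thesis
  proof (rule approxI[where r = "min r s" and C = "C * (B + D) + A * D"])
    fix q :: complex assume "norm q < min r s"
    hence q: "norm q < r" "norm q < s" "norm q \<le> 1" using C(3) by auto
    have "norm (G q) \<le> norm (lp ys q) + norm (G q - lp ys q)"
      using norm_triangle_ineq[of "lp ys q" "G q - lp ys q"] by simp
    also have "\<dots> \<le> B + D"
    proof (rule add_mono)
      show "norm (lp ys q) \<le> B" unfolding B_def by (rule norm_lp_le[OF q(3)])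
      have "D * norm q ^ K \<le> D * 1" using q(3) D(1) by (intro mult_left_mono power_le_one) auto
      thus "norm (G q - lp ys q) \<le> D" using D(4)[OF q(2)] by simp
    qed
    finally have G: "norm (G q) \<le> B + D" .
    have 1: "norm ((F q - lp xs q) * G q) \<le> (C * norm q ^ K) * (B + D)"
      unfolding norm_mult using C(4)[OF q(1)] G C(1) by (intro mult_mono) auto
    have 2: "norm (lp xs q * (G q - lp ys q)) \<le> A * (D * norm q ^ K)"
      unfolding norm_mult A_def using norm_lp_le[OF q(3), of xs] D(4)[OF q(2)]
      by (intro mult_mono) (auto intro!: sum_list_nonneg)
    have "F q * G q - lp (lmul xs ys) q = (F q - lp xs q) * G q + lp xs q * (G q - lp ys q)"
      by (simp add: lp_lmul algebra_simps)
    also have "norm \<dots> \<le> (C * norm q ^ K) * (B + D) + A * (D * norm q ^ K)"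
      by (rule norm_triangle_le) (use 1 2 in linarith)
    finally show "norm (F q * G q - lp (lmul xs ys) q) \<le> (C * (B + D) + A * D) * norm q ^ K"
      by (simp add: algebra_simps)
  qed (use C D in auto)
qed

lemma approx_const: "approx K (\<lambda>_. of_int a) [a]"
  by (rule approxI[of 1 _ _ 0]) auto

lemma approx_cmult: "approx K F xs \<Longrightarrow> approx K (\<lambda>q. of_int c * F q) (map ((*) c) xs)"
  by (rule approx_cong_lp[OF approx_mult[OF approx_const]]) (auto simp: lp_ladd lp_map_mult)

lemma approx_q_mult: "approx K F xs \<Longrightarrow> approx K (\<lambda>q. q * F q) (0 # xs)"
proof -
  assume "approx K F xs"
  moreover have "approx K (\<lambda>q. q) [0, 1]" by (rule approxI[of 1 _ _ 0]) auto
  ultimately show ?thesis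
    by (intro approx_cong_lp[OF approx_mult]) (auto simp: lp_lmul)
qed

lemma approx_power:
  assumes "approx K F xs"
  shows "approx K (\<lambda>q. F q ^ n) (lpow K n xs)"
proof (induction n rule: less_induct)
  case (less n)
  show ?case
  proof (cases "n = 0")
    case True
    thus ?thesis using approx_const[of K 1] by (simp add: lpow.simps)
  next
    case False
    define ys where "ys = lpow K (n div 2) xs"
    define zs where "zs = take K (lmul ys ys)"
    have l: "lpow K n xs = (if even n then zs else take K (lmul xs zs))"
      using False by (subst lpow.simps) (simp add: Let_def ys_def zs_def)
    have "approx K (\<lambda>q. F q ^ (n div 2)) ys" unfolding ys_def using False by (intro less.IH) auto
    hence zs: "approx K (\<lambda>q. F q ^ (n div 2) * F q ^ (n div 2)) zs"
      unfolding zs_def by (intro approx_take[OF approx_mult order_refl]) auto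
    show ?thesis
    proof (cases "even n")
      case True
      hence "F q ^ n = F q ^ (n div 2) * F q ^ (n div 2)" for q
        by (auto elim!: evenE simp: power_add[symmetric] mult_2)
      thus ?thesis using zs True l by simp
    next
      case odd: False
      hence "F q ^ n = F q * (F q ^ (n div 2) * F q ^ (n div 2))" for q
        by (auto elim!: oddE simp: power_add[symmetric] mult_2)
      moreover have "approx K (\<lambda>q. F q * (F q ^ (n div 2) * F q ^ (n div 2))) (take K (lmul xs zs))"
        by (intro approx_take[OF approx_mult order_refl] assms zs)
      ultimately show ?thesis using odd l by simp
    qed
  qed
qed

lemma approx_lcomp:
  assumes "approx K F xs"
  shows "approx K (\<lambda>q. lp bs (F q)) (lcomp K bs xs)"
proof (induction bs)
  case (Cons b bs)
  have "approx K (\<lambda>q. of_int b + F q * lp bs (F q)) (ladd [b] (take K (lmul xs (lcomp K bs xs))))"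
    by (intro approx_add approx_const approx_take[OF approx_mult order_refl] assms Cons)
  thus ?case by simp
qed (rule approxI[of 1 _ _ 0], auto)

lemma approx_compose_power:
  assumes "approx K F xs" "m > 0"
  shows "approx K (\<lambda>q. F (q ^ m)) (lstretch m xs)"
proof -
  obtain C r where C: "C \<ge> 0" "r > 0" "r \<le> 1" "\<And>q. norm q < r \<Longrightarrow> norm (F q - lp xs q) \<le> C * norm q ^ K"
    using approxE[OF assms(1)] by blast
  show ?thesis
  proof (rule approxI[OF C(2), where C = C])
    fix q :: complex assume q: "norm q < r"
    have le: "norm (q ^ m) \<le> norm q"
      using power_decreasing[of 1 m "norm q"] assms(2) q C(3) by (simp add: norm_power)
    hence "norm (F (q ^ m) - lp xs (q ^ m)) \<le> C * norm (q ^ m) ^ K" using q by (intro C(4)) simp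
    also have "\<dots> \<le> C * norm q ^ K" using le C(1) by (intro mult_left_mono power_mono) auto
    finally show "norm (F (q ^ m) - lp (lstretch m xs) q) \<le> C * norm q ^ K"
      by (simp add: lp_lstretch[OF assms(2)])
  qed
qed

text \<open>The list \<open>ys\<close> is a guess that one multiplication certifies:
  \<open>1/F - ys = -(F ys - 1)/F\<close>, and \<open>F\<close> is bounded away from 0 near
  0.\<close>

lemma approx_inverse:
  assumes F: "approx K F xs" and cont: "isCont F 0" "F 0 \<noteq> 0" and K: "K > 0"
    and inv: "take K (lmul xs ys) = 1 # replicate (K - 1) 0"
  shows "approx K (\<lambda>q. inverse (F q)) ys"
proof -
  have "approx K (\<lambda>q. F q * lp ys q) (take K (lmul xs ys))"
    by (intro approx_take[OF approx_mult order_refl] F approx_lp)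
  then obtain C r where C: "C \<ge> 0" "r > 0" "r \<le> 1"
      "\<And>q. norm q < r \<Longrightarrow> norm (F q * lp ys q - lp (take K (lmul xs ys)) q) \<le> C * norm q ^ K"
    by (elim approxE) blast
  have one: "lp (take K (lmul xs ys)) q = 1" for q unfolding inv by (simp add: lp_replicate_0)
  have "norm (F 0) / 2 > 0" using cont(2) by simp
  then obtain s where s: "s > 0" "\<And>q. dist q 0 < s \<Longrightarrow> dist (F q) (F 0) < norm (F 0) / 2"
    using cont(1) unfolding continuous_at_eps_delta by blast
  show ?thesis
  proof (rule approxI[where r = "min r s" and C = "C / (norm (F 0) / 2)"])
    fix q :: complex assume q: "norm q < min r s"
    have "norm (F 0) - norm (F q) \<le> norm (F 0 - F q)" by (rule norm_triangle_ineq2)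
    hence Fq: "norm (F q) \<ge> norm (F 0) / 2" using s(2)[of q] q by (simp add: dist_norm norm_minus_commute)
    hence nz: "F q \<noteq> 0" using cont(2) by auto
    have "inverse (F q) - lp ys q = - ((F q * lp ys q - 1) / F q)" using nz by (simp add: field_simps)
    hence "norm (inverse (F q) - lp ys q) = norm (F q * lp ys q - 1) / norm (F q)" by (simp add: norm_divide)
    also have "\<dots> \<le> (C * norm q ^ K) / (norm (F 0) / 2)"
      using C(1) C(4)[of q] q Fq cont(2) unfolding one by (intro frac_le) auto
    finally show "norm (inverse (F q) - lp ys q) \<le> C / (norm (F 0) / 2) * norm q ^ K" by (simp add: mult_ac)
  qed (use C s in auto)
qed

lemma approx_zero_imp_bound:
  assumes "approx K F xs" "\<forall>x\<in>set (take K xs). x = 0"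
  obtains C r where "r > 0" "\<And>q. norm q < r \<Longrightarrow> norm (F q) \<le> C * norm q ^ K"
proof -
  have "approx K F (take K xs)" by (rule approx_take[OF assms(1) order_refl])
  moreover have "lp ys q = 0" if "\<forall>x\<in>set ys. x = 0" for ys q using that by (induction ys) auto
  ultimately show ?thesis using that assms(2) unfolding approx_def by auto
qed

section \<open>The expansions of the Euler product and of \<open>E\<^sub>4\<close>\<close>

text \<open>Multiplication by \<open>1 - q^(n + 1)\<close> is a shift followed by a
  subtraction.\<close>

fun euler_list :: "nat \<Rightarrow> nat \<Rightarrow> int list" where
  "euler_list K 0 = [1]"
| "euler_list K (Suc n) = (let xs = euler_list K n in take K (ladd xs (replicate (Suc n) 0 @ map ((*) (-1)) xs)))"

lemma approx_euler_list: "approx K (\<lambda>q. \<Prod>i<n. 1 - q ^ Suc i) (euler_list K n)"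
proof (induction n)
  case 0
  show ?case using approx_const[of K 1] by simp
next
  case (Suc n)
  define xs where "xs = euler_list K n"
  have "approx K (\<lambda>q. (\<Prod>i<n. 1 - q ^ Suc i) * lp (ladd [1] (replicate (Suc n) 0 @ [-1])) q) (lmul xs (ladd [1] (replicate (Suc n) 0 @ [-1])))"
    unfolding xs_def by (intro approx_mult Suc.IH approx_lp)
  hence "approx K (\<lambda>q. (\<Prod>i<n. 1 - q ^ Suc i) * lp (ladd [1] (replicate (Suc n) 0 @ [-1])) q) (ladd xs (replicate (Suc n) 0 @ map ((*) (-1)) xs))"
    by (rule approx_cong_lp) (simp only: lp_lmul lp_ladd lp_append lp_map_mult length_replicate lp_replicate_0 lp.simps, simp add: algebra_simps)
  hence "approx K (\<lambda>q. (\<Prod>i<n. 1 - q ^ Suc i) * lp (ladd [1] (replicate (Suc n) 0 @ [-1])) q) (take K (ladd xs (replicate (Suc n) 0 @ map ((*) (-1)) xs)))"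
    by (rule approx_take) simp
  moreover have "lp (ladd [1] (replicate (Suc n) 0 @ [-1])) q = 1 - q ^ Suc n" for q
    by (simp only: lp_ladd lp_append length_replicate lp_replicate_0 lp.simps) simp
  ultimately show ?case by (simp add: xs_def Let_def)
qed

text \<open>The factors from \<open>K\<close> on have a product that differs from 1 by at most
  \<open>exp s - 1\<close>, where \<open>s\<close> is the sum of their \<open>|q|^(i + 1)\<close>.
  For \<open>|q| \<le> 1/2\<close> this geometric sum is at most \<open>|q|^K\<close>.\<close>

lemma euler_prod_tail:
  assumes "norm q \<le> 1 / 2" "K > 0"
  shows "norm (euler_prod q - (\<Prod>i<K. 1 - q ^ Suc i)) \<le> 4 * norm (\<Prod>i<K. 1 - q ^ Suc i) * norm q ^ K"
proof -
  define A where "A = (\<Prod>i<K. 1 - q ^ Suc i)"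
  have q1: "norm q < 1" using assms(1) by simp
  have lim: "(\<lambda>N. \<Prod>i<N. 1 - q ^ Suc i) \<longlonglongrightarrow> euler_prod q"
    by (rule tendsto_uniform_limitI[OF uniform_limit_euler_prod[of "1/2"]]) (use assms in auto)
  have bnd: "norm ((\<Prod>i<N. 1 - q ^ Suc i) - A) \<le> 4 * norm A * norm q ^ K" if N: "N \<ge> K" for N
  proof -
    have "(\<Prod>i<N. 1 - q ^ Suc i) = A * (\<Prod>i\<in>{K..<N}. 1 - q ^ Suc i)"
      unfolding A_def lessThan_atLeast0 using N by (intro prod.atLeastLessThan_concat[symmetric]) auto
    hence "norm ((\<Prod>i<N. 1 - q ^ Suc i) - A) = norm A * norm ((\<Prod>i\<in>{K..<N}. 1 + (- (q ^ Suc i))) - 1)"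
      by (simp add: norm_mult[symmetric] algebra_simps)
    also have "norm ((\<Prod>i\<in>{K..<N}. 1 + (- (q ^ Suc i))) - 1) \<le> (\<Prod>i\<in>{K..<N}. 1 + norm (- (q ^ Suc i))) - 1"
      by (rule norm_prod_minus1_le_prod_minus1)
    also have "(\<Prod>i\<in>{K..<N}. 1 + norm (- (q ^ Suc i))) \<le> (\<Prod>i\<in>{K..<N}. exp (norm q ^ Suc i))"
      by (intro prod_mono) (auto simp: norm_power norm_mult simp del: power_Suc intro!: add_nonneg_nonneg)
    also have "\<dots> = exp (\<Sum>i\<in>{K..<N}. norm q ^ Suc i)" by (simp add: exp_sum)
    also have "(\<Sum>i\<in>{K..<N}. norm q ^ Suc i) \<le> norm q ^ K"
    proof -
      have "(\<Sum>i\<in>{K..<N}. norm q ^ Suc i) = (\<Sum>i<N - K. norm q ^ Suc K * norm q ^ i)"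
        using sum.shift_bounds_nat_ivl[of "\<lambda>i. norm q ^ Suc i" 0 K "N - K"] N
        by (simp add: lessThan_atLeast0 power_add mult_ac)
      also have "\<dots> = norm q ^ Suc K * (\<Sum>i<N - K. norm q ^ i)" by (rule sum_distrib_left[symmetric])
      also have "(\<Sum>i<N - K. norm q ^ i) \<le> 2"
      proof -
        have "(\<Sum>i<N - K. norm q ^ i) \<le> 1 / (1 - norm q)"
          using q1 by (subst sum_gp_strict) (auto intro!: divide_right_mono)
        also have "\<dots> \<le> 2" using assms(1) by (simp add: field_simps)
        finally show ?thesis .
      qed
      hence "norm q ^ Suc K * (\<Sum>i<N - K. norm q ^ i) \<le> norm q ^ Suc K * 2" by (intro mult_left_mono) auto
      also have "norm q ^ Suc K * 2 = norm q ^ K * (2 * norm q)" by simp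
      also have "\<dots> \<le> norm q ^ K * 1" using assms(1) by (intro mult_left_mono) auto
      finally show ?thesis by simp
    qed
    also have "exp (norm q ^ K) \<le> 1 + 2 * norm q ^ K"
    proof -
      have "norm q ^ K \<le> norm q ^ 1" using assms q1 by (intro power_decreasing) auto
      hence "norm q ^ K \<le> 1/2" using assms(1) by simp
      moreover from this have "norm q ^ K * norm q ^ K \<le> norm q ^ K * 1" by (intro mult_left_mono) auto
      ultimately show ?thesis using exp_bound[of "norm q ^ K"] by (simp add: power2_eq_square)
    qed
    finally have "norm ((\<Prod>i<N. 1 - q ^ Suc i) - A) \<le> norm A * (2 * norm q ^ K)"
      by (simp add: mult_left_mono)
    also have "\<dots> \<le> 4 * norm A * norm q ^ K" by simp
    finally show ?thesis .
  qed
  have "\<forall>\<^sub>F N in sequentially. norm ((\<Prod>i<N. 1 - q ^ Suc i) - A) \<le> 4 * norm A * norm q ^ K"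
    using eventually_ge_at_top[of K] by (rule eventually_mono) (rule bnd)
  moreover have "(\<lambda>N. norm ((\<Prod>i<N. 1 - q ^ Suc i) - A)) \<longlonglongrightarrow> norm (euler_prod q - A)"
    by (intro tendsto_intros lim)
  ultimately show ?thesis unfolding A_def[symmetric] by (intro tendsto_upperbound) auto
qed

lemma approx_euler_prod:
  assumes "K > 0"
  shows "approx K euler_prod (euler_list K K)"
proof -
  obtain C r where C: "C \<ge> 0" "r > 0" "r \<le> 1"
      "\<And>q. norm q < r \<Longrightarrow> norm ((\<Prod>i<K. 1 - q ^ Suc i) - lp (euler_list K K) q) \<le> C * norm q ^ K"
    using approxE[OF approx_euler_list[of K K]] by blast
  define B where "B = (\<Sum>x\<leftarrow>euler_list K K. real_of_int \<bar>x\<bar>)"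
  show ?thesis
  proof (rule approxI[where r = "min r (1/2)" and C = "4 * (B + C) + C"])
    fix q :: complex assume q: "norm q < min r (1/2)"
    have q1: "norm q \<le> 1" using q by simp
    define A where "A = (\<Prod>i<K. 1 - q ^ Suc i)"
    have a: "norm (A - lp (euler_list K K) q) \<le> C * norm q ^ K" unfolding A_def using q by (intro C(4)) simp
    have "C * norm q ^ K \<le> C * 1" using q1 C(1) by (intro mult_left_mono power_le_one) auto
    moreover have "norm (lp (euler_list K K) q) \<le> B" unfolding B_def by (rule norm_lp_le[OF q1])
    moreover have "norm A \<le> norm (lp (euler_list K K) q) + norm (A - lp (euler_list K K) q)"
      using norm_triangle_ineq[of "lp (euler_list K K) q" "A - lp (euler_list K K) q"] by simp
    ultimately have "norm A \<le> B + C" using a by linarith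
    hence "4 * norm A * norm q ^ K \<le> 4 * (B + C) * norm q ^ K" by (intro mult_right_mono) auto
    moreover have "norm (euler_prod q - A) \<le> 4 * norm A * norm q ^ K"
      unfolding A_def using q assms by (intro euler_prod_tail) auto
    ultimately have "norm (euler_prod q - A) \<le> 4 * (B + C) * norm q ^ K" by linarith
    moreover have "norm (euler_prod q - lp (euler_list K K) q) \<le> norm (euler_prod q - A) + norm (A - lp (euler_list K K) q)"
      using norm_triangle_ineq[of "euler_prod q - A" "A - lp (euler_list K K) q"] by simp
    ultimately have "norm (euler_prod q - lp (euler_list K K) q) \<le> 4 * (B + C) * norm q ^ K + C * norm q ^ K" using a by linarith
    thus "norm (euler_prod q - lp (euler_list K K) q) \<le> (4 * (B + C) + C) * norm q ^ K" by (simp only: distrib_right)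
  qed (use C in auto)
qed

lemma lp_map_upt: "lp (map a [0..<K]) q = (\<Sum>n<K. of_int (a n) * q ^ n)"
  by (induction K) (auto simp: lp_append)

text \<open>For \<open>|q| < 1/2\<close> the tail is \<open>q^K\<close> times a series dominated by
  its absolute values at \<open>1/2\<close>, which lies inside the disc of convergence.\<close>

lemma approx_e4q: "approx K e4q (map e4_coeff [0..<K])"
proof -
  define a where "a n = complex_of_int (e4_coeff n)" for n
  define M where "M = (\<Sum>n. norm (a (n + K) * (1/2) ^ n))"
  have "summable (\<lambda>n. norm (a n * (1/2) ^ n))"
  proof (rule powser_insidea)
    show "summable (\<lambda>n. a n * (3/4) ^ n)" unfolding a_def by (rule summable_e4) simp
  qed simp
  hence "summable (\<lambda>n. norm (a (n + K) * (1/2) ^ (n + K)))" by (subst summable_iff_shift)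
  hence "summable (\<lambda>n. 2 ^ K * norm (a (n + K) * (1/2) ^ (n + K)))" by (rule summable_mult)
  hence sM: "summable (\<lambda>n. norm (a (n + K) * (1/2) ^ n))"
    by (simp add: norm_mult norm_power norm_divide power_add power_divide field_simps)
  show ?thesis
  proof (rule approxI[where r = "1/2" and C = M])
    fix q :: complex assume q: "norm q < 1 / 2"
    have sm: "summable (\<lambda>n. a n * q ^ n)" unfolding a_def using q by (intro summable_e4) simp
    have le: "norm (a (n + K) * q ^ n) \<le> norm (a (n + K) * (1/2) ^ n)" for n
      using q by (auto simp: norm_mult norm_power norm_divide intro!: mult_left_mono power_mono)
    have sq: "summable (\<lambda>n. norm (a (n + K) * q ^ n))"
      by (rule summable_comparison_test'[OF sM, of 0]) (use le in simp)
    have "e4q q - lp (map e4_coeff [0..<K]) q = (\<Sum>n. a (n + K) * q ^ (n + K))"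
      unfolding e4q_def lp_map_upt a_def[symmetric] using suminf_minus_initial_segment[OF sm, of K] by simp
    also have "\<dots> = q ^ K * (\<Sum>n. a (n + K) * q ^ n)"
      using suminf_mult[OF summable_norm_cancel[OF sq], of "q ^ K"] by (simp add: power_add mult_ac)
    finally have "norm (e4q q - lp (map e4_coeff [0..<K]) q) = norm q ^ K * norm (\<Sum>n. a (n + K) * q ^ n)"
      by (simp add: norm_mult norm_power)
    moreover have "norm (\<Sum>n. a (n + K) * q ^ n) \<le> (\<Sum>n. norm (a (n + K) * q ^ n))" by (rule summable_norm[OF sq])
    moreover have "(\<Sum>n. norm (a (n + K) * q ^ n)) \<le> M" unfolding M_def by (rule suminf_le[OF le sq sM])
    ultimately show "norm (e4q q - lp (map e4_coeff [0..<K]) q) \<le> M * norm q ^ K"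
      using mult_left_mono[of "norm (\<Sum>n. a (n + K) * q ^ n)" M "norm q ^ K"] by (simp add: mult.commute)
  qed simp
qed

text \<open>The pentagonal number series; the next two lists are the partition numbers and E4.
  Sixteen coefficients cover the highest precision that occurs, \<open>N + 2 = 15\<close> at
  \<open>N = 13\<close>.\<close>

definition euler16 :: "int list" where
  "euler16 = [1, -1, -1, 0, 0, 1, 0, 1, 0, 0, 0, 0, -1, 0, 0, -1]"

definition partitions16 :: "int list" where
  "partitions16 = [1, 1, 2, 3, 5, 7, 11, 15, 22, 30, 42, 56, 77, 101, 135, 176]"

definition eisenstein16 :: "int list" where
  "eisenstein16 = [1, 240, 2160, 6720, 17520, 30240, 60480, 82560, 140400, 181680, 272160,
     319680, 490560, 527520, 743040, 846720]"

lemma approx_euler16: "approx 16 euler_prod euler16"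
proof -
  have "euler_list 16 16 = euler16" unfolding euler16_def by code_simp
  thus ?thesis using approx_euler_prod[of 16] by simp
qed

lemma approx_partitions16: "approx 16 (\<lambda>q. inverse (euler_prod q)) partitions16"
proof (rule approx_inverse[OF approx_euler16])
  show "isCont euler_prod 0" by (rule isCont_0_of_holomorphic[OF holomorphic_euler_prod])
  show "take 16 (lmul euler16 partitions16) = 1 # replicate (16 - 1) 0"
    unfolding euler16_def partitions16_def by code_simp
qed (auto simp: euler_prod_0)

lemma sigma3_conv_filter: "n > 0 \<Longrightarrow> sigma3 n = sum_list (map (\<lambda>d. d ^ 3) (filter (\<lambda>d. d dvd n) [1..<Suc n]))"
proof -
  assume "n > 0"
  hence e: "{d. d dvd n} = set (filter (\<lambda>d. d dvd n) [1..<Suc n])"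
    by (auto dest: dvd_imp_le intro!: Nat.gr0I)
  show ?thesis unfolding sigma3_def e by (rule sum.distinct_set_conv_list) simp
qed

lemma approx_eisenstein16: "approx 16 e4q eisenstein16"
proof -
  have "e4_coeff = (\<lambda>n. if n = 0 then 1 else 240 * int (sum_list (map (\<lambda>d. d ^ 3) (filter (\<lambda>d. d dvd n) [1..<Suc n]))))"
  proof (rule ext)
    fix n
    show "e4_coeff n = (if n = 0 then 1 else 240 * int (sum_list (map (\<lambda>d. d ^ 3) (filter (\<lambda>d. d dvd n) [1..<Suc n]))))"
      using sigma3_conv_filter[of n] by (cases "n = 0") (simp_all only: e4_coeff_def if_True if_False neq0_conv simp_thms)
  qed
  hence "map e4_coeff [0..<16] = map (\<lambda>n. if n = 0 then 1 else 240 * int (sum_list (map (\<lambda>d. d ^ 3) (filter (\<lambda>d. d dvd n) [1..<Suc n])))) [0..<16]"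
    by (simp only:)
  also have "\<dots> = eisenstein16" unfolding eisenstein16_def by code_simp
  finally show ?thesis using approx_e4q[of 16] by simp
qed

section \<open>Computed expansions of the Hauptmoduln and of \<open>q j\<close>\<close>

definition eta_list :: "nat \<Rightarrow> nat \<Rightarrow> int \<Rightarrow> int list" where
  "eta_list K m r = lpow K (nat \<bar>r\<bar>) (take K (lstretch m (if r \<ge> 0 then euler16 else partitions16)))"

fun epq_list :: "nat \<Rightarrow> (nat \<times> int) list \<Rightarrow> int list" where
  "epq_list K [] = [1]"
| "epq_list K ((m, r) # rs) = take K (lmul (eta_list K m r) (epq_list K rs))"

definition jq_list :: "nat \<Rightarrow> int list" where
  "jq_list K = take K (lmul (lpow K 3 (take K eisenstein16)) (lpow K 24 (take K partitions16)))"

definition hauptmodul_list :: "nat \<Rightarrow> nat \<Rightarrow> int list" where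
  "hauptmodul_list K N = take K (map ((*) (kappa N)) (0 # epq_list K (eta_exps N)))"

text \<open>A negative power is a positive power of the partition series, so no list is ever
  divided.\<close>

lemma approx_eta_list:
  assumes "K \<le> 16" "m > 0"
  shows "approx K (\<lambda>q. euler_prod (q ^ m) powi r) (eta_list K m r)"
proof (cases "r \<ge> 0")
  case True
  hence "(\<lambda>q. euler_prod (q ^ m) powi r) = (\<lambda>q. euler_prod (q ^ m) ^ nat \<bar>r\<bar>)"
    by (simp add: power_int_def)
  moreover have "approx K (\<lambda>q. euler_prod (q ^ m) ^ nat \<bar>r\<bar>) (eta_list K m r)"
    unfolding eta_list_def using True
    by (simp only: if_True) (intro approx_power approx_take[OF _ assms(1)] approx_compose_power approx_euler16 assms(2))
  ultimately show ?thesis by simp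
next
  case False
  hence "(\<lambda>q. euler_prod (q ^ m) powi r) = (\<lambda>q. inverse (euler_prod (q ^ m)) ^ nat \<bar>r\<bar>)"
    by (simp add: power_int_def)
  moreover have "approx K (\<lambda>q. inverse (euler_prod (q ^ m)) ^ nat \<bar>r\<bar>) (eta_list K m r)"
    unfolding eta_list_def using False
    by (simp only: if_False) (intro approx_power approx_take[OF _ assms(1)]
        approx_compose_power[where F = "\<lambda>q. inverse (euler_prod q)"] approx_partitions16 assms(2))
  ultimately show ?thesis by simp
qed

lemma approx_epq_list:
  assumes "K \<le> 16" "\<forall>(m, r)\<in>set rs. m > 0"
  shows "approx K (epq rs) (epq_list K rs)"
  using assms(2)
proof (induction rs)
  case Nil
  thus ?case using approx_const[of K 1] by (simp add: epq_def[abs_def])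
next
  case (Cons x rs)
  obtain m r where x: "x = (m, r)" by (cases x)
  have "approx K (\<lambda>q. euler_prod (q ^ m) powi r * epq rs q) (take K (lmul (eta_list K m r) (epq_list K rs)))"
    using Cons by (intro approx_take[OF approx_mult order_refl] approx_eta_list[OF assms(1)]) (auto simp: x)
  moreover have "epq (x # rs) = (\<lambda>q. euler_prod (q ^ m) powi r * epq rs q)"
    by (auto simp: epq_def x)
  ultimately show ?case by (simp add: x)
qed

lemma approx_jq_list: "K \<le> 16 \<Longrightarrow> approx K jq (jq_list K)"
proof -
  assume K: "K \<le> 16"
  have "approx K (\<lambda>q. e4q q ^ 3 * inverse (euler_prod q) ^ 24) (jq_list K)"
    unfolding jq_list_def
    by (intro approx_take[OF approx_mult order_refl] approx_power approx_take[OF approx_eisenstein16 K]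
        approx_take[OF approx_partitions16 K])
  moreover have "jq = (\<lambda>q. e4q q ^ 3 * inverse (euler_prod q) ^ 24)"
    by (simp add: jq_def fun_eq_iff divide_inverse power_inverse)
  ultimately show ?thesis by simp
qed

lemma approx_hauptmodul_list:
  assumes "K \<le> 16" "N \<in> levels"
  shows "approx K (hauptmodul_q N) (hauptmodul_list K N)"
  unfolding hauptmodul_list_def hauptmodul_q_def[abs_def]
  by (intro approx_take[OF _ order_refl] approx_cmult approx_q_mult approx_epq_list assms eta_exps_pos)

section \<open>Modular equations\<close>

text \<open>The factor \<open>length bs - 1\<close> is the formal degree; natural subtraction makes
  it 0 for the empty list too. With \<open>w \<ge> 0\<close> the leading term governs the
  growth.\<close>

lemma growth_lp:
  assumes "growth f w" "w \<ge> 0"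
  shows "growth (\<lambda>\<tau>. lp bs (f \<tau>)) (real (length bs - 1) * w)"
proof (induction bs)
  case Nil
  show ?case using growth_const[of 0 0] by simp
next
  case (Cons b bs)
  show ?case
  proof (cases bs)
    case Nil
    thus ?thesis using growth_const[of 0 "of_int b"] by simp
  next
    case (Cons b' bs')
    have "growth (\<lambda>\<tau>. f \<tau> * lp bs (f \<tau>)) (w + real (length bs - 1) * w)"
      by (intro growth_mult assms Cons.IH)
    hence "growth (\<lambda>\<tau>. of_int b + f \<tau> * lp bs (f \<tau>)) (w + real (length bs - 1) * w)"
      using assms(2) by (intro growth_add growth_const) auto
    thus ?thesis using Cons by (simp add: algebra_simps)
  qed
qed

lemma holomorphic_lp [holomorphic_intros]: "f holomorphic_on A \<Longrightarrow> (\<lambda>z. lp bs (f z)) holomorphic_on A"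
  by (induction bs) (auto intro!: holomorphic_intros)

text \<open>\<open>24N\<close> times the order of the pole of \<open>t\<^sub>M\<close> at the cusps of denominator \<open>d\<close>, where \<open>M\<close>
  divides \<open>N\<close>; it is 0 if there is no pole.\<close>

definition pole_order :: "nat \<Rightarrow> nat \<Rightarrow> nat \<Rightarrow> int" where
  "pole_order N M d = max 0 (- (\<Sum>(m, r)\<leftarrow>eta_exps M. r * (gcd (int m) (int d))\<^sup>2 * int (N div m)))"

text \<open>Clearing the denominators leaves integers that can be evaluated by computation. The
  clipping at 0 only weakens the bound and supplies the nonnegative order that
  \<open>growth_lp\<close> requires.\<close>

lemma growth_hauptmodul_pole_order:
  assumes "M \<in> levels" "M dvd N" "N > 0" "a * d - b * c = 1"
  shows "growth (\<lambda>\<tau>. hauptmodul M (mob a b c d \<tau>))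
           (of_int (pole_order N M (nat (gcd c (int N)))) / (24 * real N))"
proof -
  define e where "e = nat (gcd c (int N))"
  have e: "gcd c (int N) = int e" by (simp add: e_def)
  have dv: "\<forall>(m, r)\<in>set (eta_exps M). m > 0 \<and> m dvd N"
    using eta_exps_props(1)[OF assms(1)] dvd_trans[OF _ assms(2)] by blast
  have ord: "- etaq_order (eta_exps M) c = - etaq_order (eta_exps M) (int e)"
  proof -
    have "\<forall>(m, r)\<in>set (eta_exps M). m dvd N" using dv by blast
    from etaq_order_gcd[OF this, of c] show ?thesis unfolding e by (rule arg_cong)
  qed
  have "(\<Sum>(m, r)\<leftarrow>rs. of_int r * (of_int (gcd (int m) (int e)))\<^sup>2 / (24 * real m))
      = of_int (\<Sum>(m, r)\<leftarrow>rs. r * (gcd (int m) (int e))\<^sup>2 * int (N div m)) / (24 * real N)"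
    if "\<forall>(m, r)\<in>set rs. m > 0 \<and> m dvd N" for rs
    using that
  proof (induction rs)
    case (Cons x rs)
    obtain m r where x: "x = (m, r)" by (cases x)
    have m: "m > 0" "m dvd N" using Cons.prems by (auto simp: x)
    then obtain k where k: "N = m * k" by blast
    define g where "g = gcd (int m) (int e)"
    have Nm: "N div m = k" "real N = real m * real k" "real k \<noteq> 0" using m assms(3) by (auto simp: k)
    have "of_int r * (of_int g)\<^sup>2 / (24 * real m) = of_int (r * g\<^sup>2 * int (N div m)) / (24 * real N)"
      unfolding Nm(1,2) using Nm(3) by simp
    moreover have "(\<Sum>(m, r)\<leftarrow>rs. of_int r * (of_int (gcd (int m) (int e)))\<^sup>2 / (24 * real m))
      = of_int (\<Sum>(m, r)\<leftarrow>rs. r * (gcd (int m) (int e))\<^sup>2 * int (N div m)) / (24 * real N)"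
      using Cons.prems by (intro Cons.IH) auto
    ultimately show ?case
      unfolding x list.map sum_list.Cons prod.case g_def of_int_add add_divide_distrib by (rule arg_cong2)
  qed simp
  from this[OF dv] have "etaq_order (eta_exps M) (int e) =
      of_int (\<Sum>(m, r)\<leftarrow>eta_exps M. r * (gcd (int m) (int e))\<^sup>2 * int (N div m)) / (24 * real N)"
    unfolding etaq_order_def .
  moreover have "- (of_int S / (24 * real N)) \<le> of_int (max 0 (- S)) / (24 * real N)" for S :: int
    unfolding minus_divide_left by (intro divide_right_mono) auto
  ultimately have "- etaq_order (eta_exps M) c \<le> of_int (pole_order N M e) / (24 * real N)"
    unfolding ord pole_order_def by (simp only:)
  with growth_hauptmodul[OF assms(1,4)] show ?thesis unfolding e_def by (rule growth_mono)
qed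

text \<open>In units of \<open>1/(24 N)\<close>, the value 24 says that \<open>t_N\<close> has a
  pole of order \<open>1/N\<close> in the nome at each of the \<open>N\<close> cosets with
  \<open>gcd c N = 1\<close>. With a polynomial of degree at most \<open>N + 1\<close>, all poles
  together count at most \<open>N (1 + 1/N) = N + 1\<close>, one less than \<open>K\<close>.\<close>

definition j_equation_check :: "nat \<Rightarrow> int list \<Rightarrow> bool" where
  "j_equation_check N bs \<longleftrightarrow> (let K = N + 2 in K \<le> 16 \<and> length bs \<le> N + 2 \<and> pole_order N N 1 = 24 \<and>
     list_all (\<lambda>x. x = 0) (take K (ladd (lmul (map ((*) (kappa N)) (epq_list K (eta_exps N))) (jq_list K))
       (map ((*) (-1)) (lcomp K bs (hauptmodul_list K N))))))"

text \<open>At a prime level there is one cusp besides \<i>\<infinity>. There \<open>t_N j\<close>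
  has a pole of order at most \<open>1/N + 1\<close>, and the polynomial in \<open>t_N\<close> one
  of order at most \<open>(N + 1)/N\<close>, which is the same bound.\<close>

lemma j_equation:
  assumes N: "N \<in> levels" "\<And>d. d dvd N \<Longrightarrow> d = 1 \<or> d = N"
    and inv: "\<And>a b c d \<tau>. Im \<tau> > 0 \<Longrightarrow> a * d - b * c = 1 \<Longrightarrow> int N dvd c \<Longrightarrow>
           hauptmodul N (mob a b c d \<tau>) = hauptmodul N \<tau>"
    and jinv: "\<And>a b c d \<tau>. Im \<tau> > 0 \<Longrightarrow> a * d - b * c = 1 \<Longrightarrow> elliptic_j (mob a b c d \<tau>) = elliptic_j \<tau>"
    and check: "j_equation_check N bs"
    and \<tau>: "Im \<tau> > 0"
  shows "hauptmodul N \<tau> * elliptic_j \<tau> = lp bs (hauptmodul N \<tau>)"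
proof -
  define K where "K = N + 2"
  have chk: "K \<le> 16" "length bs \<le> N + 2" "pole_order N N 1 = 24"
     "\<forall>x\<in>set (take K (ladd (lmul (map ((*) (kappa N)) (epq_list K (eta_exps N))) (jq_list K))
       (map ((*) (-1)) (lcomp K bs (hauptmodul_list K N))))). x = 0"
    using check unfolding j_equation_check_def Let_def K_def[symmetric] list_all_iff by auto
  define f where "f \<tau> = hauptmodul N \<tau> * elliptic_j \<tau> - lp bs (hauptmodul N \<tau>)" for \<tau>
  have N1: "N > 1" by (rule eta_exps_props(5)[OF N(1)])
  have "f \<tau> = 0"
  proof (rule Gamma0_vanishing[where f = f and \<tau> = \<tau> and N = N and K = K and p = 0 and w = "\<lambda>_. 1 + 1 / real N", OF _ N1])
    show "f holomorphic_on {\<tau>. Im \<tau> > 0}"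
      unfolding f_def by (intro holomorphic_intros holomorphic_hauptmodul holomorphic_elliptic_j N(1))
    show "f (mob a b c d \<tau>) = f \<tau>" if "Im \<tau> > 0" "a * d - b * c = 1" "int N dvd c" for a b c d \<tau>
      by (simp only: f_def inv[OF that] jinv[OF that(1,2)])
    show "growth f (- real K)"
    proof -
      define F where "F q = of_int (kappa N) * epq (eta_exps N) q * jq q + of_int (-1) * lp bs (hauptmodul_q N q)" for q
      have F: "approx K F (ladd (lmul (map ((*) (kappa N)) (epq_list K (eta_exps N))) (jq_list K))
         (map ((*) (-1)) (lcomp K bs (hauptmodul_list K N))))"
        unfolding F_def
        by (intro approx_add approx_mult approx_cmult approx_epq_list approx_jq_list approx_lcomp
            approx_hauptmodul_list chk(1) N(1) eta_exps_pos)
      have "continuous_on (ball 0 1) F"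
        unfolding F_def
        by (intro holomorphic_on_imp_continuous_on holomorphic_intros holomorphic_epq holomorphic_jq
            holomorphic_hauptmodul_q N(1) eta_exps_pos)
      moreover obtain C r where "r > 0" "\<And>q. norm q < r \<Longrightarrow> norm (F q) \<le> C * norm q ^ K"
        using approx_zero_imp_bound[OF F chk(4)] by blast
      ultimately have "growth (\<lambda>\<tau>. F (nome \<tau>)) (- real K)" by (rule growth_nome)
      moreover have "F (nome \<tau>) = f \<tau>" if "Im \<tau> > 0" for \<tau>
        using that by (simp add: F_def f_def hauptmodul_conv_q[OF N(1)] elliptic_j_conv_jq) (simp add: hauptmodul_q_def)
      ultimately show ?thesis using growth_cong[of "\<lambda>\<tau>. F (nome \<tau>)" f] by blast
    qed
    show "growth (\<lambda>\<tau>. f (mob a b c d \<tau>)) (1 + 1 / real N)"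
      if det: "a * d - b * c = 1" and c: "\<not> int N dvd c" for a b c d
    proof -
      define e where "e = nat (gcd c (int N))"
      have "int e dvd int N" by (simp add: e_def)
      moreover have "e \<noteq> N" using c by (metis e_def gcd_dvd1 gcd_ge_0_int int_nat_eq)
      ultimately have e: "e = 1" using N(2)[of e] by simp
      have g: "growth (\<lambda>\<tau>. hauptmodul N (mob a b c d \<tau>)) (1 / real N)"
        using growth_hauptmodul_pole_order[OF N(1) dvd_refl _ det] N1 chk(3) e unfolding e_def by simp
      have "growth (\<lambda>\<tau>. elliptic_j (mob a b c d \<tau>)) 1"
        using growth_elliptic_j growth_cong[of "\<lambda>\<tau>. elliptic_j (mob a b c d \<tau>)" elliptic_j] jinv[OF _ det] by blast
      hence 1: "growth (\<lambda>\<tau>. hauptmodul N (mob a b c d \<tau>) * elliptic_j (mob a b c d \<tau>)) (1 + 1 / real N)"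
        using growth_mult[OF g] by (simp add: add.commute)
      have "real (length bs - 1) * (1 / real N) \<le> real (N + 1) * (1 / real N)"
        using chk(2) by (intro mult_right_mono) auto
      also have "\<dots> = 1 + 1 / real N" using N1 by (simp add: field_simps)
      finally have "growth (\<lambda>\<tau>. lp bs (hauptmodul N (mob a b c d \<tau>))) (1 + 1 / real N)"
        by (intro growth_mono[OF growth_lp[OF g]]) auto
      with 1 show ?thesis unfolding f_def by (rule growth_diff)
    qed
    \<comment> \<open>There are no intermediate divisors, so the claim is vacuous.\<close>
    show "1 + 1 / real N \<le> 0" if "d dvd N" "d \<noteq> 1" "d \<noteq> N" for d
      using N(2)[OF that(1)] that by auto
    show "real N * (1 + 1 / real N) + real 0 * (1 + 1 / real N) < real K"
      using N1 by (simp add: K_def field_simps)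
  qed (use \<tau> in auto)
  thus ?thesis by (simp add: f_def)
qed

text \<open>In units of \<open>1/(24 N)\<close>, a bound for the pole of
  \<open>t_M A(t_N) - B(t_N)\<close> at the cusps of denominator \<open>d\<close>.\<close>

definition total_pole :: "nat \<Rightarrow> nat \<Rightarrow> int list \<Rightarrow> int list \<Rightarrow> nat \<Rightarrow> int" where
  "total_pole N M as bs d = max (pole_order N M d + int (length as - 1) * pole_order N N d)
     (int (length bs - 1) * pole_order N N d)"

text \<open>The pole bounds are multiplied by the number of cosets: \<open>N\<close> of them with
  denominator 1 and, for positive \<open>p\<close>, another \<open>p\<close> with denominator 2. All
  other intermediate denominators must be free of poles.\<close>

definition t_equation_check :: "nat \<Rightarrow> nat \<Rightarrow> int list \<Rightarrow> int list \<Rightarrow> nat \<Rightarrow> nat \<Rightarrow> bool" where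
  "t_equation_check N M as bs p K \<longleftrightarrow> K \<le> 16 \<and> M dvd N \<and> (p > 0 \<longrightarrow> N = 2 * p \<and> odd p \<and> p > 1) \<and>
     list_all (\<lambda>d. d dvd N \<longrightarrow> (p > 0 \<and> d = 2) \<or> total_pole N M as bs d \<le> 0) [2..<N] \<and>
     int N * total_pole N M as bs 1 + int p * total_pole N M as bs 2 < 24 * int N * int K \<and>
     list_all (\<lambda>x. x = 0) (take K (ladd (lmul (hauptmodul_list K M) (lcomp K as (hauptmodul_list K N)))
       (map ((*) (-1)) (lcomp K bs (hauptmodul_list K N)))))"

text \<open>Since \<open>M\<close> divides \<open>N\<close>, \<open>t_M\<close> is invariant under
  the congruence subgroup of level \<open>N\<close> as well, and the vanishing criterion applies to
  the difference of the two sides.\<close>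

lemma t_equation:
  assumes N: "N \<in> levels" "M \<in> levels"
    and inv: "\<And>N a b c d \<tau>. N \<in> levels \<Longrightarrow> Im \<tau> > 0 \<Longrightarrow> a * d - b * c = 1 \<Longrightarrow> int N dvd c \<Longrightarrow>
           hauptmodul N (mob a b c d \<tau>) = hauptmodul N \<tau>"
    and check: "t_equation_check N M as bs p K"
    and \<tau>: "Im \<tau> > 0"
  shows "hauptmodul M \<tau> * lp as (hauptmodul N \<tau>) = lp bs (hauptmodul N \<tau>)"
proof -
  note c = check[unfolded t_equation_check_def list_all_iff set_upt]
  note chk = c[THEN conjunct1] c[THEN conjunct2, THEN conjunct1] c[THEN conjunct2, THEN conjunct2, THEN conjunct1]
    c[THEN conjunct2, THEN conjunct2, THEN conjunct2, THEN conjunct1]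
    c[THEN conjunct2, THEN conjunct2, THEN conjunct2, THEN conjunct2, THEN conjunct1]
    c[THEN conjunct2, THEN conjunct2, THEN conjunct2, THEN conjunct2, THEN conjunct2]
  define f where "f \<tau> = hauptmodul M \<tau> * lp as (hauptmodul N \<tau>) - lp bs (hauptmodul N \<tau>)" for \<tau>
  have N1: "N > 1" by (rule eta_exps_props(5)[OF N(1)])
  define w where "w d = of_int (total_pole N M as bs (nat d)) / (24 * real N)" for d :: int
  have pole0: "pole_order N M' d \<ge> 0" for M' d by (simp add: pole_order_def)
  have total0: "total_pole N M as bs d \<ge> 0" for d
    using pole0 by (simp add: total_pole_def le_max_iff_disj)
  have "f \<tau> = 0"
  proof (rule Gamma0_vanishing[where f = f and \<tau> = \<tau> and N = N and K = K and p = p and w = w, OF _ N1])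
    show "f holomorphic_on {\<tau>. Im \<tau> > 0}"
      unfolding f_def by (intro holomorphic_intros holomorphic_hauptmodul N)
    show "f (mob a b c d \<tau>) = f \<tau>" if "Im \<tau> > 0" "a * d - b * c = 1" "int N dvd c" for a b c d \<tau>
    proof -
      have "int M dvd int N" using chk(2) by simp
      hence "int M dvd c" using that(3) by (rule dvd_trans)
      thus ?thesis by (simp only: f_def inv[OF N(1) that] inv[OF N(2) that(1,2)])
    qed
    show "growth f (- real K)"
    proof -
      define F where "F q = hauptmodul_q M q * lp as (hauptmodul_q N q) + of_int (-1) * lp bs (hauptmodul_q N q)" for q
      have F: "approx K F (ladd (lmul (hauptmodul_list K M) (lcomp K as (hauptmodul_list K N)))
         (map ((*) (-1)) (lcomp K bs (hauptmodul_list K N))))"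
        unfolding F_def
        by (intro approx_add approx_mult approx_cmult approx_lcomp approx_hauptmodul_list chk(1) N)
      have "continuous_on (ball 0 1) F"
        unfolding F_def
        by (intro holomorphic_on_imp_continuous_on holomorphic_intros holomorphic_hauptmodul_q N)
      moreover obtain C r where "r > 0" "\<And>q. norm q < r \<Longrightarrow> norm (F q) \<le> C * norm q ^ K"
        using approx_zero_imp_bound[OF F chk(6)] by blast
      ultimately have "growth (\<lambda>\<tau>. F (nome \<tau>)) (- real K)" by (rule growth_nome)
      moreover have "F (nome \<tau>) = f \<tau>" for \<tau>
        by (simp add: F_def f_def hauptmodul_conv_q N)
      ultimately show ?thesis by simp
    qed
    show "growth (\<lambda>\<tau>. f (mob a b c d \<tau>)) (w (gcd c (int N)))"
      if det: "a * d - b * c = 1" and c: "\<not> int N dvd c" for a b c d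
    proof -
      define e where "e = nat (gcd c (int N))"
      define v where "v M' = of_int (pole_order N M' e) / (24 * real N)" for M'
      have v0: "v M' \<ge> 0" for M' using pole0 by (simp add: v_def)
      have g: "growth (\<lambda>\<tau>. hauptmodul M (mob a b c d \<tau>)) (v M)" "growth (\<lambda>\<tau>. hauptmodul N (mob a b c d \<tau>)) (v N)"
        using growth_hauptmodul_pole_order[OF N(1) dvd_refl _ det] growth_hauptmodul_pole_order[OF N(2) chk(2) _ det] N1
        unfolding e_def v_def by simp_all
      have "real_of_int (pole_order N M e + int (length as - 1) * pole_order N N e) \<le> of_int (total_pole N M as bs e)"
           "real_of_int (int (length bs - 1) * pole_order N N e) \<le> of_int (total_pole N M as bs e)"
        unfolding total_pole_def of_int_le_iff by auto
      moreover have "v M + real (length as - 1) * v N =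
          of_int (pole_order N M e + int (length as - 1) * pole_order N N e) / (24 * real N)"
        unfolding v_def by (simp add: add_divide_distrib)
      moreover have "real (length bs - 1) * v N = of_int (int (length bs - 1) * pole_order N N e) / (24 * real N)"
        unfolding v_def by simp
      ultimately have le: "v M + real (length as - 1) * v N \<le> w (int e)" "real (length bs - 1) * v N \<le> w (int e)"
        unfolding w_def nat_int by (simp_all only: divide_right_mono mult_nonneg_nonneg of_nat_0_le_iff zero_le_numeral)
      have "growth (\<lambda>\<tau>. f (mob a b c d \<tau>)) (w (int e))"
        unfolding f_def
        by (rule growth_diff[OF growth_mono[OF growth_mult[OF g(1) growth_lp[OF g(2) v0]] le(1)]
              growth_mono[OF growth_lp[OF g(2) v0] le(2)]])
      thus ?thesis by (simp add: e_def)
    qed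
    show "w 1 \<ge> 0" using total0 by (simp add: w_def)
    show "w 2 \<ge> 0 \<and> N = 2 * p \<and> odd p \<and> p > 1" if "p > 0"
      using that chk(3) total0 by (simp add: w_def)
    show "w (int d) \<le> 0" if "d dvd N" "d \<noteq> 1" "d \<noteq> N" "p > 0 \<longrightarrow> d \<noteq> 2" for d
    proof -
      have "d \<noteq> 0" using that(1) N1 by (intro notI) simp
      moreover have "d \<le> N" using that(1) N1 by (intro dvd_imp_le) auto
      ultimately have "d \<in> {2..<N}" using that by auto
      hence "total_pole N M as bs d \<le> 0" using chk(4) that by blast
      thus ?thesis using N1 by (simp add: w_def divide_nonpos_pos)
    qed
    show "real N * w 1 + real p * w 2 < real K"
    proof -
      have "real_of_int (int N * total_pole N M as bs 1 + int p * total_pole N M as bs 2) < of_int (24 * int N * int K)"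
        using chk(5) by (simp only: of_int_less_iff)
      thus ?thesis using N1 unfolding w_def by (simp add: field_simps)
    qed
  qed (use \<tau> in auto)
  thus ?thesis by (simp add: f_def)
qed

definition lcube :: "int list \<Rightarrow> int list" where
  "lcube xs = lmul xs (lmul xs xs)"

lemma lp_lcube: "lp (lcube xs) q = lp xs q ^ 3"
  by (simp add: lcube_def lp_lmul power3_eq_cube mult.assoc)

text \<open>The last argument is always the total pole count plus one. In the first seven cases
  \<open>t_M\<close> is a polynomial in \<open>t_N\<close>. In the last two, \<open>t_3\<close> and
  \<open>t_5\<close> have poles at the cusps of denominator 2, where \<open>t_6\<close> and
  \<open>t_10\<close> are finite with the values -8 and -4; hence the left factors and the positive
  \<open>p\<close>.\<close>

lemma t_checks:
  "t_equation_check 4 2 [1] [0, 16, 1] 0 3"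
  "t_equation_check 8 4 [1] [0, 8, 1] 0 3"
  "t_equation_check 16 8 [1] [0, 4, 1] 0 3"
  "t_equation_check 9 3 [1] [0, 27, 9, 1] 0 4"
  "t_equation_check 25 5 [1] [0, 25, 25, 15, 5, 1] 0 6"
  "t_equation_check 12 6 [1] [0, 6, 1] 0 3"
  "t_equation_check 18 6 [1] [0, 12, 6, 1] 0 4"
  "t_equation_check 6 3 [8, 1] [0, 81, 18, 1] 3 5"
  "t_equation_check 10 5 [4, 1] [0, 25, 10, 1] 5 5"
  by code_simp+

lemma j_checks:
  "j_equation_check 2 (lcube [16, 1])"
  "j_equation_check 3 (lmul [27, 1] (lcube [3, 1]))"
  "j_equation_check 5 (lcube [5, 10, 1])"
  "j_equation_check 7 (lmul [49, 13, 1] (lcube [1, 5, 1]))"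
  by code_simp+

lemma j_check_13: "j_equation_check 13 (lmul [13, 5, 1] (lcube [1, 19, 20, 7, 1]))"
  by code_simp

section \<open>The functions \<open>h\<^sub>N\<close>\<close>

lemma complex_poly_has_root:
  fixes p :: "complex poly"
  assumes "degree p > 0"
  shows "\<exists>z. poly p z = 0"
proof -
  have "coeff p 0 = 0 \<or> (\<exists>i\<in>{1..degree p}. coeff p i \<noteq> 0)"
    using assms by (intro disjI2 bexI[of _ "degree p"]) auto
  from fundamental_theorem_of_algebra[OF this] show ?thesis by (metis poly_altdef)
qed

text \<open>Euclid's lemma, proved by splitting off the roots of \<open>p\<close> one by one: each
  is a root of \<open>r * q\<close> but not of \<open>q\<close>, hence one of
  \<open>r\<close>.\<close>

lemma dvd_mult_no_common_root:
  fixes p q r :: "complex poly"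
  assumes "p \<noteq> 0" "\<And>x. poly p x = 0 \<Longrightarrow> poly q x \<noteq> 0" "p dvd r * q"
  shows "p dvd r"
  using assms
proof (induction "degree p" arbitrary: p r)
  case 0
  then obtain c where "p = [:c:]" by (metis degree_eq_zeroE)
  hence "is_unit p" using 0 by (simp add: is_unit_iff_degree)
  thus ?case by (rule unit_imp_dvd)
next
  case (Suc n)
  obtain a where a: "poly p a = 0" using complex_poly_has_root[of p] Suc.hyps(2) by auto
  then obtain p' where p': "p = [:- a, 1:] * p'" by (auto simp: poly_eq_0_iff_dvd elim: dvdE)
  obtain k where k: "r * q = p * k" using Suc.prems(3) by (rule dvdE)
  have "poly (r * q) a = 0" unfolding k using a by simp
  hence "poly r a = 0" using Suc.prems(2)[OF a] by simp
  then obtain r' where r': "r = [:- a, 1:] * r'" by (auto simp: poly_eq_0_iff_dvd elim: dvdE)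
  have "p' \<noteq> 0" using Suc.prems(1) p' by auto
  have "degree p = Suc (degree p')" unfolding p' using \<open>p' \<noteq> 0\<close> by (subst degree_mult_eq) auto
  hence "n = degree p'" using Suc.hyps(2) by simp
  moreover have "poly q x \<noteq> 0" if "poly p' x = 0" for x using Suc.prems(2)[of x] that by (simp add: p')
  moreover have "p' dvd r' * q"
  proof -
    have "[:- a, 1:] * p' dvd [:- a, 1:] * (r' * q)" using Suc.prems(3) by (simp only: p' r' mult.assoc)
    thus ?thesis by (subst (asm) dvd_mult_cancel_left) auto
  qed
  ultimately have "p' dvd r'" using Suc.hyps(1)[OF _ \<open>p' \<noteq> 0\<close>] by blast
  thus ?case unfolding p' r' by (rule mult_dvd_mono[OF dvd_refl])
qed

lemma coprime_poly_no_common_root: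
  fixes p q :: "complex poly"
  assumes "coprime p q" "poly p x = 0"
  shows "poly q x \<noteq> 0"
proof
  assume "poly q x = 0"
  hence "[:- x, 1:] dvd p" "[:- x, 1:] dvd q" using assms(2) by (simp_all add: poly_eq_0_iff_dvd)
  with assms(1) have "is_unit [:- x, 1:]" by (rule coprime_common_divisor)
  thus False by (simp add: is_unit_poly_iff)
qed

text \<open>A common divisor has no roots and is constant by the fundamental theorem of
  algebra.\<close>

lemma coprime_poly_complexI:
  fixes p q :: "complex poly"
  assumes "\<And>x. poly p x = 0 \<Longrightarrow> poly q x \<noteq> 0"
  shows "coprime p q"
proof (rule coprimeI)
  fix l assume l: "l dvd p" "l dvd q"
  have nr: "poly l x \<noteq> 0" for x
    using assms[of x] l by (auto elim!: dvdE)
  hence "degree l = 0" using complex_poly_has_root[of l] by blast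
  moreover have "l \<noteq> 0" using nr[of 0] by auto
  ultimately show "is_unit l" by (simp add: is_unit_iff_degree)
qed

text \<open>Nonzero values that tend to 0 along the imaginary axis cannot form a finite set.\<close>

lemma hauptmodul_range_infinite:
  assumes N: "N \<in> levels"
  shows "infinite (hauptmodul N ` {\<tau>. Im \<tau> > 0})"
proof
  define S where "S = hauptmodul N ` {\<tau>. Im \<tau> > 0}"
  assume "finite (hauptmodul N ` {\<tau>. Im \<tau> > 0})"
  hence "finite S" by (simp add: S_def)
  moreover have "0 \<notin> S" using hauptmodul_nonzero[OF N] by (auto simp: S_def)
  ultimately obtain e where e: "e > 0" "\<And>x. x \<in> S \<Longrightarrow> e \<le> dist 0 x"
    using finite_set_avoid[of S 0] by metis
  have "\<forall>\<^sub>F y in at_top. dist (hauptmodul N (\<i> * of_real y)) 0 < e"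
    by (rule tendstoD[OF hauptmodul_tendsto_0[OF N] e(1)])
  moreover have "\<forall>\<^sub>F y in at_top. (0::real) < y" by (rule eventually_gt_at_top)
  ultimately have "\<forall>\<^sub>F y::real in at_top. False"
  proof eventually_elim
    case (elim y)
    hence "hauptmodul N (\<i> * of_real y) \<in> S" by (auto simp: S_def)
    from e(2)[OF this] elim show ?case by (simp add: dist_commute)
  qed
  thus False by simp
qed

text \<open>Cross multiplication yields \<open>P Q0 = P0 Q\<close> at infinitely many points, so as
  polynomials. Coprimality makes the two pairs proportional, and \<open>h_fun\<close> involves only
  \<open>P t/P 0\<close> and \<open>Q t/P t\<close>, in which a common factor cancels.\<close>

lemma h_fun_unique:
  assumes N: "N \<in> levels" and cop: "coprime P Q" "coprime P0 Q0"
    and j: "\<And>\<tau>. Im \<tau> > 0 \<Longrightarrow> elliptic_j \<tau> = poly P (hauptmodul N \<tau>) / poly Q (hauptmodul N \<tau>)"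
    and rel: "\<And>\<tau>. Im \<tau> > 0 \<Longrightarrow> poly Q0 (hauptmodul N \<tau>) * elliptic_j \<tau> = poly P0 (hauptmodul N \<tau>)"
  shows "h_fun P Q t = h_fun P0 Q0 t"
proof -
  \<comment> \<open>This excludes \<open>Q = 0\<close>, where the quotient in the hypothesis would
    be 0 by the convention for division.\<close>
  have not0: "\<not> (\<forall>\<tau>. Im \<tau> > 0 \<longrightarrow> elliptic_j \<tau> = 0)"
  proof
    assume 0: "\<forall>\<tau>. Im \<tau> > 0 \<longrightarrow> elliptic_j \<tau> = 0"
    have "((\<lambda>y::real. 0) \<longlongrightarrow> complex_of_int (kappa N)) at_top"
      using hauptmodul_mult_j_tendsto[OF N]
      by (rule Lim_transform_eventually) (use eventually_gt_at_top[of 0] in \<open>eventually_elim, simp add: 0\<close>)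
    thus False using eta_exps_props(4)[OF N] by (simp add: tendsto_const_iff)
  qed
  have P: "P \<noteq> 0" and Q: "Q \<noteq> 0" using not0 j by auto
  \<comment> \<open>Zeros of \<open>Q\<close> are removed because the quotient is 0 there by
    convention, whatever the value of \<open>P\<close>.\<close>
  define S where "S = hauptmodul N ` {\<tau>. Im \<tau> > 0} - {x. poly Q x = 0}"
  have "infinite S"
    unfolding S_def by (intro Diff_infinite_finite poly_roots_finite Q hauptmodul_range_infinite N)
  have "S \<subseteq> {x. poly (P * Q0 - P0 * Q) x = 0}"
  proof
    fix x assume "x \<in> S"
    then obtain \<tau> where \<tau>: "Im \<tau> > 0" "x = hauptmodul N \<tau>" "poly Q x \<noteq> 0" by (auto simp: S_def)
    have "poly P x = elliptic_j \<tau> * poly Q x" using j[OF \<tau>(1)] \<tau>(2,3) by simp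
    thus "x \<in> {x. poly (P * Q0 - P0 * Q) x = 0}"
      using rel[OF \<tau>(1)] by (simp add: \<tau>(2)[symmetric] mult_ac)
  qed
  hence "infinite {x. poly (P * Q0 - P0 * Q) x = 0}" using \<open>infinite S\<close> finite_subset by blast
  hence "P * Q0 - P0 * Q = 0" using poly_roots_finite by blast
  hence eq: "P * Q0 = P0 * Q" by simp
  have "P dvd P0 * Q" unfolding eq[symmetric] by simp
  hence "P dvd P0" 
    using dvd_mult_no_common_root[of P Q P0] P coprime_poly_no_common_root[OF cop(1)] by blast
  have "P0 dvd P * Q0" unfolding eq by simp
  moreover have "P0 \<noteq> 0"
  proof
    assume P0: "P0 = 0"
    have "poly Q0 x \<noteq> 0" for x by (rule coprime_poly_no_common_root[OF cop(2)]) (simp add: P0)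
    thus False using rel not0 by (auto simp: P0)
  qed
  ultimately have "P0 dvd P"
    using dvd_mult_no_common_root[of P0 Q0 P] coprime_poly_no_common_root[OF cop(2)] by blast
  obtain C where C: "P0 = P * C" using \<open>P dvd P0\<close> by (rule dvdE)
  obtain D where D: "P = P0 * D" using \<open>P0 dvd P\<close> by (rule dvdE)
  have "P * (C * D) = P * 1" using C D by (metis mult.assoc mult_1_right)
  hence "C * D = 1" using P mult_left_cancel[of P "C * D" 1] by blast
  hence "is_unit C" by (metis dvd_triv_left)
  then obtain c where c': "C = [:c:]" "c dvd 1" unfolding is_unit_poly_iff by blast
  hence c: "C = [:c:]" "c \<noteq> 0" by auto
  have P0: "P0 = smult c P" using C c by simp
  have "P * Q0 = P * smult c Q" using eq P0 by simp
  hence Q0: "Q0 = smult c Q" using P mult_left_cancel[of P Q0 "smult c Q"] by blast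
  show ?thesis using c(2) by (simp add: h_fun_def P0 Q0)
qed

lemma isCont_tendsto_nhds: "isCont f a \<Longrightarrow> (f \<longlongrightarrow> f a) (nhds a)"
  unfolding isCont_def by (rule iffD1[OF tendsto_at_iff_tendsto_nhds])

text \<open>Near \<open>z = 1\<close> the imaginary part of \<open>Ln z\<close> is below 1, hence
  below \<open>pi/3\<close>, so that three times the logarithm remains in the principal
  strip.\<close>

lemma powr_cube_eventually:
  fixes z :: "complex \<Rightarrow> complex"
  assumes "isCont z 0" "z 0 = 1"
  shows "\<forall>\<^sub>F t in nhds 0. (z t ^ 3) powr (-1/12) = z t powr (-1/4)"
proof -
  have "isCont (\<lambda>t. Ln (z t)) 0"
    by (intro continuous_intros assms(1)) (simp add: assms(2) complex_nonpos_Reals_iff)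
  hence "((\<lambda>t. Ln (z t)) \<longlongrightarrow> 0) (nhds 0)" using isCont_tendsto_nhds[where f = "\<lambda>t. Ln (z t)" and a = 0] assms(2) by simp
  hence 1: "\<forall>\<^sub>F t in nhds 0. dist (Ln (z t)) 0 < 1" by (rule tendstoD) simp
  have "(z \<longlongrightarrow> 1) (nhds 0)" using isCont_tendsto_nhds[OF assms(1)] assms(2) by simp
  hence 2: "\<forall>\<^sub>F t in nhds 0. dist (z t) 1 < 1" by (rule tendstoD) simp
  from 1 2 show ?thesis
  proof eventually_elim
    case (elim t)
    have nz: "z t \<noteq> 0" using elim(2) by auto
    have "\<bar>Im (Ln (z t))\<bar> < 1" using elim(1) abs_Im_le_cmod[of "Ln (z t)"] by simp
    hence "Ln (exp (3 * Ln (z t))) = 3 * Ln (z t)"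
      using pi_gt3 by (intro Ln_exp) auto
    moreover have "exp (3 * Ln (z t)) = z t ^ 3"
      using nz by (simp add: exp_of_nat_mult[of 3, simplified])
    ultimately have "Ln (z t ^ 3) = 3 * Ln (z t)" by simp
    thus ?case using nz by (simp add: powr_def)
  qed
qed

text \<open>For the levels whose numerator is a cube. The functions \<open>g\<close> and
  \<open>q\<close> have the shape wanted in the conclusion, \<open>G\<close> and \<open>R\<close>
  are the corresponding polynomials. The restriction to a neighbourhood of 0 comes from the branch
  of the power alone.\<close>

lemma h_fun_cube:
  fixes g q :: "complex \<Rightarrow> complex"
  assumes N: "N \<in> levels" and cop: "coprime P Q"
    and j: "\<And>\<tau>. Im \<tau> > 0 \<Longrightarrow> elliptic_j \<tau> = poly P (hauptmodul N \<tau>) / poly Q (hauptmodul N \<tau>)"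
    and rel: "\<And>\<tau>. Im \<tau> > 0 \<Longrightarrow> q (hauptmodul N \<tau>) * elliptic_j \<tau> = g (hauptmodul N \<tau>) ^ 3"
    and G: "\<And>t. poly G t = g t" and R: "\<And>t. poly R t = q t"
    and "\<And>t. q t = 0 \<Longrightarrow> g t \<noteq> 0" and g0: "g 0 = c" "c \<noteq> 0"
  shows "\<forall>\<^sub>F t in nhds 0. h_fun P Q t = (1 / c * g t) powr (-1/4) * hyp_F (12^3 * q t / g t ^ 3)"
proof -
  have h: "h_fun P Q t = h_fun (G ^ 3) R t" for t
    by (rule h_fun_unique[OF N cop _ j])
       (use rel assms(7) in \<open>auto simp: G R intro!: coprime_poly_complexI\<close>)
  have "isCont (\<lambda>t. 1 / c * poly G t) 0" by (intro continuous_intros)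
  hence "\<forall>\<^sub>F t in nhds 0. ((1 / c * poly G t) ^ 3) powr (-1/12) = (1 / c * poly G t) powr (-1/4)"
    by (rule powr_cube_eventually) (simp add: G g0)
  thus ?thesis
  proof eventually_elim
    case (elim t)
    have e: "poly (G ^ 3) t / poly (G ^ 3) 0 = (1 / c * g t) ^ 3"
      by (simp add: G g0 power_divide power_mult_distrib)
    have e': "poly (G ^ 3) t = g t ^ 3" by (simp add: G)
    have "h_fun (G ^ 3) R t = ((1 / c * g t) ^ 3) powr (-1/12) * hyp_F (12^3 * q t / g t ^ 3)"
      by (unfold h_fun_def e, unfold e' R, rule refl)
    thus ?case unfolding h using elim unfolding G by simp
  qed
qed

lemma h_fun_plain:
  fixes g q :: "complex \<Rightarrow> complex"
  assumes N: "N \<in> levels" and cop: "coprime P Q"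
    and j: "\<And>\<tau>. Im \<tau> > 0 \<Longrightarrow> elliptic_j \<tau> = poly P (hauptmodul N \<tau>) / poly Q (hauptmodul N \<tau>)"
    and rel: "\<And>\<tau>. Im \<tau> > 0 \<Longrightarrow> q (hauptmodul N \<tau>) * elliptic_j \<tau> = g (hauptmodul N \<tau>)"
    and G: "\<And>t. poly G t = g t" and R: "\<And>t. poly R t = q t"
    and "\<And>t. q t = 0 \<Longrightarrow> g t \<noteq> 0" and g0: "g 0 = c"
  shows "h_fun P Q t = (1 / c * g t) powr (-1/12) * hyp_F (12^3 * q t / g t)"
proof -
  have "h_fun P Q t = h_fun G R t"
    by (rule h_fun_unique[OF N cop _ j])
       (use rel assms(7) in \<open>auto simp: G R intro!: coprime_poly_complexI\<close>)
  thus ?thesis by (simp add: h_fun_def G R g0)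
qed

section \<open>Coincidences between the arguments of \<open>F\<close>\<close>

definition g10_fun :: "complex \<Rightarrow> complex" where
  "g10_fun t = t^6 + 20*t^5 + 160*t^4 + 640*t^3 + 1280*t^2 + 1040*t + 80"

text \<open>This fraction is the common normal form: the next lemma brings the other composition of
  level 6 to it as well. The pair of lemmas for level 10 is of the same kind.\<close>

lemma a_fun_level_6:
  assumes "t + 9 \<noteq> 0"
  shows "a_fun (t * (t + 8)^3 / (t + 9)) = 12^3 * (t * (t + 8)^3 * (t + 9)^2) / p_fun t ^ 3"
proof -
  have "t * (t + 8)^3 / (t + 9) + 16 = p_fun t / (t + 9)"
    using assms by (simp add: p_fun_def divide_simps) (simp add: eval_nat_numeral algebra_simps)
  thus ?thesis using assms unfolding a_fun_def by (simp add: power_divide eval_nat_numeral)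
qed

lemma b_fun_level_6:
  assumes "t + 8 \<noteq> 0"
  shows "b_fun (t * (t + 9)^2 / (t + 8)) = 12^3 * (t * (t + 8)^3 * (t + 9)^2) / p_fun t ^ 3"
proof -
  have 1: "t * (t + 9)^2 / (t + 8) + 27 = (t + 6) ^ 3 / (t + 8)"
    and 2: "t * (t + 9)^2 / (t + 8) + 3 = (t^3 + 18*t^2 + 84*t + 24) / (t + 8)"
    using assms by (simp_all add: divide_simps) (simp_all add: eval_nat_numeral algebra_simps)
  show ?thesis using assms unfolding b_fun_def 1 2 p_fun_def
    by (simp add: power_divide power_mult_distrib eval_nat_numeral mult_ac)
qed

lemma a_fun_level_10:
  assumes "t + 5 \<noteq> 0"
  shows "a_fun (t * (t + 4)^5 / (t + 5)) = 12^3 * (t * (t + 4)^5 * (t + 5)^2) / g10_fun t ^ 3"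
proof -
  have "t * (t + 4)^5 / (t + 5) + 16 = g10_fun t / (t + 5)"
    using assms by (simp add: g10_fun_def divide_simps) (simp add: eval_nat_numeral algebra_simps)
  thus ?thesis using assms unfolding a_fun_def by (simp add: power_divide eval_nat_numeral)
qed

lemma c_fun_level_10:
  assumes "t + 4 \<noteq> 0"
  shows "c_fun (t * (t + 5)^2 / (t + 4)) = 12^3 * (t * (t + 4)^5 * (t + 5)^2) / g10_fun t ^ 3"
proof -
  have *: "(A / s)^2 + 10 * (A / s) + 5 = (A^2 + 10 * A * s + 5 * s^2) / s^2" if "s \<noteq> 0" for A s :: complex
    using that by (simp add: power2_eq_square add_divide_distrib)
  have "(t * (t + 5)^2)^2 + 10 * (t * (t + 5)^2) * (t + 4) + 5 * (t + 4)^2 = g10_fun t"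
    by (simp add: g10_fun_def eval_nat_numeral algebra_simps)
  thus ?thesis unfolding c_fun_def *[OF assms] using assms
    by (simp add: power_divide) (simp add: eval_nat_numeral mult_ac)
qed

text \<open>Putting \<open>t (t + 6)\<close> into the level 6 map splits its factors: adding 8 gives
  \<open>(t + 2)(t + 4)\<close>, adding 9 gives \<open>(t + 3)^2\<close>. The other chain has the
  same factors, so the two agree before \<open>a_fun\<close> is applied.\<close>

lemma level_12_argument:
  assumes "t + 3 \<noteq> (0::complex)"
  shows "t * (t + 4)^3 / (t + 3) * (t * (t + 4)^3 / (t + 3) + 16) =
    (t * (t + 6)) * (t * (t + 6) + 8)^3 / (t * (t + 6) + 9)"
proof -
  have 8: "t * (t + 6) + 8 = (t + 2) * (t + 4)" and 9: "t * (t + 6) + 9 = (t + 3)^2"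
    by (simp_all add: power2_eq_square algebra_simps)
  have "t * (t + 4)^3 / (t + 3) + 16 = (t + 2)^3 * (t + 6) / (t + 3)"
    using assms by (simp add: divide_simps) (simp add: eval_nat_numeral algebra_simps)
  thus ?thesis unfolding 8 9 by (simp add: power_mult_distrib power2_eq_square mult_ac)
qed

text \<open>Shifted variables reveal the cubes: \<open>u + 8 = (t + 2)^3\<close>,
  \<open>v + 3 = (u + 6)/(t + 2)\<close> and
  \<open>v (v^2 + 9v + 27) = (v + 3)^3 - 27\<close>.\<close>

lemma level_18_argument:
  assumes "t + 2 \<noteq> (0::complex)"
  defines "u \<equiv> t * (t^2 + 6*t + 12)" and "v \<equiv> t * (t + 3)^2 / (t + 2)"
  shows "v * (v^2 + 9 * v + 27) = u * (u + 9)^2 / (u + 8)"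
proof -
  define s where "s = u + 6"
  have s2: "(t + 2)^3 = s + 2" by (simp add: s_def u_def eval_nat_numeral algebra_simps)
  have "v + 3 = s / (t + 2)"
    using assms(1) unfolding v_def s_def u_def by (simp add: divide_simps) (simp add: eval_nat_numeral algebra_simps)
  hence "(v + 3)^3 = s^3 / (s + 2)" by (simp add: power_divide s2)
  moreover have "v * (v^2 + 9 * v + 27) = (v + 3)^3 - 27" by (simp add: eval_nat_numeral algebra_simps)
  moreover have "s + 2 \<noteq> 0" using assms(1) s2 by (metis power_eq_0_iff)
  ultimately have "v * (v^2 + 9 * v + 27) = (s^3 - 27 * (s + 2)) / (s + 2)"
    by (simp add: divide_simps left_diff_distrib)
  also have "s^3 - 27 * (s + 2) = u * (u + 9)^2" by (simp add: s_def eval_nat_numeral algebra_simps)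
  also have "s + 2 = u + 8" by (simp add: s_def)
  finally show ?thesis .
qed

lemma same_ratfunI:
  assumes "\<And>t. poly p t \<noteq> 0 \<Longrightarrow> f t = g t" "p \<noteq> 0"
  shows "same_ratfun f g"
proof -
  have "{t. f t \<noteq> g t} \<subseteq> {t. poly p t = 0}" using assms(1) by blast
  thus ?thesis unfolding same_ratfun_def using poly_roots_finite[OF assms(2)] finite_subset by blast
qed

lemma eventually_nonzero_at_0:
  fixes f :: "complex \<Rightarrow> complex"
  assumes "isCont f 0" "f 0 \<noteq> 0"
  shows "\<forall>\<^sub>F t in nhds 0. f t \<noteq> 0"
  using isCont_tendsto_nhds[OF assms(1)] assms(2) by (rule tendsto_imp_eventually_ne)

lemma p_fun_coprime:
  assumes "u * (u + 8)^3 * (u + 9)^2 = 0"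
  shows "p_fun u \<noteq> 0"
proof -
  have "u = 0 \<or> u = - 8 \<or> u = - 9" using assms by (simp add: eq_neg_iff_add_eq_0)
  thus ?thesis by (elim disjE) (simp_all add: p_fun_def)
qed

lemma g10_fun_coprime:
  assumes "u * (u + 4)^5 * (u + 5)^2 = 0"
  shows "g10_fun u \<noteq> 0"
proof -
  have "u = 0 \<or> u = - 4 \<or> u = - 5" using assms by (simp add: eq_neg_iff_add_eq_0)
  thus ?thesis by (elim disjE) (simp_all add: g10_fun_def)
qed

lemma lp_values:
  "lp [1] x = 1"
  "lp [16, 1] x = x + 16"
  "lp [27, 1] x = x + 27"
  "lp [3, 1] x = x + 3"
  "lp [5, 10, 1] x = x^2 + 10*x + 5"
  "lp [49, 13, 1] x = x^2 + 13*x + 49"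
  "lp [1, 5, 1] x = x^2 + 5*x + 1"
  "lp [13, 5, 1] x = x^2 + 5*x + 13"
  "lp [1, 19, 20, 7, 1] x = x^4 + 7*x^3 + 20*x^2 + 19*x + 1"
  "lp [0, 16, 1] x = x * (x + 16)"
  "lp [0, 8, 1] x = x * (x + 8)"
  "lp [0, 4, 1] x = x * (x + 4)"
  "lp [0, 27, 9, 1] x = x * (x^2 + 9*x + 27)"
  "lp [0, 25, 25, 15, 5, 1] x = x * (x^4 + 5*x^3 + 15*x^2 + 25*x + 25)"
  "lp [0, 6, 1] x = x * (x + 6)"
  "lp [0, 12, 6, 1] x = x * (x^2 + 6*x + 12)"
  "lp [8, 1] x = x + 8"
  "lp [0, 81, 18, 1] x = x * (x + 9)^2"
  "lp [4, 1] x = x + 4"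
  "lp [0, 25, 10, 1] x = x * (x + 5)^2"
  by (simp_all add: eval_nat_numeral algebra_simps)

theorem theorem7p1:
  fixes P Q :: "nat \<Rightarrow> complex poly"
  assumes "\<And>N. N \<in> levels \<Longrightarrow> coprime (P N) (Q N)"
    and "\<And>N \<tau>. N \<in> levels \<Longrightarrow> Im \<tau> > 0 \<Longrightarrow>
           elliptic_j \<tau> = poly (P N) (hauptmodul N \<tau>) / poly (Q N) (hauptmodul N \<tau>)"
  shows
    "(\<forall>\<^sub>F t in nhds 0. h_fun (P 2) (Q 2) t =
        (1/16 * (t + 16)) powr (-1/4) * hyp_F (a_fun t)) \<and>

     (\<forall>\<^sub>F t in nhds 0. h_fun (P 3) (Q 3) t =
        (1/3^6 * ((t + 27) * (t + 3)^3)) powr (-1/12) * hyp_F (b_fun t)) \<and>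

     (\<forall>\<^sub>F t in nhds 0. h_fun (P 4) (Q 4) t =
        (1/16 * ((\<lambda>t. t + 16) \<circ> (\<lambda>t. t * (t + 16))) t) powr (-1/4)
        * hyp_F ((a_fun \<circ> (\<lambda>t. t * (t + 16))) t)) \<and>

     (\<forall>\<^sub>F t in nhds 0. h_fun (P 5) (Q 5) t =
        (1/5 * (t^2 + 10*t + 5)) powr (-1/4) * hyp_F (c_fun t)) \<and>

     same_ratfun (a_fun \<circ> (\<lambda>t. t * (t + 8)^3 / (t + 9))) (b_fun \<circ> (\<lambda>t. t * (t + 9)^2 / (t + 8))) \<and>
     (\<forall>\<^sub>F t in nhds 0. h_fun (P 6) (Q 6) t =
        (1/144 * p_fun t) powr (-1/4)
        * hyp_F ((a_fun \<circ> (\<lambda>t. t * (t + 8)^3 / (t + 9))) t)) \<and>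

     (\<forall>\<^sub>F t in nhds 0. h_fun (P 7) (Q 7) t =
        (1/49 * ((t^2 + 13*t + 49) * (t^2 + 5*t + 1)^3)) powr (-1/12)
        * hyp_F (12^3 * t / ((t^2 + 13*t + 49) * (t^2 + 5*t + 1)^3))) \<and>

     (\<forall>\<^sub>F t in nhds 0. h_fun (P 8) (Q 8) t =
        (1/16 * ((\<lambda>t. t + 16) \<circ> (\<lambda>t. t * (t + 16)) \<circ> (\<lambda>t. t * (t + 8))) t) powr (-1/4)
        * hyp_F ((a_fun \<circ> (\<lambda>t. t * (t + 16)) \<circ> (\<lambda>t. t * (t + 8))) t)) \<and>

     (\<forall>\<^sub>F t in nhds 0. h_fun (P 9) (Q 9) t =
        (1/3^6 * ((\<lambda>t. (t + 27) * (t + 3)^3) \<circ> (\<lambda>t. t * (t^2 + 9*t + 27))) t) powr (-1/12)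
        * hyp_F ((b_fun \<circ> (\<lambda>t. t * (t^2 + 9*t + 27))) t)) \<and>

     same_ratfun (a_fun \<circ> (\<lambda>t. t * (t + 4)^5 / (t + 5))) (c_fun \<circ> (\<lambda>t. t * (t + 5)^2 / (t + 4))) \<and>
     (\<forall>\<^sub>F t in nhds 0. h_fun (P 10) (Q 10) t =
        (1/80 * (t^6 + 20*t^5 + 160*t^4 + 640*t^3 + 1280*t^2 + 1040*t + 80)) powr (-1/4)
        * hyp_F ((a_fun \<circ> (\<lambda>t. t * (t + 4)^5 / (t + 5))) t)) \<and>

     same_ratfun (a_fun \<circ> (\<lambda>t. t * (t + 8)^3 / (t + 9)) \<circ> (\<lambda>t. t * (t + 6)))
                 (b_fun \<circ> (\<lambda>t. t * (t + 9)^2 / (t + 8)) \<circ> (\<lambda>t. t * (t + 6))) \<and>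
     same_ratfun (b_fun \<circ> (\<lambda>t. t * (t + 9)^2 / (t + 8)) \<circ> (\<lambda>t. t * (t + 6)))
                 (a_fun \<circ> (\<lambda>t. t * (t + 16)) \<circ> (\<lambda>t. t * (t + 4)^3 / (t + 3))) \<and>
     (\<forall>\<^sub>F t in nhds 0. h_fun (P 12) (Q 12) t =
        (1/144 * (p_fun \<circ> (\<lambda>t. t * (t + 6))) t) powr (-1/4)
        * hyp_F ((a_fun \<circ> (\<lambda>t. t * (t + 8)^3 / (t + 9)) \<circ> (\<lambda>t. t * (t + 6))) t)) \<and>

     (\<forall>\<^sub>F t in nhds 0. h_fun (P 13) (Q 13) t =
        (1/13 * ((t^2 + 5*t + 13) * (t^4 + 7*t^3 + 20*t^2 + 19*t + 1)^3)) powr (-1/12)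
        * hyp_F (12^3 * t / ((t^2 + 5*t + 13) * (t^4 + 7*t^3 + 20*t^2 + 19*t + 1)^3))) \<and>

     (\<forall>\<^sub>F t in nhds 0. h_fun (P 16) (Q 16) t =
        (1/16 * ((\<lambda>t. t + 16) \<circ> (\<lambda>t. t * (t + 16)) \<circ> (\<lambda>t. t * (t + 8)) \<circ> (\<lambda>t. t * (t + 4))) t) powr (-1/4)
        * hyp_F ((a_fun \<circ> (\<lambda>t. t * (t + 16)) \<circ> (\<lambda>t. t * (t + 8)) \<circ> (\<lambda>t. t * (t + 4))) t)) \<and>

     same_ratfun (a_fun \<circ> (\<lambda>t. t * (t + 8)^3 / (t + 9)) \<circ> (\<lambda>t. t * (t^2 + 6*t + 12)))
                 (b_fun \<circ> (\<lambda>t. t * (t + 9)^2 / (t + 8)) \<circ> (\<lambda>t. t * (t^2 + 6*t + 12))) \<and>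
     same_ratfun (b_fun \<circ> (\<lambda>t. t * (t + 9)^2 / (t + 8)) \<circ> (\<lambda>t. t * (t^2 + 6*t + 12)))
                 (b_fun \<circ> (\<lambda>t. t * (t^2 + 9*t + 27)) \<circ> (\<lambda>t. t * (t + 3)^2 / (t + 2))) \<and>
     (\<forall>\<^sub>F t in nhds 0. h_fun (P 18) (Q 18) t =
        (1/144 * (p_fun \<circ> (\<lambda>t. t * (t^2 + 6*t + 12))) t) powr (-1/4)
        * hyp_F ((a_fun \<circ> (\<lambda>t. t * (t + 8)^3 / (t + 9)) \<circ> (\<lambda>t. t * (t^2 + 6*t + 12))) t)) \<and>

     (\<forall>\<^sub>F t in nhds 0. h_fun (P 25) (Q 25) t =
        (1/5 * ((\<lambda>t. t^2 + 10*t + 5) \<circ> (\<lambda>t. t * (t^4 + 5*t^3 + 15*t^2 + 25*t + 25))) t) powr (-1/4)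
        * hyp_F ((c_fun \<circ> (\<lambda>t. t * (t^4 + 5*t^3 + 15*t^2 + 25*t + 25))) t))"
proof -
  note cop = assms(1) and j = assms(2)
  have lv: "2 \<in> levels" "3 \<in> levels" "4 \<in> levels" "5 \<in> levels" "6 \<in> levels" "7 \<in> levels" "8 \<in> levels" "9 \<in> levels" "10 \<in> levels" "12 \<in> levels" "13 \<in> levels" "16 \<in> levels" "18 \<in> levels" "25 \<in> levels"
    by (simp_all add: levels_def)
  have jmod: "elliptic_j (mob a b c d \<tau>) = elliptic_j \<tau>" if "Im \<tau> > 0" "a * d - b * c = 1" for a b c d \<tau>
    by (rule elliptic_j_modular[where ?R2.0 = "\<lambda>x. poly (P 2) x / poly (Q 2) x"
          and ?R3.0 = "\<lambda>x. poly (P 3) x / poly (Q 3) x", OF j[OF lv(1)] j[OF lv(2)] that])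
  have inv: "hauptmodul N (mob a b c d \<tau>) = hauptmodul N \<tau>"
    if "N \<in> levels" "Im \<tau> > 0" "a * d - b * c = 1" "int N dvd c" for N a b c d \<tau>
    by (rule hauptmodul_Gamma0[OF that(1) cop[OF that(1)] j[OF that(1)] jmod that(3,4,2)])
  have prime_dvd: "d = 1 \<or> d = p" if "prime p" "d dvd p" for d p :: nat
    using that by (simp add: prime_nat_iff)

  \<comment> \<open>The equations for \<open>j\<close> at prime levels\<close>
  have J2: "hauptmodul 2 \<tau> * elliptic_j \<tau> = ((hauptmodul 2 \<tau>) + 16)^3" if "Im \<tau> > 0" for \<tau>
  proof -
    have "hauptmodul 2 \<tau> * elliptic_j \<tau> = lp (lcube [16, 1]) (hauptmodul 2 \<tau>)"
      by (rule j_equation[OF lv(1) prime_dvd inv[OF lv(1)] jmod j_checks(1) that]) simp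
    thus ?thesis unfolding lp_lmul lp_lcube lp_values .
  qed
  have J3: "hauptmodul 3 \<tau> * elliptic_j \<tau> = (((hauptmodul 3 \<tau>) + 27) * ((hauptmodul 3 \<tau>) + 3)^3)" if "Im \<tau> > 0" for \<tau>
  proof -
    have "hauptmodul 3 \<tau> * elliptic_j \<tau> = lp (lmul [27, 1] (lcube [3, 1])) (hauptmodul 3 \<tau>)"
      by (rule j_equation[OF lv(2) prime_dvd inv[OF lv(2)] jmod j_checks(2) that]) simp
    thus ?thesis unfolding lp_lmul lp_lcube lp_values .
  qed
  have J5: "hauptmodul 5 \<tau> * elliptic_j \<tau> = ((hauptmodul 5 \<tau>)^2 + 10*(hauptmodul 5 \<tau>) + 5)^3" if "Im \<tau> > 0" for \<tau>
  proof -
    have "hauptmodul 5 \<tau> * elliptic_j \<tau> = lp (lcube [5, 10, 1]) (hauptmodul 5 \<tau>)"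
      by (rule j_equation[OF lv(4) prime_dvd inv[OF lv(4)] jmod j_checks(3) that]) simp
    thus ?thesis unfolding lp_lmul lp_lcube lp_values .
  qed
  have J7: "hauptmodul 7 \<tau> * elliptic_j \<tau> = (((hauptmodul 7 \<tau>)^2 + 13*(hauptmodul 7 \<tau>) + 49) * ((hauptmodul 7 \<tau>)^2 + 5*(hauptmodul 7 \<tau>) + 1)^3)" if "Im \<tau> > 0" for \<tau>
  proof -
    have "hauptmodul 7 \<tau> * elliptic_j \<tau> = lp (lmul [49, 13, 1] (lcube [1, 5, 1])) (hauptmodul 7 \<tau>)"
      by (rule j_equation[OF lv(6) prime_dvd inv[OF lv(6)] jmod j_checks(4) that]) simp
    thus ?thesis unfolding lp_lmul lp_lcube lp_values .
  qed
  have J13: "hauptmodul 13 \<tau> * elliptic_j \<tau> = (((hauptmodul 13 \<tau>)^2 + 5*(hauptmodul 13 \<tau>) + 13) * ((hauptmodul 13 \<tau>)^4 + 7*(hauptmodul 13 \<tau>)^3 + 20*(hauptmodul 13 \<tau>)^2 + 19*(hauptmodul 13 \<tau>) + 1)^3)" if "Im \<tau> > 0" for \<tau>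
  proof -
    have "hauptmodul 13 \<tau> * elliptic_j \<tau> = lp (lmul [13, 5, 1] (lcube [1, 19, 20, 7, 1])) (hauptmodul 13 \<tau>)"
      by (rule j_equation[OF lv(11) prime_dvd inv[OF lv(11)] jmod j_check_13 that]) simp
    thus ?thesis unfolding lp_lmul lp_lcube lp_values .
  qed

  \<comment> \<open>Hauptmoduln expressed by those of higher level\<close>
  have T4: "hauptmodul 2 \<tau> = hauptmodul 4 \<tau> * (hauptmodul 4 \<tau> + 16)" if "Im \<tau> > 0" for \<tau>
    using t_equation[OF lv(3) lv(1) inv t_checks(1) that] unfolding lp_values by (simp only: mult_1_right)
  have T8: "hauptmodul 4 \<tau> = hauptmodul 8 \<tau> * (hauptmodul 8 \<tau> + 8)" if "Im \<tau> > 0" for \<tau>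
    using t_equation[OF lv(7) lv(3) inv t_checks(2) that] unfolding lp_values by (simp only: mult_1_right)
  have T16: "hauptmodul 8 \<tau> = hauptmodul 16 \<tau> * (hauptmodul 16 \<tau> + 4)" if "Im \<tau> > 0" for \<tau>
    using t_equation[OF lv(12) lv(7) inv t_checks(3) that] unfolding lp_values by (simp only: mult_1_right)
  have T9: "hauptmodul 3 \<tau> = hauptmodul 9 \<tau> * (hauptmodul 9 \<tau>^2 + 9*hauptmodul 9 \<tau> + 27)" if "Im \<tau> > 0" for \<tau>
    using t_equation[OF lv(8) lv(2) inv t_checks(4) that] unfolding lp_values by (simp only: mult_1_right)
  have T25: "hauptmodul 5 \<tau> = hauptmodul 25 \<tau> * (hauptmodul 25 \<tau>^4 + 5*hauptmodul 25 \<tau>^3 + 15*hauptmodul 25 \<tau>^2 + 25*hauptmodul 25 \<tau> + 25)" if "Im \<tau> > 0" for \<tau>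
    using t_equation[OF lv(14) lv(4) inv t_checks(5) that] unfolding lp_values by (simp only: mult_1_right)
  have T12: "hauptmodul 6 \<tau> = hauptmodul 12 \<tau> * (hauptmodul 12 \<tau> + 6)" if "Im \<tau> > 0" for \<tau>
    using t_equation[OF lv(10) lv(5) inv t_checks(6) that] unfolding lp_values by (simp only: mult_1_right)
  have T18: "hauptmodul 6 \<tau> = hauptmodul 18 \<tau> * (hauptmodul 18 \<tau>^2 + 6*hauptmodul 18 \<tau> + 12)" if "Im \<tau> > 0" for \<tau>
    using t_equation[OF lv(13) lv(5) inv t_checks(7) that] unfolding lp_values by (simp only: mult_1_right)
  \<comment> \<open>Elimination of \<open>y = t_3\<close>: after multiplication by
    \<open>(x + 8)^4\<close> every \<open>y\<close> in the quartic of level 3 occurs as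
    \<open>y (x + 8)\<close>, which is known in terms of \<open>x\<close>.\<close>
  have J6: "hauptmodul 6 \<tau> * (hauptmodul 6 \<tau> + 8)^3 * (hauptmodul 6 \<tau> + 9)^2 * elliptic_j \<tau> = p_fun (hauptmodul 6 \<tau>) ^ 3"
    if "Im \<tau> > 0" for \<tau>
  proof -
    define x y where "x = hauptmodul 6 \<tau>" and "y = hauptmodul 3 \<tau>"
    have y: "y * (x + 8) = x * (x + 9)^2"
      using t_equation[OF lv(5) lv(2) inv t_checks(8) that, folded x_def y_def]
      unfolding lp_values .
    have jy: "y * elliptic_j \<tau> = (y + 27) * (y + 3)^3" using J3[OF that] by (simp add: y_def)
    have "x * (x + 8)^3 * (x + 9)^2 * elliptic_j \<tau> = (x * (x + 9)^2) * (x + 8)^3 * elliptic_j \<tau>"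
      by (simp add: mult_ac)
    also have "\<dots> = (x + 8)^4 * (y * elliptic_j \<tau>)"
      unfolding y[symmetric] by (simp add: eval_nat_numeral mult_ac)
    also have "\<dots> = (y * (x + 8) + 27 * (x + 8)) * (y * (x + 8) + 3 * (x + 8))^3"
    proof -
      have "(x + 8)^4 = (x + 8) * (x + 8)^3" by (simp add: eval_nat_numeral)
      moreover have "y * (x + 8) + 27 * (x + 8) = (y + 27) * (x + 8)" "y * (x + 8) + 3 * (x + 8) = (y + 3) * (x + 8)"
        by (simp_all only: distrib_right)
      ultimately show ?thesis unfolding jy by (simp only: power_mult_distrib mult_ac)
    qed
    also have "y * (x + 8) + 27 * (x + 8) = (x + 6)^3"
      unfolding y by (simp add: eval_nat_numeral algebra_simps)
    also have "y * (x + 8) + 3 * (x + 8) = x^3 + 18*x^2 + 84*x + 24"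
      unfolding y by (simp add: eval_nat_numeral algebra_simps)
    finally show ?thesis by (simp add: p_fun_def power_mult_distrib x_def)
  qed
  \<comment> \<open>Likewise with \<open>(x + 4)^6\<close>, as the right-hand side of level 5 is the
    cube of a quadratic in \<open>y = t_5\<close>.\<close>
  have J10: "hauptmodul 10 \<tau> * (hauptmodul 10 \<tau> + 4)^5 * (hauptmodul 10 \<tau> + 5)^2 * elliptic_j \<tau> = g10_fun (hauptmodul 10 \<tau>) ^ 3"
    if "Im \<tau> > 0" for \<tau>
  proof -
    define x y where "x = hauptmodul 10 \<tau>" and "y = hauptmodul 5 \<tau>"
    have y: "y * (x + 4) = x * (x + 5)^2"
      using t_equation[OF lv(9) lv(4) inv t_checks(9) that, folded x_def y_def]
      unfolding lp_values .
    have jy: "y * elliptic_j \<tau> = (y^2 + 10*y + 5)^3" using J5[OF that] by (simp add: y_def)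
    have "x * (x + 4)^5 * (x + 5)^2 * elliptic_j \<tau> = (x * (x + 5)^2) * (x + 4)^5 * elliptic_j \<tau>"
      by (simp add: mult_ac)
    also have "\<dots> = ((x + 4)^2)^3 * (y * elliptic_j \<tau>)"
      unfolding y[symmetric] by (simp add: eval_nat_numeral mult_ac)
    also have "\<dots> = ((x + 4)^2 * (y^2 + 10*y + 5))^3"
      unfolding jy by (simp add: power_mult_distrib)
    also have "(x + 4)^2 * (y^2 + 10*y + 5) = (y * (x + 4))^2 + 10 * (y * (x + 4)) * (x + 4) + 5 * (x + 4)^2"
      by (simp add: eval_nat_numeral algebra_simps)
    also have "\<dots> = g10_fun x"
      unfolding y g10_fun_def by (simp add: eval_nat_numeral algebra_simps)
    finally show ?thesis by (simp add: x_def)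
  qed

  \<comment> \<open>The functions \<open>h_N\<close> in terms of explicit polynomials\<close>
  have h2: "\<forall>\<^sub>F t in nhds 0. h_fun (P 2) (Q 2) t = (1 / 16 * (t + 16)) powr (-1/4) * hyp_F (12^3 * (t) / (t + 16) ^ 3)"
  proof (rule h_fun_cube[where N = 2 and q = "\<lambda>t. t" and g = "\<lambda>t. t + 16" and c = "16"
      and G = "[:16, 1:]" and R = "[:0, 1:]", OF lv(1) cop[OF lv(1)] j[OF lv(1)]])
    show "((hauptmodul 2 \<tau>)) * elliptic_j \<tau> = ((hauptmodul 2 \<tau>) + 16) ^ 3" if "Im \<tau> > 0" for \<tau>
      using J2[OF that] .
    show "poly ([:16, 1:]) t = t + 16" for t :: complex
      by (simp add: poly_pcompose p_fun_def g10_fun_def power2_eq_square power3_eq_cube eval_nat_numeral algebra_simps)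
    show "poly ([:0, 1:]) t = t" for t :: complex
      by (simp add: poly_pcompose eval_nat_numeral algebra_simps)
    show "t + 16 \<noteq> 0" if "t = 0" for t :: complex
      unfolding that by simp
  qed (simp_all add: p_fun_def g10_fun_def)
  have h4: "\<forall>\<^sub>F t in nhds 0. h_fun (P 4) (Q 4) t = (1 / 16 * ((t * (t + 16)) + 16)) powr (-1/4) * hyp_F (12^3 * (t * (t + 16)) / ((t * (t + 16)) + 16) ^ 3)"
  proof (rule h_fun_cube[where N = 4 and q = "\<lambda>t. t * (t + 16)" and g = "\<lambda>t. (t * (t + 16)) + 16" and c = "16"
      and G = "[:16, 1:] \<circ>\<^sub>p [:0, 16, 1:]" and R = "[:0, 16, 1:]", OF lv(3) cop[OF lv(3)] j[OF lv(3)]])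
    show "((hauptmodul 4 \<tau>) * ((hauptmodul 4 \<tau>) + 16)) * elliptic_j \<tau> = (((hauptmodul 4 \<tau>) * ((hauptmodul 4 \<tau>) + 16)) + 16) ^ 3" if "Im \<tau> > 0" for \<tau>
      using J2[OF that] unfolding T4[OF that] .
    show "poly ([:16, 1:] \<circ>\<^sub>p [:0, 16, 1:]) t = (t * (t + 16)) + 16" for t :: complex
      by (simp add: poly_pcompose p_fun_def g10_fun_def power2_eq_square power3_eq_cube eval_nat_numeral algebra_simps)
    show "poly ([:0, 16, 1:]) t = t * (t + 16)" for t :: complex
      by (simp add: poly_pcompose eval_nat_numeral algebra_simps)
    show "(t * (t + 16)) + 16 \<noteq> 0" if "t * (t + 16) = 0" for t :: complex
      unfolding that by simp
  qed (simp_all add: p_fun_def g10_fun_def)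
  have h8: "\<forall>\<^sub>F t in nhds 0. h_fun (P 8) (Q 8) t = (1 / 16 * (((t * (t + 8)) * ((t * (t + 8)) + 16)) + 16)) powr (-1/4) * hyp_F (12^3 * ((t * (t + 8)) * ((t * (t + 8)) + 16)) / (((t * (t + 8)) * ((t * (t + 8)) + 16)) + 16) ^ 3)"
  proof (rule h_fun_cube[where N = 8 and q = "\<lambda>t. (t * (t + 8)) * ((t * (t + 8)) + 16)" and g = "\<lambda>t. ((t * (t + 8)) * ((t * (t + 8)) + 16)) + 16" and c = "16"
      and G = "[:16, 1:] \<circ>\<^sub>p ([:0, 16, 1:] \<circ>\<^sub>p [:0, 8, 1:])" and R = "[:0, 16, 1:] \<circ>\<^sub>p [:0, 8, 1:]", OF lv(7) cop[OF lv(7)] j[OF lv(7)]])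
    show "(((hauptmodul 8 \<tau>) * ((hauptmodul 8 \<tau>) + 8)) * (((hauptmodul 8 \<tau>) * ((hauptmodul 8 \<tau>) + 8)) + 16)) * elliptic_j \<tau> = ((((hauptmodul 8 \<tau>) * ((hauptmodul 8 \<tau>) + 8)) * (((hauptmodul 8 \<tau>) * ((hauptmodul 8 \<tau>) + 8)) + 16)) + 16) ^ 3" if "Im \<tau> > 0" for \<tau>
      using J2[OF that] unfolding T4[OF that] T8[OF that] .
    show "poly ([:16, 1:] \<circ>\<^sub>p ([:0, 16, 1:] \<circ>\<^sub>p [:0, 8, 1:])) t = ((t * (t + 8)) * ((t * (t + 8)) + 16)) + 16" for t :: complex
      by (simp add: poly_pcompose p_fun_def g10_fun_def power2_eq_square power3_eq_cube eval_nat_numeral algebra_simps)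
    show "poly ([:0, 16, 1:] \<circ>\<^sub>p [:0, 8, 1:]) t = (t * (t + 8)) * ((t * (t + 8)) + 16)" for t :: complex
      by (simp add: poly_pcompose eval_nat_numeral algebra_simps)
    show "((t * (t + 8)) * ((t * (t + 8)) + 16)) + 16 \<noteq> 0" if "(t * (t + 8)) * ((t * (t + 8)) + 16) = 0" for t :: complex
      unfolding that by simp
  qed (simp_all add: p_fun_def g10_fun_def)
  have h16: "\<forall>\<^sub>F t in nhds 0. h_fun (P 16) (Q 16) t = (1 / 16 * ((((t * (t + 4)) * ((t * (t + 4)) + 8)) * (((t * (t + 4)) * ((t * (t + 4)) + 8)) + 16)) + 16)) powr (-1/4) * hyp_F (12^3 * (((t * (t + 4)) * ((t * (t + 4)) + 8)) * (((t * (t + 4)) * ((t * (t + 4)) + 8)) + 16)) / ((((t * (t + 4)) * ((t * (t + 4)) + 8)) * (((t * (t + 4)) * ((t * (t + 4)) + 8)) + 16)) + 16) ^ 3)"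
  proof (rule h_fun_cube[where N = 16 and q = "\<lambda>t. ((t * (t + 4)) * ((t * (t + 4)) + 8)) * (((t * (t + 4)) * ((t * (t + 4)) + 8)) + 16)" and g = "\<lambda>t. (((t * (t + 4)) * ((t * (t + 4)) + 8)) * (((t * (t + 4)) * ((t * (t + 4)) + 8)) + 16)) + 16" and c = "16"
      and G = "[:16, 1:] \<circ>\<^sub>p ([:0, 16, 1:] \<circ>\<^sub>p ([:0, 8, 1:] \<circ>\<^sub>p [:0, 4, 1:]))" and R = "[:0, 16, 1:] \<circ>\<^sub>p ([:0, 8, 1:] \<circ>\<^sub>p [:0, 4, 1:])", OF lv(12) cop[OF lv(12)] j[OF lv(12)]])
    show "((((hauptmodul 16 \<tau>) * ((hauptmodul 16 \<tau>) + 4)) * (((hauptmodul 16 \<tau>) * ((hauptmodul 16 \<tau>) + 4)) + 8)) * ((((hauptmodul 16 \<tau>) * ((hauptmodul 16 \<tau>) + 4)) * (((hauptmodul 16 \<tau>) * ((hauptmodul 16 \<tau>) + 4)) + 8)) + 16)) * elliptic_j \<tau> = (((((hauptmodul 16 \<tau>) * ((hauptmodul 16 \<tau>) + 4)) * (((hauptmodul 16 \<tau>) * ((hauptmodul 16 \<tau>) + 4)) + 8)) * ((((hauptmodul 16 \<tau>) * ((hauptmodul 16 \<tau>) + 4)) * (((hauptmodul 16 \<tau>) * ((hauptmodul 16 \<tau>) + 4)) + 8)) + 16)) + 16) ^ 3" if "Im \<tau> > 0" for \<tau>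
      using J2[OF that] unfolding T4[OF that] T8[OF that] T16[OF that] .
    show "poly ([:16, 1:] \<circ>\<^sub>p ([:0, 16, 1:] \<circ>\<^sub>p ([:0, 8, 1:] \<circ>\<^sub>p [:0, 4, 1:]))) t = (((t * (t + 4)) * ((t * (t + 4)) + 8)) * (((t * (t + 4)) * ((t * (t + 4)) + 8)) + 16)) + 16" for t :: complex
      by (simp add: poly_pcompose p_fun_def g10_fun_def power2_eq_square power3_eq_cube eval_nat_numeral algebra_simps)
    show "poly ([:0, 16, 1:] \<circ>\<^sub>p ([:0, 8, 1:] \<circ>\<^sub>p [:0, 4, 1:])) t = ((t * (t + 4)) * ((t * (t + 4)) + 8)) * (((t * (t + 4)) * ((t * (t + 4)) + 8)) + 16)" for t :: complex
      by (simp add: poly_pcompose eval_nat_numeral algebra_simps)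
    show "(((t * (t + 4)) * ((t * (t + 4)) + 8)) * (((t * (t + 4)) * ((t * (t + 4)) + 8)) + 16)) + 16 \<noteq> 0" if "((t * (t + 4)) * ((t * (t + 4)) + 8)) * (((t * (t + 4)) * ((t * (t + 4)) + 8)) + 16) = 0" for t :: complex
      unfolding that by simp
  qed (simp_all add: p_fun_def g10_fun_def)
  have h5: "\<forall>\<^sub>F t in nhds 0. h_fun (P 5) (Q 5) t = (1 / 5 * (t^2 + 10*t + 5)) powr (-1/4) * hyp_F (12^3 * (t) / (t^2 + 10*t + 5) ^ 3)"
  proof (rule h_fun_cube[where N = 5 and q = "\<lambda>t. t" and g = "\<lambda>t. t^2 + 10*t + 5" and c = "5"
      and G = "[:5, 10, 1:]" and R = "[:0, 1:]", OF lv(4) cop[OF lv(4)] j[OF lv(4)]])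
    show "((hauptmodul 5 \<tau>)) * elliptic_j \<tau> = ((hauptmodul 5 \<tau>)^2 + 10*(hauptmodul 5 \<tau>) + 5) ^ 3" if "Im \<tau> > 0" for \<tau>
      using J5[OF that] .
    show "poly ([:5, 10, 1:]) t = t^2 + 10*t + 5" for t :: complex
      by (simp add: poly_pcompose p_fun_def g10_fun_def power2_eq_square power3_eq_cube eval_nat_numeral algebra_simps)
    show "poly ([:0, 1:]) t = t" for t :: complex
      by (simp add: poly_pcompose eval_nat_numeral algebra_simps)
    show "t^2 + 10*t + 5 \<noteq> 0" if "t = 0" for t :: complex
      unfolding that by simp
  qed (simp_all add: p_fun_def g10_fun_def)
  have h25: "\<forall>\<^sub>F t in nhds 0. h_fun (P 25) (Q 25) t = (1 / 5 * ((t * (t^4 + 5*t^3 + 15*t^2 + 25*t + 25))^2 + 10*(t * (t^4 + 5*t^3 + 15*t^2 + 25*t + 25)) + 5)) powr (-1/4) * hyp_F (12^3 * (t * (t^4 + 5*t^3 + 15*t^2 + 25*t + 25)) / ((t * (t^4 + 5*t^3 + 15*t^2 + 25*t + 25))^2 + 10*(t * (t^4 + 5*t^3 + 15*t^2 + 25*t + 25)) + 5) ^ 3)"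
  proof (rule h_fun_cube[where N = 25 and q = "\<lambda>t. t * (t^4 + 5*t^3 + 15*t^2 + 25*t + 25)" and g = "\<lambda>t. (t * (t^4 + 5*t^3 + 15*t^2 + 25*t + 25))^2 + 10*(t * (t^4 + 5*t^3 + 15*t^2 + 25*t + 25)) + 5" and c = "5"
      and G = "[:5, 10, 1:] \<circ>\<^sub>p [:0, 25, 25, 15, 5, 1:]" and R = "[:0, 25, 25, 15, 5, 1:]", OF lv(14) cop[OF lv(14)] j[OF lv(14)]])
    show "((hauptmodul 25 \<tau>) * ((hauptmodul 25 \<tau>)^4 + 5*(hauptmodul 25 \<tau>)^3 + 15*(hauptmodul 25 \<tau>)^2 + 25*(hauptmodul 25 \<tau>) + 25)) * elliptic_j \<tau> = (((hauptmodul 25 \<tau>) * ((hauptmodul 25 \<tau>)^4 + 5*(hauptmodul 25 \<tau>)^3 + 15*(hauptmodul 25 \<tau>)^2 + 25*(hauptmodul 25 \<tau>) + 25))^2 + 10*((hauptmodul 25 \<tau>) * ((hauptmodul 25 \<tau>)^4 + 5*(hauptmodul 25 \<tau>)^3 + 15*(hauptmodul 25 \<tau>)^2 + 25*(hauptmodul 25 \<tau>) + 25)) + 5) ^ 3" if "Im \<tau> > 0" for \<tau>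
      using J5[OF that] unfolding T25[OF that] .
    show "poly ([:5, 10, 1:] \<circ>\<^sub>p [:0, 25, 25, 15, 5, 1:]) t = (t * (t^4 + 5*t^3 + 15*t^2 + 25*t + 25))^2 + 10*(t * (t^4 + 5*t^3 + 15*t^2 + 25*t + 25)) + 5" for t :: complex
      by (simp add: poly_pcompose p_fun_def g10_fun_def power2_eq_square power3_eq_cube eval_nat_numeral algebra_simps)
    show "poly ([:0, 25, 25, 15, 5, 1:]) t = t * (t^4 + 5*t^3 + 15*t^2 + 25*t + 25)" for t :: complex
      by (simp add: poly_pcompose eval_nat_numeral algebra_simps)
    show "(t * (t^4 + 5*t^3 + 15*t^2 + 25*t + 25))^2 + 10*(t * (t^4 + 5*t^3 + 15*t^2 + 25*t + 25)) + 5 \<noteq> 0" if "t * (t^4 + 5*t^3 + 15*t^2 + 25*t + 25) = 0" for t :: complex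
      unfolding that by simp
  qed (simp_all add: p_fun_def g10_fun_def)
  have h6: "\<forall>\<^sub>F t in nhds 0. h_fun (P 6) (Q 6) t = (1 / 144 * (p_fun t)) powr (-1/4) * hyp_F (12^3 * (t * (t + 8)^3 * (t + 9)^2) / (p_fun t) ^ 3)"
  proof (rule h_fun_cube[where N = 6 and q = "\<lambda>t. t * (t + 8)^3 * (t + 9)^2" and g = "\<lambda>t. p_fun t" and c = "144"
      and G = "([:6, 1:] * [:24, 84, 18, 1:])" and R = "([:0, 1:] * [:8, 1:]^3 * [:9, 1:]^2)", OF lv(5) cop[OF lv(5)] j[OF lv(5)]])
    show "((hauptmodul 6 \<tau>) * ((hauptmodul 6 \<tau>) + 8)^3 * ((hauptmodul 6 \<tau>) + 9)^2) * elliptic_j \<tau> = (p_fun (hauptmodul 6 \<tau>)) ^ 3" if "Im \<tau> > 0" for \<tau>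
      by (rule J6[OF that])
    show "poly (([:6, 1:] * [:24, 84, 18, 1:])) t = p_fun t" for t :: complex
      by (simp add: poly_pcompose p_fun_def g10_fun_def power2_eq_square power3_eq_cube eval_nat_numeral algebra_simps)
    show "poly (([:0, 1:] * [:8, 1:]^3 * [:9, 1:]^2)) t = t * (t + 8)^3 * (t + 9)^2" for t :: complex
      by (simp add: poly_pcompose eval_nat_numeral algebra_simps)
    show "p_fun t \<noteq> 0" if "t * (t + 8)^3 * (t + 9)^2 = 0" for t :: complex
      by (rule p_fun_coprime[OF that])
  qed (simp_all add: p_fun_def g10_fun_def)
  have h12: "\<forall>\<^sub>F t in nhds 0. h_fun (P 12) (Q 12) t = (1 / 144 * (p_fun (t * (t + 6)))) powr (-1/4) * hyp_F (12^3 * ((t * (t + 6)) * ((t * (t + 6)) + 8)^3 * ((t * (t + 6)) + 9)^2) / (p_fun (t * (t + 6))) ^ 3)"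
  proof (rule h_fun_cube[where N = 12 and q = "\<lambda>t. (t * (t + 6)) * ((t * (t + 6)) + 8)^3 * ((t * (t + 6)) + 9)^2" and g = "\<lambda>t. p_fun (t * (t + 6))" and c = "144"
      and G = "([:6, 1:] * [:24, 84, 18, 1:]) \<circ>\<^sub>p [:0, 6, 1:]" and R = "([:0, 1:] * [:8, 1:]^3 * [:9, 1:]^2) \<circ>\<^sub>p [:0, 6, 1:]", OF lv(10) cop[OF lv(10)] j[OF lv(10)]])
    show "(((hauptmodul 12 \<tau>) * ((hauptmodul 12 \<tau>) + 6)) * (((hauptmodul 12 \<tau>) * ((hauptmodul 12 \<tau>) + 6)) + 8)^3 * (((hauptmodul 12 \<tau>) * ((hauptmodul 12 \<tau>) + 6)) + 9)^2) * elliptic_j \<tau> = (p_fun ((hauptmodul 12 \<tau>) * ((hauptmodul 12 \<tau>) + 6))) ^ 3" if "Im \<tau> > 0" for \<tau>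
      using J6[OF that] unfolding T12[OF that] .
    show "poly (([:6, 1:] * [:24, 84, 18, 1:]) \<circ>\<^sub>p [:0, 6, 1:]) t = p_fun (t * (t + 6))" for t :: complex
      by (simp add: poly_pcompose p_fun_def g10_fun_def power2_eq_square power3_eq_cube eval_nat_numeral algebra_simps)
    show "poly (([:0, 1:] * [:8, 1:]^3 * [:9, 1:]^2) \<circ>\<^sub>p [:0, 6, 1:]) t = (t * (t + 6)) * ((t * (t + 6)) + 8)^3 * ((t * (t + 6)) + 9)^2" for t :: complex
      by (simp add: poly_pcompose eval_nat_numeral algebra_simps)
    show "p_fun (t * (t + 6)) \<noteq> 0" if "(t * (t + 6)) * ((t * (t + 6)) + 8)^3 * ((t * (t + 6)) + 9)^2 = 0" for t :: complex
      by (rule p_fun_coprime[OF that])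
  qed (simp_all add: p_fun_def g10_fun_def)
  have h18: "\<forall>\<^sub>F t in nhds 0. h_fun (P 18) (Q 18) t = (1 / 144 * (p_fun (t * (t^2 + 6*t + 12)))) powr (-1/4) * hyp_F (12^3 * ((t * (t^2 + 6*t + 12)) * ((t * (t^2 + 6*t + 12)) + 8)^3 * ((t * (t^2 + 6*t + 12)) + 9)^2) / (p_fun (t * (t^2 + 6*t + 12))) ^ 3)"
  proof (rule h_fun_cube[where N = 18 and q = "\<lambda>t. (t * (t^2 + 6*t + 12)) * ((t * (t^2 + 6*t + 12)) + 8)^3 * ((t * (t^2 + 6*t + 12)) + 9)^2" and g = "\<lambda>t. p_fun (t * (t^2 + 6*t + 12))" and c = "144"
      and G = "([:6, 1:] * [:24, 84, 18, 1:]) \<circ>\<^sub>p [:0, 12, 6, 1:]" and R = "([:0, 1:] * [:8, 1:]^3 * [:9, 1:]^2) \<circ>\<^sub>p [:0, 12, 6, 1:]", OF lv(13) cop[OF lv(13)] j[OF lv(13)]])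
    show "(((hauptmodul 18 \<tau>) * ((hauptmodul 18 \<tau>)^2 + 6*(hauptmodul 18 \<tau>) + 12)) * (((hauptmodul 18 \<tau>) * ((hauptmodul 18 \<tau>)^2 + 6*(hauptmodul 18 \<tau>) + 12)) + 8)^3 * (((hauptmodul 18 \<tau>) * ((hauptmodul 18 \<tau>)^2 + 6*(hauptmodul 18 \<tau>) + 12)) + 9)^2) * elliptic_j \<tau> = (p_fun ((hauptmodul 18 \<tau>) * ((hauptmodul 18 \<tau>)^2 + 6*(hauptmodul 18 \<tau>) + 12))) ^ 3" if "Im \<tau> > 0" for \<tau>
      using J6[OF that] unfolding T18[OF that] .
    show "poly (([:6, 1:] * [:24, 84, 18, 1:]) \<circ>\<^sub>p [:0, 12, 6, 1:]) t = p_fun (t * (t^2 + 6*t + 12))" for t :: complex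
      by (simp add: poly_pcompose p_fun_def g10_fun_def power2_eq_square power3_eq_cube eval_nat_numeral algebra_simps)
    show "poly (([:0, 1:] * [:8, 1:]^3 * [:9, 1:]^2) \<circ>\<^sub>p [:0, 12, 6, 1:]) t = (t * (t^2 + 6*t + 12)) * ((t * (t^2 + 6*t + 12)) + 8)^3 * ((t * (t^2 + 6*t + 12)) + 9)^2" for t :: complex
      by (simp add: poly_pcompose eval_nat_numeral algebra_simps)
    show "p_fun (t * (t^2 + 6*t + 12)) \<noteq> 0" if "(t * (t^2 + 6*t + 12)) * ((t * (t^2 + 6*t + 12)) + 8)^3 * ((t * (t^2 + 6*t + 12)) + 9)^2 = 0" for t :: complex
      by (rule p_fun_coprime[OF that])
  qed (simp_all add: p_fun_def g10_fun_def)
  have h10: "\<forall>\<^sub>F t in nhds 0. h_fun (P 10) (Q 10) t = (1 / 80 * (g10_fun t)) powr (-1/4) * hyp_F (12^3 * (t * (t + 4)^5 * (t + 5)^2) / (g10_fun t) ^ 3)"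
  proof (rule h_fun_cube[where N = 10 and q = "\<lambda>t. t * (t + 4)^5 * (t + 5)^2" and g = "\<lambda>t. g10_fun t" and c = "80"
      and G = "[:80, 1040, 1280, 640, 160, 20, 1:]" and R = "([:0, 1:] * [:4, 1:]^5 * [:5, 1:]^2)", OF lv(9) cop[OF lv(9)] j[OF lv(9)]])
    show "((hauptmodul 10 \<tau>) * ((hauptmodul 10 \<tau>) + 4)^5 * ((hauptmodul 10 \<tau>) + 5)^2) * elliptic_j \<tau> = (g10_fun (hauptmodul 10 \<tau>)) ^ 3" if "Im \<tau> > 0" for \<tau>
      by (rule J10[OF that])
    show "poly ([:80, 1040, 1280, 640, 160, 20, 1:]) t = g10_fun t" for t :: complex
      by (simp add: poly_pcompose p_fun_def g10_fun_def power2_eq_square power3_eq_cube eval_nat_numeral algebra_simps)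
    show "poly (([:0, 1:] * [:4, 1:]^5 * [:5, 1:]^2)) t = t * (t + 4)^5 * (t + 5)^2" for t :: complex
      by (simp add: poly_pcompose eval_nat_numeral algebra_simps)
    show "g10_fun t \<noteq> 0" if "t * (t + 4)^5 * (t + 5)^2 = 0" for t :: complex
      by (rule g10_fun_coprime[OF that])
  qed (simp_all add: p_fun_def g10_fun_def)
  have h3: "h_fun (P 3) (Q 3) t = (1 / 3^6 * ((t + 27) * (t + 3)^3)) powr (-1/12) * hyp_F (12^3 * (t) / ((t + 27) * (t + 3)^3))" for t
  proof (rule h_fun_plain[where N = 3 and q = "\<lambda>t. t" and g = "\<lambda>t. (t + 27) * (t + 3)^3" and c = "3^6"
      and G = "([:27, 1:] * [:3, 1:]^3)" and R = "[:0, 1:]", OF lv(2) cop[OF lv(2)] j[OF lv(2)]])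
    show "((hauptmodul 3 \<tau>)) * elliptic_j \<tau> = ((hauptmodul 3 \<tau>) + 27) * ((hauptmodul 3 \<tau>) + 3)^3" if "Im \<tau> > 0" for \<tau>
      using J3[OF that] .
    show "poly (([:27, 1:] * [:3, 1:]^3)) t = (t + 27) * (t + 3)^3" for t :: complex
      by (simp add: poly_pcompose p_fun_def g10_fun_def power2_eq_square power3_eq_cube eval_nat_numeral algebra_simps)
    show "poly ([:0, 1:]) t = t" for t :: complex
      by (simp add: poly_pcompose eval_nat_numeral algebra_simps)
    show "(t + 27) * (t + 3)^3 \<noteq> 0" if "t = 0" for t :: complex
      unfolding that by simp
  qed (simp_all add: p_fun_def g10_fun_def)
  have h9: "h_fun (P 9) (Q 9) t = (1 / 3^6 * (((t * (t^2 + 9*t + 27)) + 27) * ((t * (t^2 + 9*t + 27)) + 3)^3)) powr (-1/12) * hyp_F (12^3 * (t * (t^2 + 9*t + 27)) / (((t * (t^2 + 9*t + 27)) + 27) * ((t * (t^2 + 9*t + 27)) + 3)^3))" for t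
  proof (rule h_fun_plain[where N = 9 and q = "\<lambda>t. t * (t^2 + 9*t + 27)" and g = "\<lambda>t. ((t * (t^2 + 9*t + 27)) + 27) * ((t * (t^2 + 9*t + 27)) + 3)^3" and c = "3^6"
      and G = "([:27, 1:] * [:3, 1:]^3) \<circ>\<^sub>p [:0, 27, 9, 1:]" and R = "[:0, 27, 9, 1:]", OF lv(8) cop[OF lv(8)] j[OF lv(8)]])
    show "((hauptmodul 9 \<tau>) * ((hauptmodul 9 \<tau>)^2 + 9*(hauptmodul 9 \<tau>) + 27)) * elliptic_j \<tau> = (((hauptmodul 9 \<tau>) * ((hauptmodul 9 \<tau>)^2 + 9*(hauptmodul 9 \<tau>) + 27)) + 27) * (((hauptmodul 9 \<tau>) * ((hauptmodul 9 \<tau>)^2 + 9*(hauptmodul 9 \<tau>) + 27)) + 3)^3" if "Im \<tau> > 0" for \<tau>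
      using J3[OF that] unfolding T9[OF that] .
    show "poly (([:27, 1:] * [:3, 1:]^3) \<circ>\<^sub>p [:0, 27, 9, 1:]) t = ((t * (t^2 + 9*t + 27)) + 27) * ((t * (t^2 + 9*t + 27)) + 3)^3" for t :: complex
      by (simp add: poly_pcompose p_fun_def g10_fun_def power2_eq_square power3_eq_cube eval_nat_numeral algebra_simps)
    show "poly ([:0, 27, 9, 1:]) t = t * (t^2 + 9*t + 27)" for t :: complex
      by (simp add: poly_pcompose eval_nat_numeral algebra_simps)
    show "((t * (t^2 + 9*t + 27)) + 27) * ((t * (t^2 + 9*t + 27)) + 3)^3 \<noteq> 0" if "t * (t^2 + 9*t + 27) = 0" for t :: complex
      unfolding that by simp
  qed (simp_all add: p_fun_def g10_fun_def)
  have h7: "h_fun (P 7) (Q 7) t = (1 / 49 * ((t^2 + 13*t + 49) * (t^2 + 5*t + 1)^3)) powr (-1/12) * hyp_F (12^3 * (t) / ((t^2 + 13*t + 49) * (t^2 + 5*t + 1)^3))" for t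
  proof (rule h_fun_plain[where N = 7 and q = "\<lambda>t. t" and g = "\<lambda>t. (t^2 + 13*t + 49) * (t^2 + 5*t + 1)^3" and c = "49"
      and G = "([:49, 13, 1:] * [:1, 5, 1:]^3)" and R = "[:0, 1:]", OF lv(6) cop[OF lv(6)] j[OF lv(6)]])
    show "((hauptmodul 7 \<tau>)) * elliptic_j \<tau> = ((hauptmodul 7 \<tau>)^2 + 13*(hauptmodul 7 \<tau>) + 49) * ((hauptmodul 7 \<tau>)^2 + 5*(hauptmodul 7 \<tau>) + 1)^3" if "Im \<tau> > 0" for \<tau>
      using J7[OF that] .
    show "poly (([:49, 13, 1:] * [:1, 5, 1:]^3)) t = (t^2 + 13*t + 49) * (t^2 + 5*t + 1)^3" for t :: complex
      by (simp add: poly_pcompose p_fun_def g10_fun_def power2_eq_square power3_eq_cube eval_nat_numeral algebra_simps)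
    show "poly ([:0, 1:]) t = t" for t :: complex
      by (simp add: poly_pcompose eval_nat_numeral algebra_simps)
    show "(t^2 + 13*t + 49) * (t^2 + 5*t + 1)^3 \<noteq> 0" if "t = 0" for t :: complex
      unfolding that by simp
  qed (simp_all add: p_fun_def g10_fun_def)
  have h13: "h_fun (P 13) (Q 13) t = (1 / 13 * ((t^2 + 5*t + 13) * (t^4 + 7*t^3 + 20*t^2 + 19*t + 1)^3)) powr (-1/12) * hyp_F (12^3 * (t) / ((t^2 + 5*t + 13) * (t^4 + 7*t^3 + 20*t^2 + 19*t + 1)^3))" for t
  proof (rule h_fun_plain[where N = 13 and q = "\<lambda>t. t" and g = "\<lambda>t. (t^2 + 5*t + 13) * (t^4 + 7*t^3 + 20*t^2 + 19*t + 1)^3" and c = "13"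
      and G = "([:13, 5, 1:] * [:1, 19, 20, 7, 1:]^3)" and R = "[:0, 1:]", OF lv(11) cop[OF lv(11)] j[OF lv(11)]])
    show "((hauptmodul 13 \<tau>)) * elliptic_j \<tau> = ((hauptmodul 13 \<tau>)^2 + 5*(hauptmodul 13 \<tau>) + 13) * ((hauptmodul 13 \<tau>)^4 + 7*(hauptmodul 13 \<tau>)^3 + 20*(hauptmodul 13 \<tau>)^2 + 19*(hauptmodul 13 \<tau>) + 1)^3" if "Im \<tau> > 0" for \<tau>
      using J13[OF that] .
    show "poly (([:13, 5, 1:] * [:1, 19, 20, 7, 1:]^3)) t = (t^2 + 5*t + 13) * (t^4 + 7*t^3 + 20*t^2 + 19*t + 1)^3" for t :: complex
      by (simp add: poly_pcompose p_fun_def g10_fun_def power2_eq_square power3_eq_cube eval_nat_numeral algebra_simps)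
    show "poly ([:0, 1:]) t = t" for t :: complex
      by (simp add: poly_pcompose eval_nat_numeral algebra_simps)
    show "(t^2 + 5*t + 13) * (t^4 + 7*t^3 + 20*t^2 + 19*t + 1)^3 \<noteq> 0" if "t = 0" for t :: complex
      unfolding that by simp
  qed (simp_all add: p_fun_def g10_fun_def)
  \<comment> \<open>The inner fraction is meaningful where \<open>f t + 9\<close> is nonzero, in
    particular near 0. A general \<open>f\<close> serves the levels 6, 12 and 18 at once.\<close>
  have E6: "\<forall>\<^sub>F t in nhds 0. a_fun (f t * (f t + 8)^3 / (f t + 9)) = 12^3 * (f t * (f t + 8)^3 * (f t + 9)^2) / p_fun (f t) ^ 3"
    if "isCont f 0" "f 0 = 0" for f :: "complex \<Rightarrow> complex"
  proof -
    have "\<forall>\<^sub>F t in nhds 0. f t + 9 \<noteq> 0"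
      using that by (intro eventually_nonzero_at_0 continuous_intros) auto
    thus ?thesis by eventually_elim (rule a_fun_level_6)
  qed
  have E10: "\<forall>\<^sub>F t in nhds 0. a_fun (t * (t + 4)^5 / (t + 5)) = 12^3 * (t * (t + 4)^5 * (t + 5)^2) / g10_fun t ^ 3"
  proof -
    have "\<forall>\<^sub>F t in nhds 0. t + 5 \<noteq> (0 :: complex)"
      by (intro eventually_nonzero_at_0 continuous_intros) auto
    thus ?thesis by eventually_elim (rule a_fun_level_10)
  qed
  have same6: "a_fun (u * (u + 8)^3 / (u + 9)) = b_fun (u * (u + 9)^2 / (u + 8))" if "(u + 9) * (u + 8) \<noteq> 0" for u
    using that by (simp add: a_fun_level_6 b_fun_level_6)
  show ?thesis
  proof (intro conjI)
    show "(\<forall>\<^sub>F t in nhds 0. h_fun (P 2) (Q 2) t =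
        (1/16 * (t + 16)) powr (-1/4) * hyp_F (a_fun t))"
      using h2 by (rule eventually_mono) (simp only: a_fun_def c_fun_def o_apply)
    show "(\<forall>\<^sub>F t in nhds 0. h_fun (P 3) (Q 3) t =
        (1/3^6 * ((t + 27) * (t + 3)^3)) powr (-1/12) * hyp_F (b_fun t))"
      by (intro always_eventually allI) (simp only: h3 b_fun_def o_apply)
    show "(\<forall>\<^sub>F t in nhds 0. h_fun (P 4) (Q 4) t =
        (1/16 * ((\<lambda>t. t + 16) \<circ> (\<lambda>t. t * (t + 16))) t) powr (-1/4)
        * hyp_F ((a_fun \<circ> (\<lambda>t. t * (t + 16))) t))"
      using h4 by (rule eventually_mono) (simp only: a_fun_def c_fun_def o_apply)
    show "(\<forall>\<^sub>F t in nhds 0. h_fun (P 5) (Q 5) t =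
        (1/5 * (t^2 + 10*t + 5)) powr (-1/4) * hyp_F (c_fun t))"
      using h5 by (rule eventually_mono) (simp only: a_fun_def c_fun_def o_apply)
    show "same_ratfun (a_fun \<circ> (\<lambda>t. t * (t + 8)^3 / (t + 9))) (b_fun \<circ> (\<lambda>t. t * (t + 9)^2 / (t + 8)))"
    proof (rule same_ratfunI[where p = "[:9, 1:] * [:8, 1:]"])
      fix t :: complex assume that: "poly ([:9, 1:] * [:8, 1:]) t \<noteq> 0"
      hence "(t + 9) * (t + 8) \<noteq> 0" by (simp add: eval_nat_numeral algebra_simps)
      from same6[OF this] show "(a_fun \<circ> (\<lambda>t. t * (t + 8)^3 / (t + 9))) t = (b_fun \<circ> (\<lambda>t. t * (t + 9)^2 / (t + 8))) t" by (simp only: o_apply)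
    qed simp
    show "(\<forall>\<^sub>F t in nhds 0. h_fun (P 6) (Q 6) t =
        (1/144 * p_fun t) powr (-1/4)
        * hyp_F ((a_fun \<circ> (\<lambda>t. t * (t + 8)^3 / (t + 9))) t))"
    proof -
      have "isCont (\<lambda>t::complex. t) 0" by (intro continuous_intros)
      from E6[OF this] have "\<forall>\<^sub>F t in nhds 0. a_fun ((t) * ((t) + 8)^3 / ((t) + 9)) = 12^3 * ((t) * ((t) + 8)^3 * ((t) + 9)^2) / p_fun (t) ^ 3" by simp
      with h6 show ?thesis by eventually_elim (simp only: o_apply)
    qed
    show "(\<forall>\<^sub>F t in nhds 0. h_fun (P 7) (Q 7) t =
        (1/49 * ((t^2 + 13*t + 49) * (t^2 + 5*t + 1)^3)) powr (-1/12)
        * hyp_F (12^3 * t / ((t^2 + 13*t + 49) * (t^2 + 5*t + 1)^3)))"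
      by (intro always_eventually allI) (simp only: h7 b_fun_def o_apply)
    show "(\<forall>\<^sub>F t in nhds 0. h_fun (P 8) (Q 8) t =
        (1/16 * ((\<lambda>t. t + 16) \<circ> (\<lambda>t. t * (t + 16)) \<circ> (\<lambda>t. t * (t + 8))) t) powr (-1/4)
        * hyp_F ((a_fun \<circ> (\<lambda>t. t * (t + 16)) \<circ> (\<lambda>t. t * (t + 8))) t))"
      using h8 by (rule eventually_mono) (simp only: a_fun_def c_fun_def o_apply)
    show "(\<forall>\<^sub>F t in nhds 0. h_fun (P 9) (Q 9) t =
        (1/3^6 * ((\<lambda>t. (t + 27) * (t + 3)^3) \<circ> (\<lambda>t. t * (t^2 + 9*t + 27))) t) powr (-1/12)
        * hyp_F ((b_fun \<circ> (\<lambda>t. t * (t^2 + 9*t + 27))) t))"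
      by (intro always_eventually allI) (simp only: h9 b_fun_def o_apply)
    show "same_ratfun (a_fun \<circ> (\<lambda>t. t * (t + 4)^5 / (t + 5))) (c_fun \<circ> (\<lambda>t. t * (t + 5)^2 / (t + 4)))"
    proof (rule same_ratfunI[where p = "[:5, 1:] * [:4, 1:]"])
      fix t :: complex assume that: "poly ([:5, 1:] * [:4, 1:]) t \<noteq> 0"
      hence "(t + 5) * (t + 4) \<noteq> 0" by (simp add: algebra_simps)
      hence "t + 5 \<noteq> 0" "t + 4 \<noteq> 0" by (auto simp only: mult_eq_0_iff)
      thus "(a_fun \<circ> (\<lambda>t. t * (t + 4)^5 / (t + 5))) t = (c_fun \<circ> (\<lambda>t. t * (t + 5)^2 / (t + 4))) t" by (simp only: o_apply a_fun_level_10 c_fun_level_10 simp_thms)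
    qed simp
    show "(\<forall>\<^sub>F t in nhds 0. h_fun (P 10) (Q 10) t =
        (1/80 * (t^6 + 20*t^5 + 160*t^4 + 640*t^3 + 1280*t^2 + 1040*t + 80)) powr (-1/4)
        * hyp_F ((a_fun \<circ> (\<lambda>t. t * (t + 4)^5 / (t + 5))) t))"
      using h10 E10 by eventually_elim (simp only: o_apply g10_fun_def)
    show "same_ratfun (a_fun \<circ> (\<lambda>t. t * (t + 8)^3 / (t + 9)) \<circ> (\<lambda>t. t * (t + 6)))
                 (b_fun \<circ> (\<lambda>t. t * (t + 9)^2 / (t + 8)) \<circ> (\<lambda>t. t * (t + 6)))"
    proof (rule same_ratfunI[where p = "[:9, 6, 1:] * [:8, 6, 1:]"])
      fix t :: complex assume that: "poly ([:9, 6, 1:] * [:8, 6, 1:]) t \<noteq> 0"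
      hence "(t * (t + 6) + 9) * (t * (t + 6) + 8) \<noteq> 0" by (simp add: eval_nat_numeral algebra_simps)
      from same6[OF this] show "(a_fun \<circ> (\<lambda>t. t * (t + 8)^3 / (t + 9)) \<circ> (\<lambda>t. t * (t + 6))) t = (b_fun \<circ> (\<lambda>t. t * (t + 9)^2 / (t + 8)) \<circ> (\<lambda>t. t * (t + 6))) t" by (simp only: o_apply)
    qed simp
    show "same_ratfun (b_fun \<circ> (\<lambda>t. t * (t + 9)^2 / (t + 8)) \<circ> (\<lambda>t. t * (t + 6)))
                 (a_fun \<circ> (\<lambda>t. t * (t + 16)) \<circ> (\<lambda>t. t * (t + 4)^3 / (t + 3)))"
    \<comment> \<open>The excluded points are -3 and the zeros of \<open>t (t + 6) + 9\<close> and
      \<open>t (t + 6) + 8\<close>, where one of the inner fractions has denominator 0.\<close>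
    proof (rule same_ratfunI[where p = "[:3, 1:] * ([:9, 6, 1:] * [:8, 6, 1:])"])
      fix t :: complex assume "poly ([:3, 1:] * ([:9, 6, 1:] * [:8, 6, 1:])) t \<noteq> 0"
      hence "(t + 3) * ((t * (t + 6) + 9) * (t * (t + 6) + 8)) \<noteq> 0" by (simp add: algebra_simps)
      hence "t + 3 \<noteq> 0" "(t * (t + 6) + 9) * (t * (t + 6) + 8) \<noteq> 0" by (auto simp only: mult_eq_0_iff)
      thus "(b_fun \<circ> (\<lambda>t. t * (t + 9)^2 / (t + 8)) \<circ> (\<lambda>t. t * (t + 6))) t = (a_fun \<circ> (\<lambda>t. t * (t + 16)) \<circ> (\<lambda>t. t * (t + 4)^3 / (t + 3))) t"
        by (simp only: o_apply level_12_argument same6 simp_thms)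
    qed simp
    show "(\<forall>\<^sub>F t in nhds 0. h_fun (P 12) (Q 12) t =
        (1/144 * (p_fun \<circ> (\<lambda>t. t * (t + 6))) t) powr (-1/4)
        * hyp_F ((a_fun \<circ> (\<lambda>t. t * (t + 8)^3 / (t + 9)) \<circ> (\<lambda>t. t * (t + 6))) t))"
    proof -
      have "isCont (\<lambda>t::complex. t * (t + 6)) 0" by (intro continuous_intros)
      from E6[OF this] have "\<forall>\<^sub>F t in nhds 0. a_fun ((t * (t + 6)) * ((t * (t + 6)) + 8)^3 / ((t * (t + 6)) + 9)) = 12^3 * ((t * (t + 6)) * ((t * (t + 6)) + 8)^3 * ((t * (t + 6)) + 9)^2) / p_fun (t * (t + 6)) ^ 3" by simp
      with h12 show ?thesis by eventually_elim (simp only: o_apply)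
    qed
    show "(\<forall>\<^sub>F t in nhds 0. h_fun (P 13) (Q 13) t =
        (1/13 * ((t^2 + 5*t + 13) * (t^4 + 7*t^3 + 20*t^2 + 19*t + 1)^3)) powr (-1/12)
        * hyp_F (12^3 * t / ((t^2 + 5*t + 13) * (t^4 + 7*t^3 + 20*t^2 + 19*t + 1)^3)))"
      by (intro always_eventually allI) (simp only: h13 b_fun_def o_apply)
    show "(\<forall>\<^sub>F t in nhds 0. h_fun (P 16) (Q 16) t =
        (1/16 * ((\<lambda>t. t + 16) \<circ> (\<lambda>t. t * (t + 16)) \<circ> (\<lambda>t. t * (t + 8)) \<circ> (\<lambda>t. t * (t + 4))) t) powr (-1/4)
        * hyp_F ((a_fun \<circ> (\<lambda>t. t * (t + 16)) \<circ> (\<lambda>t. t * (t + 8)) \<circ> (\<lambda>t. t * (t + 4))) t))"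
      using h16 by (rule eventually_mono) (simp only: a_fun_def c_fun_def o_apply)
    show "same_ratfun (a_fun \<circ> (\<lambda>t. t * (t + 8)^3 / (t + 9)) \<circ> (\<lambda>t. t * (t^2 + 6*t + 12)))
                 (b_fun \<circ> (\<lambda>t. t * (t + 9)^2 / (t + 8)) \<circ> (\<lambda>t. t * (t^2 + 6*t + 12)))"
    proof (rule same_ratfunI[where p = "[:9, 12, 6, 1:] * [:8, 12, 6, 1:]"])
      fix t :: complex assume that: "poly ([:9, 12, 6, 1:] * [:8, 12, 6, 1:]) t \<noteq> 0"
      hence "(t * (t^2 + 6*t + 12) + 9) * (t * (t^2 + 6*t + 12) + 8) \<noteq> 0" by (simp add: eval_nat_numeral algebra_simps)
      from same6[OF this] show "(a_fun \<circ> (\<lambda>t. t * (t + 8)^3 / (t + 9)) \<circ> (\<lambda>t. t * (t^2 + 6*t + 12))) t = (b_fun \<circ> (\<lambda>t. t * (t + 9)^2 / (t + 8)) \<circ> (\<lambda>t. t * (t^2 + 6*t + 12))) t" by (simp only: o_apply)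
    qed simp
    show "same_ratfun (b_fun \<circ> (\<lambda>t. t * (t + 9)^2 / (t + 8)) \<circ> (\<lambda>t. t * (t^2 + 6*t + 12)))
                 (b_fun \<circ> (\<lambda>t. t * (t^2 + 9*t + 27)) \<circ> (\<lambda>t. t * (t + 3)^2 / (t + 2)))"
    \<comment> \<open>The inner arguments of \<open>b_fun\<close> already agree off -2, and
      \<open>u + 8 = (t + 2)^3\<close> vanishes nowhere else.\<close>
    proof (rule same_ratfunI[where p = "[:2, 1:]"])
      fix t :: complex assume "poly [:2, 1:] t \<noteq> 0"
      hence "t + 2 \<noteq> 0" by (simp add: add.commute)
      from level_18_argument[OF this] show "(b_fun \<circ> (\<lambda>t. t * (t + 9)^2 / (t + 8)) \<circ> (\<lambda>t. t * (t^2 + 6*t + 12))) t = (b_fun \<circ> (\<lambda>t. t * (t^2 + 9*t + 27)) \<circ> (\<lambda>t. t * (t + 3)^2 / (t + 2))) t"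
        by (simp only: o_apply)
    qed simp
    show "(\<forall>\<^sub>F t in nhds 0. h_fun (P 18) (Q 18) t =
        (1/144 * (p_fun \<circ> (\<lambda>t. t * (t^2 + 6*t + 12))) t) powr (-1/4)
        * hyp_F ((a_fun \<circ> (\<lambda>t. t * (t + 8)^3 / (t + 9)) \<circ> (\<lambda>t. t * (t^2 + 6*t + 12))) t))"
    proof -
      have "isCont (\<lambda>t::complex. t * (t^2 + 6*t + 12)) 0" by (intro continuous_intros)
      from E6[OF this] have "\<forall>\<^sub>F t in nhds 0. a_fun ((t * (t^2 + 6*t + 12)) * ((t * (t^2 + 6*t + 12)) + 8)^3 / ((t * (t^2 + 6*t + 12)) + 9)) = 12^3 * ((t * (t^2 + 6*t + 12)) * ((t * (t^2 + 6*t + 12)) + 8)^3 * ((t * (t^2 + 6*t + 12)) + 9)^2) / p_fun (t * (t^2 + 6*t + 12)) ^ 3" by simp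
      with h18 show ?thesis by eventually_elim (simp only: o_apply)
    qed
    show "(\<forall>\<^sub>F t in nhds 0. h_fun (P 25) (Q 25) t =
        (1/5 * ((\<lambda>t. t^2 + 10*t + 5) \<circ> (\<lambda>t. t * (t^4 + 5*t^3 + 15*t^2 + 25*t + 25))) t) powr (-1/4)
        * hyp_F ((c_fun \<circ> (\<lambda>t. t * (t^4 + 5*t^3 + 15*t^2 + 25*t + 25))) t))"
      using h25 by (rule eventually_mono) (simp only: a_fun_def c_fun_def o_apply)
  qed
qed

end
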